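(* Let $X$ be a quandle, $(D_X,\rho_{+\leftrightarrow -})$ its symmetric double, and $Y$ an $X$-set, regarded also as a $(D_X,\rho_{+\leftrightarrow -})$-set. Let $(D,o)$ be a diagram of an oriented link and take $[C]_{\rm ori}\in{\rm Col}_{(D_X,\rho_{+\leftrightarrow -})_Y}(D)/\!\sim_{\rm ori}$ such that $o$ is the orientation induced by the canonical form of $(D,C)$. Then there exists a one-to-one correspondence between ${\rm Col}_{X_Y}(D,o)$ and $[C]_{\rm ori}$, and thus \[\#{\rm Col}_{X_Y}(D,o)=\#[C]_{\rm ori}.\]
   Context: Quandles. A quandle $(X,* )$ is a set $X$ with a binary operation $*$ such that (Q1) $x*x=x$; (Q2) for all $x,y\in X$ there is a unique $z\in X$ with $z*y=x$, denoted $z=x*y^{-1}$; (Q3) $(x*y)*z=(x*z)*(y*z)$. Write $x*y^{+1}=x*y$. A good involution of $X$ is an involution $\rho:X\to X$ with $\rho(x*y)=\rho(x)*y$ and $x*\rho(y)=x*y^{-1}$; the pair $(X,\rho)$ is then a symmetric quandle. The symmetric double of $(X,* )$ is the symmetric quandle $(D_X,\rho_{+\leftrightarrow -})$ with $D_X=X^{+1}\sqcup X^{-1}$, where $X^{\varepsilon}=\{x^{\varepsilon}\mid x\in X\}$ are two copies of $X$, operation $x^{\varepsilon}\star y^{\delta}=(x*y^{\delta})^{\varepsilon}$ and $\rho_{+\leftrightarrow -}(x^{\varepsilon})=x^{-\varepsilon}$. Sets with action. $G_X=\langle x\in X\mid x*y=y^{-1}xy\ (x,y\in X)\rangle$; an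 $X$-set is a set $Y$ with a right action of $G_X$, written $r*g$. For a symmetric quandle, $G_{(X,\rho)}=\langle x\in X\mid x*y=y^{-1}xy,\ \rho(x)=x^{-1}\ (x,y\in X)\rangle$; an $(X,\rho)$-set is a set with a right action of $G_{(X,\rho)}$. An $X$-set $Y$ is a $(D_X,\rho_{+\leftrightarrow -})$-set via $r\star g=r*\pi(g)$, where $\pi:G_{(D_X,\rho_{+\leftrightarrow -})}\to G_X$ is the homomorphism sending the generator $x^{\varepsilon}$ to $x^{\varepsilon}\in G_X$ (i.e. $x$ or its inverse). Diagrams. A link is a disjoint union of circles embedded in $\mathbb R^3$; a diagram $D$ is its image under a generic projection to $\mathbb R^2$ with over/under information at crossings, shown by removing neighborhoods of the lower crossing points. Arcs of $D$ are the connected components of the resulting figure; semi-arcs are the connected components left after removing neighborhoods of all crossings; complementary regions are the connected regions into which the diagram separates $\mathbb R^2$. If $D$ has orientation $o$, each arc gets the normal orientation $n$ such that $(o,n)$ is the right-handed orientation of $\mathbb R^2$. $X_Y$-colorings. An $X$-coloring of an oriented diagram $(D,o)$ assigns an element of $X$ to each arc so that at each crossing, if the under-arcs $\alpha_1,\alpha_2$ have labels $x_1,x_2$, the over-arc has label $x_3$, and the normal orientation of the over-arc points from $\alpha_1$ to $\alpha_2$, then $x_1*x_3=x_2$. An $X_Y$-coloring is an $X$-coloring together with an assignment of an element of $Y$ to each complementary region such that if regions $\gamma_1,\gamma_2$ with labels $r_1,r_2$ are adjacent over an arc labeled $x$ whose normal orientation points from $\gamma_1$ to $\gamma_2$, then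 $r_1*x=r_2$. ${\rm Col}_{X_Y}(D,o)$ is the set of $X_Y$-colorings. $(X,\rho)_Y$-colorings. For a symmetric quandle $(X,\rho)$, an $(X,\rho)$-coloring of an unoriented diagram $D$ is an equivalence class of assignments of a normal orientation and an element of $X$ to each semi-arc such that at each crossing: (i) if the two over-semi-arcs have labels $x_1,x_2$, then $x_1=x_2$ if their normal orientations are coherent and $x_1=\rho(x_2)$ otherwise; (ii) if the under-semi-arcs $\alpha_1,\alpha_2$ have labels $x_1,x_2$, one of the over-semi-arcs has label $x_3$ and its normal orientation points from $\alpha_1$ to $\alpha_2$, then $x_1*x_3=x_2$ if the normal orientations of $\alpha_1,\alpha_2$ are coherent, and $x_1*x_3=\rho(x_2)$ otherwise. The equivalence relation is generated by basic inversions: reversing the normal orientation of a semi-arc and replacing its label $x$ by $\rho(x)$. For an $(X,\rho)$-set $Y$, an $(X,\rho)_Y$-coloring is an $(X,\rho)$-coloring with an assignment of an element of $Y$ to each complementary region such that if regions $\gamma_1,\gamma_2$ with labels $r_1,r_2$ are adjacent over a semi-arc labeled $x$ whose normal orientation points from $\gamma_1$ to $\gamma_2$, then $r_1*x=r_2$. ${\rm Col}_{(X,\rho)_Y}(D)$ is the set of $(X,\rho)_Y$-colorings. Canonical form. Every $(D_X,\rho_{+\leftrightarrow -})_Y$-coloring $C$ of $D$ is represented by a unique assignment in which all semi-arc labels lie in $X^{+1}$, the canonical form of $C$ (or of $(D,C)$). Its normal orientations are coherent along each component of the link; giving each semi-arc the orientation $o_\alpha$ such that $(o_\alpha,n_\alpha)$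 is right-handed, with $n_\alpha$ the normal orientation in the canonical form, yields an orientation of $D$, called the orientation induced by the canonical form of $(D,C)$. Two colorings satisfy $C\sim_{\rm ori}C'$ if their canonical forms induce the same orientation of $D$; $[C]_{\rm ori}$ is the equivalence class of $C$, a subset of ${\rm Col}_{(D_X,\rho_{+\leftrightarrow -})_Y}(D)$. $\#$ denotes cardinality. *)

theory Defs
  imports "HOL-Analysis.Analysis" "HOL-Algebra.Group"
begin

section \<open>Quandles and symmetric quandles\<close>

definition quandle :: "'a set \<Rightarrow> ('a \<Rightarrow> 'a \<Rightarrow> 'a) \<Rightarrow> bool" where
  "quandle X f \<longleftrightarrow>
     (\<forall>x\<in>X. \<forall>y\<in>X. f x y \<in> X) \<and>
     (\<forall>x\<in>X. f x x = x) \<and>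
     (\<forall>x\<in>X. \<forall>y\<in>X. \<exists>!z. z \<in> X \<and> f z y = x) \<and>
     (\<forall>x\<in>X. \<forall>y\<in>X. \<forall>z\<in>X. f (f x y) z = f (f x z) (f y z))"

text \<open>The sign \<open>+1\<close> is \<open>True\<close> and \<open>-1\<close> is \<open>False\<close>: this is the element \<open>x * y\<^sup>e\<close>.\<close>

definition quandle_pow :: "'a set \<Rightarrow> ('a \<Rightarrow> 'a \<Rightarrow> 'a) \<Rightarrow> 'a \<Rightarrow> 'a \<Rightarrow> bool \<Rightarrow> 'a" where
  "quandle_pow X f x y e = (if e then f x y else (THE z. z \<in> X \<and> f z y = x))"

definition good_involution :: "'a set \<Rightarrow> ('a \<Rightarrow> 'a \<Rightarrow> 'a) \<Rightarrow> ('a \<Rightarrow> 'a) \<Rightarrow> bool" where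
  "good_involution X f \<rho> \<longleftrightarrow>
     (\<forall>x\<in>X. \<rho> x \<in> X \<and> \<rho> (\<rho> x) = x) \<and>
     (\<forall>x\<in>X. \<forall>y\<in>X. \<rho> (f x y) = f (\<rho> x) y \<and> f x (\<rho> y) = quandle_pow X f x y False)"

definition symmetric_quandle :: "'a set \<Rightarrow> ('a \<Rightarrow> 'a \<Rightarrow> 'a) \<Rightarrow> ('a \<Rightarrow> 'a) \<Rightarrow> bool" where
  "symmetric_quandle X f \<rho> \<longleftrightarrow> quandle X f \<and> good_involution X f \<rho>"

definition double_carrier :: "'a set \<Rightarrow> ('a \<times> bool) set" where
  "double_carrier X = X \<times> UNIV"

definition double_op :: "'a set \<Rightarrow> ('a \<Rightarrow> 'a \<Rightarrow> 'a) \<Rightarrow> 'a \<times> bool \<Rightarrow> 'a \<times> bool \<Rightarrow> 'a \<times> bool" where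
  "double_op X f = (\<lambda>(x, e) (y, d). (quandle_pow X f x y d, e))"

definition double_inv :: "'a \<times> bool \<Rightarrow> 'a \<times> bool" where
  "double_inv = (\<lambda>(x, e). (x, \<not> e))"

lemma quandle_pow_False:
  assumes "quandle X f" "x \<in> X" "y \<in> X"
  shows "quandle_pow X f x y False \<in> X" "f (quandle_pow X f x y False) y = x"
proof -
  have "\<exists>!z. z \<in> X \<and> f z y = x" using assms by (simp add: quandle_def)
  from theI'[OF this] show "quandle_pow X f x y False \<in> X" "f (quandle_pow X f x y False) y = x"
    by (simp_all add: quandle_pow_def)
qed

lemma quandle_cancel:
  assumes "quandle X f" "x \<in> X" "x' \<in> X" "y \<in> X" "f x y = f x' y"
  shows "x = x'"
proof -
  have "\<exists>!z. z \<in> X \<and> f z y = f x y" using assms by (simp add: quandle_def)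
  then show ?thesis using assms by metis
qed

lemma quandle_pow_eqI:
  assumes "quandle X f" "z \<in> X" "x \<in> X" "y \<in> X" "f z y = x"
  shows "quandle_pow X f x y False = z"
  using assms quandle_pow_False[OF assms(1,3,4)] quandle_cancel by metis

lemma symmetric_quandle_double:
  assumes q: "quandle X f"
  shows "symmetric_quandle (double_carrier X) (double_op X f) double_inv"
proof -
  have cl: "f x y \<in> X" if "x \<in> X" "y \<in> X" for x y using q that by (simp add: quandle_def)
  have idem: "f x x = x" if "x \<in> X" for x using q that by (simp add: quandle_def)
  have dist: "f (f x y) z = f (f x z) (f y z)" if "x \<in> X" "y \<in> X" "z \<in> X" for x y z
    using q that unfolding quandle_def by blast
  have T: "quandle_pow X f x y True = f x y" for x y by (simp add: quandle_pow_def)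
  note F = quandle_pow_False[OF q]
  have pcl: "quandle_pow X f x y e \<in> X" if "x \<in> X" "y \<in> X" for x y e
    using that cl F by (cases e) (simp_all add: T)
  have FI: "quandle_pow X f (f x y) y False = x" if "x \<in> X" "y \<in> X" for x y
    by (rule quandle_pow_eqI[OF q]) (use that cl in auto)
  have pidem: "quandle_pow X f x x e = x" if "x \<in> X" for x e
    using that idem by (cases e) (simp_all add: T quandle_pow_eqI[OF q])
  have pinv: "quandle_pow X f (quandle_pow X f x y e) y (\<not> e) = x" if "x \<in> X" "y \<in> X" for x y e
    using that F FI by (cases e) (simp_all add: T)
  have TF: "f (quandle_pow X f x y False) z = quandle_pow X f (f x z) (f y z) False"
    if "x \<in> X" "y \<in> X" "z \<in> X" for x y z
  proof -
    have "f (f (quandle_pow X f x y False) z) (f y z) = f x z"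
      using dist[OF F(1)[OF that(1,2)] that(2,3)] F(2)[OF that(1,2)] by simp
    then show ?thesis
      using quandle_pow_eqI[OF q cl[OF F(1)[OF that(1,2)] that(3)] cl[OF that(1,3)] cl[OF that(2,3)]]
      by simp
  qed
  have T': "f (quandle_pow X f x y d) z = quandle_pow X f (f x z) (f y z) d"
    if "x \<in> X" "y \<in> X" "z \<in> X" for x y z d
    using TF[OF that] dist[OF that] by (cases d) (simp_all add: T)
  have F': "quandle_pow X f (quandle_pow X f x y d) z False =
      quandle_pow X f (quandle_pow X f x z False) (quandle_pow X f y z False) d"
    if "x \<in> X" "y \<in> X" "z \<in> X" for x y z d
  proof (rule quandle_pow_eqI[OF q])
    show "f (quandle_pow X f (quandle_pow X f x z False) (quandle_pow X f y z False) d) z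
        = quandle_pow X f x y d"
      using T'[OF F(1)[OF that(1,3)] F(1)[OF that(2,3)] that(3), of d]
        F(2)[OF that(1,3)] F(2)[OF that(2,3)] by simp
  qed (use that pcl in auto)
  have pdist: "quandle_pow X f (quandle_pow X f x y d) z e =
      quandle_pow X f (quandle_pow X f x z e) (quandle_pow X f y z e) d"
    if "x \<in> X" "y \<in> X" "z \<in> X" for x y z d e
    using F'[OF that] T'[OF that] by (cases e) (simp_all add: T)
  have Q: "quandle (double_carrier X) (double_op X f)"
    unfolding quandle_def
  proof (intro conjI ballI)
    fix a b assume ab: "a \<in> double_carrier X" "b \<in> double_carrier X"
    obtain x e y d where [simp]: "a = (x, e)" "b = (y, d)" by (metis surj_pair)
    have xy: "x \<in> X" "y \<in> X" using ab by (auto simp: double_carrier_def)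
    show "\<exists>!z. z \<in> double_carrier X \<and> double_op X f z b = a"
    proof (rule ex1I[of _ "(quandle_pow X f x y (\<not> d), e)"])
      show "(quandle_pow X f x y (\<not> d), e) \<in> double_carrier X \<and>
          double_op X f (quandle_pow X f x y (\<not> d), e) b = a"
        using xy pcl pinv[of x y "\<not> d"] by (simp add: double_carrier_def double_op_def)
    next
      fix z assume "z \<in> double_carrier X \<and> double_op X f z b = a"
      then show "z = (quandle_pow X f x y (\<not> d), e)"
        using xy pinv by (cases z) (auto simp: double_carrier_def double_op_def)
    qed
  next
    fix a b c assume abc: "a \<in> double_carrier X" "b \<in> double_carrier X" "c \<in> double_carrier X"
    obtain x e y d z h where [simp]: "a = (x, e)" "b = (y, d)" "c = (z, h)" by (metis surj_pair)
    have "x \<in> X" "y \<in> X" "z \<in> X" using abc by (auto simp: double_carrier_def)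
    from pdist[OF this] show "double_op X f (double_op X f a b) c =
        double_op X f (double_op X f a c) (double_op X f b c)"
      by (simp add: double_op_def)
  qed (auto simp: double_carrier_def double_op_def pcl pidem)
  moreover have "good_involution (double_carrier X) (double_op X f) double_inv"
    unfolding good_involution_def
  proof (intro conjI ballI)
    fix a b assume ab: "a \<in> double_carrier X" "b \<in> double_carrier X"
    obtain x e y d where [simp]: "a = (x, e)" "b = (y, d)" by (metis surj_pair)
    have xy: "x \<in> X" "y \<in> X" using ab by (auto simp: double_carrier_def)
    show "double_op X f a (double_inv b) = quandle_pow (double_carrier X) (double_op X f) a b False"
      by (rule quandle_pow_eqI[OF Q, symmetric])
        (use xy pcl pinv[of x y "\<not> d"] ab in
          \<open>auto simp: double_carrier_def double_op_def double_inv_def\<close>)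
  qed (auto simp: double_carrier_def double_op_def double_inv_def)
  ultimately show ?thesis by (simp add: symmetric_quandle_def)
qed

section \<open>Group presentations and sets with action\<close>

text \<open>A letter \<open>(x, True)\<close> is the generator \<open>x\<close>, and \<open>(x, False)\<close> is its inverse. Elements of the
  group presented by generators \<open>S\<close> and relations \<open>u = v\<close> for \<open>(u, v) \<in> R\<close> are classes of words.\<close>

type_synonym 'a word = "('a \<times> bool) list"

inductive word_eq :: "'a set \<Rightarrow> ('a word \<times> 'a word) set \<Rightarrow> 'a word \<Rightarrow> 'a word \<Rightarrow> bool"
  for S R where
  refl: "w \<in> lists (S \<times> UNIV) \<Longrightarrow> word_eq S R w w"
| cancel: "x \<in> S \<Longrightarrow> word_eq S R [(x, b), (x, \<not> b)] []"
| rel: "(u, v) \<in> R \<Longrightarrow> u \<in> lists (S \<times> UNIV) \<Longrightarrow> v \<in> lists (S \<times> UNIV) \<Longrightarrow> word_eq S R u v"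
| sym: "word_eq S R u v \<Longrightarrow> word_eq S R v u"
| trans: "word_eq S R u v \<Longrightarrow> word_eq S R v w \<Longrightarrow> word_eq S R u w"
| append: "word_eq S R u u' \<Longrightarrow> word_eq S R v v' \<Longrightarrow> word_eq S R (u @ v) (u' @ v')"

definition word_class :: "'a set \<Rightarrow> ('a word \<times> 'a word) set \<Rightarrow> 'a word \<Rightarrow> 'a word set" where
  "word_class S R w = {v. word_eq S R w v}"

definition presented_group :: "'a set \<Rightarrow> ('a word \<times> 'a word) set \<Rightarrow> 'a word set monoid" where
  "presented_group S R =
     \<lparr>carrier = word_class S R ` lists (S \<times> UNIV),
      mult = (\<lambda>A B. {w. \<exists>u\<in>A. \<exists>v\<in>B. word_eq S R (u @ v) w}),
      one = word_class S R []\<rparr>"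

definition quandle_rels :: "'a set \<Rightarrow> ('a \<Rightarrow> 'a \<Rightarrow> 'a) \<Rightarrow> ('a word \<times> 'a word) set" where
  "quandle_rels X f =
     {([(f x y, True)], [(y, False), (x, True), (y, True)]) | x y. x \<in> X \<and> y \<in> X}"

definition sym_quandle_rels ::
    "'a set \<Rightarrow> ('a \<Rightarrow> 'a \<Rightarrow> 'a) \<Rightarrow> ('a \<Rightarrow> 'a) \<Rightarrow> ('a word \<times> 'a word) set" where
  "sym_quandle_rels X f \<rho> =
     quandle_rels X f \<union> {([(\<rho> x, True)], [(x, False)]) | x. x \<in> X}"

definition assoc_group :: "'a set \<Rightarrow> ('a \<Rightarrow> 'a \<Rightarrow> 'a) \<Rightarrow> 'a word set monoid" where
  "assoc_group X f = presented_group X (quandle_rels X f)"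

definition assoc_gen :: "'a set \<Rightarrow> ('a \<Rightarrow> 'a \<Rightarrow> 'a) \<Rightarrow> 'a \<Rightarrow> 'a word set" where
  "assoc_gen X f x = word_class X (quandle_rels X f) [(x, True)]"

definition sym_assoc_group ::
    "'a set \<Rightarrow> ('a \<Rightarrow> 'a \<Rightarrow> 'a) \<Rightarrow> ('a \<Rightarrow> 'a) \<Rightarrow> 'a word set monoid" where
  "sym_assoc_group X f \<rho> = presented_group X (sym_quandle_rels X f \<rho>)"

definition sym_assoc_gen ::
    "'a set \<Rightarrow> ('a \<Rightarrow> 'a \<Rightarrow> 'a) \<Rightarrow> ('a \<Rightarrow> 'a) \<Rightarrow> 'a \<Rightarrow> 'a word set" where
  "sym_assoc_gen X f \<rho> x = word_class X (sym_quandle_rels X f \<rho>) [(x, True)]"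

definition right_action :: "('g, 'm) monoid_scheme \<Rightarrow> 'y set \<Rightarrow> ('y \<Rightarrow> 'g \<Rightarrow> 'y) \<Rightarrow> bool" where
  "right_action G Y act \<longleftrightarrow>
     (\<forall>r\<in>Y. \<forall>g\<in>carrier G. act r g \<in> Y) \<and>
     (\<forall>r\<in>Y. act r \<one>\<^bsub>G\<^esub> = r) \<and>
     (\<forall>r\<in>Y. \<forall>g\<in>carrier G. \<forall>h\<in>carrier G. act r (g \<otimes>\<^bsub>G\<^esub> h) = act (act r g) h)"

text \<open>\<open>word_eval G \<phi> w\<close> substitutes \<open>\<phi> x\<close> for each generator \<open>x\<close> in the word \<open>w\<close>; applied to all
  words of a class it yields the homomorphism induced by \<open>\<phi>\<close> on a presented group.\<close>

definition word_eval :: "('g, 'm) monoid_scheme \<Rightarrow> ('a \<Rightarrow> 'g) \<Rightarrow> 'a word \<Rightarrow> 'g" where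
  "word_eval G \<phi> w =
     foldr (\<lambda>(x, b) g. (if b then \<phi> x else inv\<^bsub>G\<^esub> \<phi> x) \<otimes>\<^bsub>G\<^esub> g) w \<one>\<^bsub>G\<^esub>"

definition double_hom ::
    "'a set \<Rightarrow> ('a \<Rightarrow> 'a \<Rightarrow> 'a) \<Rightarrow> ('a \<times> bool) word set \<Rightarrow> 'a word set" where
  "double_hom X f c =
     the_elem (word_eval (assoc_group X f)
       (\<lambda>(x, e). if e then assoc_gen X f x else inv\<^bsub>assoc_group X f\<^esub> assoc_gen X f x) ` c)"

definition double_act ::
    "'a set \<Rightarrow> ('a \<Rightarrow> 'a \<Rightarrow> 'a) \<Rightarrow> ('y \<Rightarrow> 'a word set \<Rightarrow> 'y) \<Rightarrow> 'y \<Rightarrow> ('a \<times> bool) word set \<Rightarrow> 'y" where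
  "double_act X f act r g = act r (double_hom X f g)"

lemma word_eq_lists:
  "word_eq S R u v \<Longrightarrow> u \<in> lists (S \<times> UNIV) \<and> v \<in> lists (S \<times> UNIV)"
  by (induction rule: word_eq.induct) auto

lemma word_class_eq_iff:
  assumes "u \<in> lists (S \<times> UNIV)"
  shows "word_class S R u = word_class S R v \<longleftrightarrow> word_eq S R u v"
  using assms unfolding word_class_def by (blast intro: word_eq.intros)

lemma word_class_mult:
  assumes "u \<in> lists (S \<times> UNIV)" "v \<in> lists (S \<times> UNIV)"
  shows "word_class S R u \<otimes>\<^bsub>presented_group S R\<^esub> word_class S R v = word_class S R (u @ v)"
proof -
  have "(\<exists>u'. word_eq S R u u' \<and> (\<exists>v'. word_eq S R v v' \<and> word_eq S R (u' @ v') w)) \<longleftrightarrow>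
      word_eq S R (u @ v) w" for w
    using assms word_eq.refl word_eq.append word_eq.trans by metis
  then show ?thesis by (simp add: word_class_def presented_group_def Bex_def)
qed

lemma word_eq_inverse:
  assumes "w \<in> lists (S \<times> UNIV)"
  shows "word_eq S R (map (\<lambda>(x, b). (x, \<not> b)) (rev w) @ w) []"
  using assms
proof (induction w rule: list.induct)
  case Nil
  then show ?case by (simp add: word_eq.refl)
next
  case (Cons a w)
  obtain x b where a: "a = (x, b)" by force
  let ?r = "map (\<lambda>(x, b). (x, \<not> b)) (rev w)"
  have x: "x \<in> S" and w: "w \<in> lists (S \<times> UNIV)" using Cons.prems a by auto
  have IH: "word_eq S R (?r @ w) []" using Cons.IH w by simp
  have r: "?r \<in> lists (S \<times> UNIV)" using word_eq_lists[OF IH] by simp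
  have c: "word_eq S R [(x, \<not> b), (x, b)] []" using word_eq.cancel[OF x, of R "\<not> b"] by simp
  have "word_eq S R (?r @ ([(x, \<not> b), (x, b)] @ w)) (?r @ ([] @ w))"
    by (rule word_eq.append[OF word_eq.refl[OF r] word_eq.append[OF c word_eq.refl[OF w]]])
  then have "word_eq S R (?r @ ([(x, \<not> b), (x, b)] @ w)) []"
    using IH by (auto intro: word_eq.trans)
  then show ?case by (simp add: a)
qed

lemma group_presented_group: "group (presented_group S R)"
proof (rule groupI)
  have car: "carrier (presented_group S R) = word_class S R ` lists (S \<times> UNIV)"
    and one: "\<one>\<^bsub>presented_group S R\<^esub> = word_class S R []"
    by (simp_all add: presented_group_def)
  note [simp] = car one word_class_mult
  show "\<one>\<^bsub>presented_group S R\<^esub> \<in> carrier (presented_group S R)" by simp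
  fix A assume "A \<in> carrier (presented_group S R)"
  then obtain u where u: "A = word_class S R u" "u \<in> lists (S \<times> UNIV)" by auto
  show "\<one>\<^bsub>presented_group S R\<^esub> \<otimes>\<^bsub>presented_group S R\<^esub> A = A"
    using word_class_mult[of "[]" S u R] u by simp
  let ?r = "map (\<lambda>(x, b). (x, \<not> b)) (rev u)"
  have "?r @ u \<in> lists (S \<times> UNIV)" using word_eq_lists[OF word_eq_inverse[OF u(2)]] by blast
  then have r: "?r \<in> lists (S \<times> UNIV)" by simp
  moreover have "word_class S R ?r \<otimes>\<^bsub>presented_group S R\<^esub> A = \<one>\<^bsub>presented_group S R\<^esub>"
    unfolding u(1) one word_class_mult[OF r u(2)]
    using word_eq_inverse[OF u(2)] word_eq_lists word_class_eq_iff by metis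
  ultimately show "\<exists>y\<in>carrier (presented_group S R).
      y \<otimes>\<^bsub>presented_group S R\<^esub> A = \<one>\<^bsub>presented_group S R\<^esub>" unfolding car by blast
  fix B assume "B \<in> carrier (presented_group S R)"
  then obtain v where v: "B = word_class S R v" "v \<in> lists (S \<times> UNIV)" by auto
  show "A \<otimes>\<^bsub>presented_group S R\<^esub> B \<in> carrier (presented_group S R)"
    using u v by auto
  fix C assume "C \<in> carrier (presented_group S R)"
  then obtain w where w: "C = word_class S R w" "w \<in> lists (S \<times> UNIV)" by auto
  show "A \<otimes>\<^bsub>presented_group S R\<^esub> B \<otimes>\<^bsub>presented_group S R\<^esub> C =
      A \<otimes>\<^bsub>presented_group S R\<^esub> (B \<otimes>\<^bsub>presented_group S R\<^esub> C)"
    using u v w by simp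
qed

lemma word_eval_closed:
  assumes "group G" "\<And>x. x \<in> S \<Longrightarrow> \<phi> x \<in> carrier G" "w \<in> lists (S \<times> UNIV)"
  shows "word_eval G \<phi> w \<in> carrier G"
proof -
  interpret group G by fact
  from assms(3) show ?thesis
    by (induction w rule: list.induct) (auto simp: word_eval_def assms(2) split: prod.splits)
qed

lemma word_eval_append:
  assumes "group G" "\<And>x. x \<in> S \<Longrightarrow> \<phi> x \<in> carrier G"
    "u \<in> lists (S \<times> UNIV)" "v \<in> lists (S \<times> UNIV)"
  shows "word_eval G \<phi> (u @ v) = word_eval G \<phi> u \<otimes>\<^bsub>G\<^esub> word_eval G \<phi> v"
proof -
  interpret group G by fact
  have v: "word_eval G \<phi> v \<in> carrier G" by (rule word_eval_closed[OF assms(1,2,4)])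
  from assms(3) show ?thesis
  proof (induction u rule: list.induct)
    case Nil
    then show ?case using v by (simp add: word_eval_def)
  next
    case (Cons a u)
    obtain x b where a: "a = (x, b)" by force
    have x: "\<phi> x \<in> carrier G" and u: "u \<in> lists (S \<times> UNIV)" using Cons.prems a assms(2) by auto
    have "word_eval G \<phi> u \<in> carrier G" by (rule word_eval_closed[OF assms(1,2) u])
    moreover have "word_eval G \<phi> (a # w) = (if b then \<phi> x else inv\<^bsub>G\<^esub> \<phi> x) \<otimes>\<^bsub>G\<^esub> word_eval G \<phi> w" for w
      by (simp add: word_eval_def a)
    ultimately show ?case using Cons.IH u x v by (auto simp: m_assoc)
  qed
qed

lemma word_eval_cong:
  assumes "group G" "\<And>x. x \<in> S \<Longrightarrow> \<phi> x \<in> carrier G"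
    "\<And>u v. (u, v) \<in> R \<Longrightarrow> word_eval G \<phi> u = word_eval G \<phi> v" "word_eq S R u v"
  shows "word_eval G \<phi> u = word_eval G \<phi> v"
  using assms(4)
proof (induction rule: word_eq.induct)
  case (cancel x b)
  interpret group G by fact
  show ?case using assms(2)[OF cancel] by (cases b) (simp_all add: word_eval_def)
next
  case (append u u' v v')
  note l = word_eq_lists[OF append.hyps(1)] word_eq_lists[OF append.hyps(2)]
  have "word_eval G \<phi> (u @ v) = word_eval G \<phi> u \<otimes>\<^bsub>G\<^esub> word_eval G \<phi> v"
    using l by (intro word_eval_append[OF assms(1,2)]) blast+
  moreover have "word_eval G \<phi> (u' @ v') = word_eval G \<phi> u' \<otimes>\<^bsub>G\<^esub> word_eval G \<phi> v'"
    using l by (intro word_eval_append[OF assms(1,2)]) blast+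
  ultimately show ?case using append.IH by simp
next
  case (rel u v)
  then show ?case by (intro assms(3))
qed simp_all

lemma assoc_gen_closed: "x \<in> X \<Longrightarrow> assoc_gen X f x \<in> carrier (assoc_group X f)"
  by (auto simp: assoc_gen_def assoc_group_def presented_group_def)

lemma group_assoc_group: "group (assoc_group X f)"
  by (simp add: assoc_group_def group_presented_group)

lemma assoc_group_rel:
  assumes "quandle X f" "x \<in> X" "y \<in> X"
  shows "assoc_gen X f (f x y) =
    inv\<^bsub>assoc_group X f\<^esub> assoc_gen X f y \<otimes>\<^bsub>assoc_group X f\<^esub>
      (assoc_gen X f x \<otimes>\<^bsub>assoc_group X f\<^esub> assoc_gen X f y)"
proof -
  let ?R = "quandle_rels X f" and ?G = "assoc_group X f"
  interpret G: group ?G by (rule group_assoc_group)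
  have fxy: "f x y \<in> X" using assms by (simp add: quandle_def)
  have m: "word_class X ?R u \<otimes>\<^bsub>?G\<^esub> word_class X ?R v = word_class X ?R (u @ v)"
    if "u \<in> lists (X \<times> UNIV)" "v \<in> lists (X \<times> UNIV)" for u v
    using word_class_mult[OF that] by (simp add: assoc_group_def)
  have one: "\<one>\<^bsub>?G\<^esub> = word_class X ?R []" by (simp add: assoc_group_def presented_group_def)
  have car: "word_class X ?R [(y, b)] \<in> carrier ?G" for b
    using assms by (auto simp: assoc_group_def presented_group_def)
  have "word_class X ?R [(y, False)] \<otimes>\<^bsub>?G\<^esub> assoc_gen X f y = \<one>\<^bsub>?G\<^esub>"
    using assms word_eq.cancel[of y X ?R False]
    by (auto simp: assoc_gen_def m one word_class_eq_iff)
  then have i: "inv\<^bsub>?G\<^esub> assoc_gen X f y = word_class X ?R [(y, False)]"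
    using car assoc_gen_closed[OF assms(3), of f] by (metis G.inv_equality)
  have "word_eq X ?R [(f x y, True)] [(y, False), (x, True), (y, True)]"
    by (rule word_eq.rel) (use assms fxy in \<open>auto simp: quandle_rels_def\<close>)
  then show ?thesis
    using assms fxy unfolding i by (simp add: assoc_gen_def m word_class_eq_iff)
qed

text \<open>\<open>double_hom X f\<close> is well defined, and is the homomorphism sending the generator \<open>x\<^sup>e\<close> of the
  associated group of the symmetric double to \<open>x\<^sup>e\<close>.\<close>

lemma
  assumes q: "quandle X f"
  shows double_hom_hom:
      "double_hom X f \<in> hom (sym_assoc_group (double_carrier X) (double_op X f) double_inv) (assoc_group X f)"
    and double_hom_gen:
      "x \<in> X \<Longrightarrow> double_hom X f (sym_assoc_gen (double_carrier X) (double_op X f) double_inv (x, e)) =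
         (if e then assoc_gen X f x else inv\<^bsub>assoc_group X f\<^esub> assoc_gen X f x)"
proof -
  let ?D = "double_carrier X" and ?G = "assoc_group X f"
  let ?R = "sym_quandle_rels (double_carrier X) (double_op X f) double_inv"
  let ?\<phi> = "\<lambda>(x, e). if e then assoc_gen X f x else inv\<^bsub>?G\<^esub> assoc_gen X f x"
  interpret G: group ?G by (rule group_assoc_group)
  have gc: "x \<in> X \<Longrightarrow> assoc_gen X f x \<in> carrier ?G" for x by (rule assoc_gen_closed)
  have phi: "?\<phi> a \<in> carrier ?G" if "a \<in> ?D" for a
    using that gc by (auto simp: double_carrier_def)
  have cl: "f x y \<in> X" if "x \<in> X" "y \<in> X" for x y using q that by (simp add: quandle_def)
  have relT: "?\<phi> (quandle_pow X f x y d, True) =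
      inv\<^bsub>?G\<^esub> ?\<phi> (y, d) \<otimes>\<^bsub>?G\<^esub> (?\<phi> (x, True) \<otimes>\<^bsub>?G\<^esub> ?\<phi> (y, d))"
    if xy: "x \<in> X" "y \<in> X" for x y d
  proof (cases d)
    case True
    then show ?thesis using assoc_group_rel[OF q xy] by (simp add: quandle_pow_def)
  next
    case False
    let ?z = "quandle_pow X f x y False"
    have z: "?z \<in> X" "f ?z y = x" using quandle_pow_False[OF q xy] by auto
    have "assoc_gen X f x = inv\<^bsub>?G\<^esub> assoc_gen X f y \<otimes>\<^bsub>?G\<^esub> (assoc_gen X f ?z \<otimes>\<^bsub>?G\<^esub> assoc_gen X f y)"
      using assoc_group_rel[OF q z(1) xy(2)] z by simp
    then have "assoc_gen X f ?z = assoc_gen X f y \<otimes>\<^bsub>?G\<^esub> (assoc_gen X f x \<otimes>\<^bsub>?G\<^esub> inv\<^bsub>?G\<^esub> assoc_gen X f y)"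
      using gc[OF z(1)] gc[OF xy(2)] by (simp add: G.m_assoc flip: G.inv_solve_left)
    then show ?thesis using False gc[OF xy(2)] by simp
  qed
  have rel: "?\<phi> (double_op X f a b) = inv\<^bsub>?G\<^esub> ?\<phi> b \<otimes>\<^bsub>?G\<^esub> (?\<phi> a \<otimes>\<^bsub>?G\<^esub> ?\<phi> b)"
    if ab: "a \<in> ?D" "b \<in> ?D" for a b
  proof -
    obtain x e y d where [simp]: "a = (x, e)" "b = (y, d)" by (metis surj_pair)
    have xy: "x \<in> X" "y \<in> X" using ab by (auto simp: double_carrier_def)
    have b: "?\<phi> (y, d) \<in> carrier ?G" using phi[OF ab(2)] by simp
    have x: "assoc_gen X f x \<in> carrier ?G" using gc xy by simp
    show ?thesis
    proof (cases e)
      case True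
      then show ?thesis using relT[OF xy, of d] by (simp add: double_op_def)
    next
      case False
      have "inv\<^bsub>?G\<^esub> (inv\<^bsub>?G\<^esub> B \<otimes>\<^bsub>?G\<^esub> (A \<otimes>\<^bsub>?G\<^esub> B)) = inv\<^bsub>?G\<^esub> B \<otimes>\<^bsub>?G\<^esub> (inv\<^bsub>?G\<^esub> A \<otimes>\<^bsub>?G\<^esub> B)"
        if "A \<in> carrier ?G" "B \<in> carrier ?G" for A B
        using that by (simp add: G.inv_mult_group G.m_assoc)
      from this[OF x b] show ?thesis
        using False relT[OF xy, of d] by (simp add: double_op_def)
    qed
  qed
  have R: "word_eval ?G ?\<phi> u = word_eval ?G ?\<phi> v" if uv: "(u, v) \<in> ?R" for u v
  proof -
    from uv consider a b where "a \<in> ?D" "b \<in> ?D" "u = [(double_op X f a b, True)]"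
        "v = [(b, False), (a, True), (b, True)]"
      | a where "a \<in> ?D" "u = [(double_inv a, True)]" "v = [(a, False)]"
      unfolding sym_quandle_rels_def quandle_rels_def by auto
    then show ?thesis
    proof cases
      case 1
      have "double_op X f a b \<in> ?D"
        using symmetric_quandle_double[OF q] 1(1,2)
        unfolding symmetric_quandle_def quandle_def by blast
      then show ?thesis using 1 phi rel[OF 1(1,2)] by (simp add: word_eval_def)
    next
      case 2
      then show ?thesis using gc by (auto simp: word_eval_def double_inv_def double_carrier_def)
    qed
  qed
  have val: "double_hom X f (word_class ?D ?R w) = word_eval ?G ?\<phi> w"
    if w: "w \<in> lists (?D \<times> UNIV)" for w
  proof -
    have "word_eval ?G ?\<phi> v = word_eval ?G ?\<phi> w" if "v \<in> word_class ?D ?R w" for v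
    proof (rule word_eval_cong[OF group_assoc_group, symmetric])
      show "word_eq ?D ?R w v" using that by (simp add: word_class_def)
    qed (fact phi R)+
    moreover have "w \<in> word_class ?D ?R w"
      using word_eq.refl[OF w] by (simp add: word_class_def)
    ultimately have "word_eval ?G ?\<phi> ` word_class ?D ?R w = {word_eval ?G ?\<phi> w}" by blast
    then show ?thesis unfolding double_hom_def by simp
  qed
  show "double_hom X f \<in> hom (sym_assoc_group ?D (double_op X f) double_inv) ?G"
  proof (rule homI)
    fix A assume "A \<in> carrier (sym_assoc_group ?D (double_op X f) double_inv)"
    then obtain u where u: "A = word_class ?D ?R u" "u \<in> lists (?D \<times> UNIV)"
      by (auto simp: sym_assoc_group_def presented_group_def)
    show "double_hom X f A \<in> carrier ?G"
      unfolding u(1) val[OF u(2)] by (rule word_eval_closed[OF group_assoc_group phi u(2)])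
    fix B assume "B \<in> carrier (sym_assoc_group ?D (double_op X f) double_inv)"
    then obtain v where v: "B = word_class ?D ?R v" "v \<in> lists (?D \<times> UNIV)"
      by (auto simp: sym_assoc_group_def presented_group_def)
    have uv: "u @ v \<in> lists (?D \<times> UNIV)" using u(2) v(2) by simp
    show "double_hom X f (A \<otimes>\<^bsub>sym_assoc_group ?D (double_op X f) double_inv\<^esub> B)
        = double_hom X f A \<otimes>\<^bsub>?G\<^esub> double_hom X f B"
      unfolding sym_assoc_group_def u(1) v(1) word_class_mult[OF u(2) v(2)]
        val[OF u(2)] val[OF v(2)] val[OF uv]
      by (rule word_eval_append[OF group_assoc_group phi u(2) v(2)])
  qed
  show "double_hom X f (sym_assoc_gen ?D (double_op X f) double_inv (x, e)) =
      (if e then assoc_gen X f x else inv\<^bsub>?G\<^esub> assoc_gen X f x)" if "x \<in> X"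
  proof -
    have xe: "(x, e) \<in> ?D" using that by (simp add: double_carrier_def)
    have "double_hom X f (sym_assoc_gen ?D (double_op X f) double_inv (x, e)) =
        word_eval ?G ?\<phi> [((x, e), True)]"
      unfolding sym_assoc_gen_def by (rule val) (use xe in simp)
    also have "\<dots> = ?\<phi> (x, e)"
      using phi[OF xe] by (simp add: word_eval_def)
    finally show ?thesis by simp
  qed
qed

section \<open>Link diagrams\<close>

text \<open>We model \<open>\<real>\<^sup>3\<close> as \<^typ>\<open>complex \<times> real\<close>; \<^const>\<open>fst\<close> is the projection to the plane and \<^const>\<open>snd\<close> the
  height. Multiplication by \<^term>\<open>\<i>\<close> is the rotation by a right angle such that \<open>(v, \<i> * v)\<close> is a
  right-handed frame of the plane.\<close>

type_synonym point3 = "complex \<times> real"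

definition embedded_circle :: "point3 set \<Rightarrow> bool" where
  "embedded_circle K \<longleftrightarrow>
     (\<exists>\<gamma> \<gamma>'. K = range \<gamma> \<and> (\<forall>t::real. \<gamma> (t + 1) = \<gamma> t) \<and> inj_on \<gamma> {0..<1} \<and>
        continuous_on UNIV \<gamma>' \<and> (\<forall>t. (\<gamma> has_vector_derivative \<gamma>' t) (at t) \<and> \<gamma>' t \<noteq> 0))"

definition is_link :: "point3 set \<Rightarrow> bool" where
  "is_link L \<longleftrightarrow>
     (\<exists>\<K>. finite \<K> \<and> pairwise disjnt \<K> \<and> (\<forall>K\<in>\<K>. embedded_circle K) \<and> L = \<Union>\<K>)"

definition curve_through :: "point3 set \<Rightarrow> (real \<Rightarrow> point3) \<Rightarrow> point3 \<Rightarrow> point3 \<Rightarrow> bool" where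
  "curve_through L g p w \<longleftrightarrow>
     (\<forall>t. g t \<in> L) \<and> g 0 = p \<and> (g has_vector_derivative w) (at 0)"

definition tangent_space :: "point3 set \<Rightarrow> point3 \<Rightarrow> point3 set" where
  "tangent_space L p = {w. \<exists>g. curve_through L g p w}"

definition crossing :: "point3 set \<Rightarrow> point3 \<Rightarrow> point3 \<Rightarrow> bool" where
  "crossing L p q \<longleftrightarrow> p \<in> L \<and> q \<in> L \<and> fst p = fst q \<and> snd q < snd p"

text \<open>A link in general position with respect to the projection. It carries exactly the data of its
  diagram: the plane figure \<open>fst ` L\<close> with its two strands at each double point ordered by height.\<close>

definition link_diagram :: "point3 set \<Rightarrow> bool" where
  "link_diagram L \<longleftrightarrow>
     is_link L \<and>
     (\<forall>p\<in>L. \<forall>w\<in>tangent_space L p. w \<noteq> 0 \<longrightarrow> fst w \<noteq> 0) \<and>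
     (\<forall>p\<in>L. \<forall>q\<in>L. \<forall>r\<in>L. fst p = fst q \<and> fst q = fst r \<longrightarrow> p = q \<or> q = r \<or> p = r) \<and>
     finite {(p, q). crossing L p q} \<and>
     (\<forall>p q. crossing L p q \<longrightarrow> fst ` tangent_space L p \<inter> fst ` tangent_space L q = {0})"

definition upper_points :: "point3 set \<Rightarrow> point3 set" where
  "upper_points L = {p. \<exists>q. crossing L p q}"

definition lower_points :: "point3 set \<Rightarrow> point3 set" where
  "lower_points L = {q. \<exists>p. crossing L p q}"

text \<open>Arcs and semi-arcs are taken in \<open>L\<close>, the broken figure in the plane being homeomorphic to its
  lift, and points are removed rather than neighbourhoods of points; neither choice affects which
  components there are. An arc contains the upper points over which it passes.\<close>

definition arcs :: "point3 set \<Rightarrow> point3 set set" where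
  "arcs L = components (L - lower_points L)"

definition semi_arcs :: "point3 set \<Rightarrow> point3 set set" where
  "semi_arcs L = components (L - (upper_points L \<union> lower_points L))"

definition regions :: "point3 set \<Rightarrow> complex set set" where
  "regions L = components (- fst ` L)"

text \<open>An orientation is given by its field of unit tangent vectors to the diagram; it is indexed by
  points of \<open>L\<close> because a double point of the diagram has two tangent vectors.\<close>

definition diagram_orientation :: "point3 set \<Rightarrow> (point3 \<Rightarrow> complex) \<Rightarrow> bool" where
  "diagram_orientation L ori \<longleftrightarrow>
     continuous_on L ori \<and> (\<forall>p\<in>L. norm (ori p) = 1 \<and> ori p \<in> fst ` tangent_space L p)"

text \<open>A normal orientation of a semi-arc: a continuous field of unit normal vectors. Values outside
  the semi-arc are fixed so that equal orientations are equal functions.\<close>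

definition normal_orientations :: "point3 set \<Rightarrow> point3 set \<Rightarrow> (point3 \<Rightarrow> complex) set" where
  "normal_orientations L \<alpha> =
     {\<nu> \<in> extensional \<alpha>. continuous_on \<alpha> \<nu> \<and>
        (\<forall>p\<in>\<alpha>. norm (\<nu> p) = 1 \<and> - \<i> * \<nu> p \<in> fst ` tangent_space L p)}"

text \<open>\<open>issues_from L \<alpha> p w\<close>: starting at \<open>p\<close> with velocity \<open>w\<close>, one runs along the (semi-)arc \<open>\<alpha>\<close>.
  \<open>end_normal\<close> says moreover that the normal orientation \<open>\<nu>\<close> of \<open>\<alpha>\<close> tends to \<open>n\<close> at this end.\<close>

definition issues_from :: "point3 set \<Rightarrow> point3 set \<Rightarrow> point3 \<Rightarrow> point3 \<Rightarrow> bool" where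
  "issues_from L \<alpha> p w \<longleftrightarrow>
     w \<noteq> 0 \<and> (\<exists>g. curve_through L g p w \<and> (\<forall>\<^sub>F t in at_right 0. g t \<in> \<alpha>))"

definition end_normal ::
    "point3 set \<Rightarrow> point3 set \<Rightarrow> (point3 \<Rightarrow> complex) \<Rightarrow> point3 \<Rightarrow> point3 \<Rightarrow> complex \<Rightarrow> bool" where
  "end_normal L \<alpha> \<nu> p w n \<longleftrightarrow>
     w \<noteq> 0 \<and> (\<exists>g. curve_through L g p w \<and> (\<forall>\<^sub>F t in at_right 0. g t \<in> \<alpha>) \<and>
       ((\<lambda>t. \<nu> (g t)) \<longlongrightarrow> n) (at_right 0))"

text \<open>The regions on the two sides of the diagram at \<open>p\<close>, \<open>n\<close> being a normal vector that points from
  \<open>\<gamma>1\<close> to \<open>\<gamma>2\<close>.\<close>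

definition adjacent_at :: "point3 \<Rightarrow> complex \<Rightarrow> complex set \<Rightarrow> complex set \<Rightarrow> bool" where
  "adjacent_at p n \<gamma>1 \<gamma>2 \<longleftrightarrow>
     (\<forall>\<^sub>F t in at_right (0::real).
        fst p - of_real t * n \<in> \<gamma>1 \<and> fst p + of_real t * n \<in> \<gamma>2)"

section \<open>Colorings of oriented diagrams\<close>

definition X_coloring ::
    "'a set \<Rightarrow> ('a \<Rightarrow> 'a \<Rightarrow> 'a) \<Rightarrow> point3 set \<Rightarrow> (point3 \<Rightarrow> complex) \<Rightarrow> (point3 set \<Rightarrow> 'a) \<Rightarrow> bool" where
  "X_coloring X f L ori c \<longleftrightarrow>
     c \<in> arcs L \<rightarrow>\<^sub>E X \<and>
     (\<forall>p q w. \<forall>\<alpha>1\<in>arcs L. \<forall>\<alpha>2\<in>arcs L. \<forall>\<beta>\<in>arcs L.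
        crossing L p q \<and> p \<in> \<beta> \<and>
        issues_from L \<alpha>1 q (- w) \<and> issues_from L \<alpha>2 q w \<and> fst w \<bullet> (\<i> * ori p) > 0
        \<longrightarrow> f (c \<alpha>1) (c \<beta>) = c \<alpha>2)"

definition Col_XY ::
    "'a set \<Rightarrow> ('a \<Rightarrow> 'a \<Rightarrow> 'a) \<Rightarrow> 'y set \<Rightarrow> ('y \<Rightarrow> 'a word set \<Rightarrow> 'y) \<Rightarrow> point3 set \<Rightarrow>
     (point3 \<Rightarrow> complex) \<Rightarrow> ((point3 set \<Rightarrow> 'a) \<times> (complex set \<Rightarrow> 'y)) set" where
  "Col_XY X f Y act L ori =
     {(c, r). X_coloring X f L ori c \<and> r \<in> regions L \<rightarrow>\<^sub>E Y \<and>
        (\<forall>\<alpha>\<in>arcs L. \<forall>p\<in>\<alpha> - upper_points L. \<forall>\<gamma>1\<in>regions L. \<forall>\<gamma>2\<in>regions L.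
           adjacent_at p (\<i> * ori p) \<gamma>1 \<gamma>2 \<longrightarrow> act (r \<gamma>1) (assoc_gen X f (c \<alpha>)) = r \<gamma>2)}"

section \<open>Colorings of unoriented diagrams by a symmetric quandle\<close>

type_synonym 'a semi_arc_assignment = "point3 set \<Rightarrow> (point3 \<Rightarrow> complex) \<times> 'a"

definition sym_assignment ::
    "'a set \<Rightarrow> ('a \<Rightarrow> 'a \<Rightarrow> 'a) \<Rightarrow> ('a \<Rightarrow> 'a) \<Rightarrow> point3 set \<Rightarrow> 'a semi_arc_assignment \<Rightarrow> bool" where
  "sym_assignment X f \<rho> L A \<longleftrightarrow>
     A \<in> (\<Pi>\<^sub>E \<alpha>\<in>semi_arcs L. normal_orientations L \<alpha> \<times> X) \<and>
     (\<forall>p w n1 n2. \<forall>\<beta>1\<in>semi_arcs L. \<forall>\<beta>2\<in>semi_arcs L.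
        p \<in> upper_points L \<and>
        end_normal L \<beta>1 (fst (A \<beta>1)) p (- w) n1 \<and> end_normal L \<beta>2 (fst (A \<beta>2)) p w n2
        \<longrightarrow> snd (A \<beta>1) = (if n1 = n2 then snd (A \<beta>2) else \<rho> (snd (A \<beta>2)))) \<and>
     (\<forall>p q u w n n1 n2. \<forall>\<beta>\<in>semi_arcs L. \<forall>\<alpha>1\<in>semi_arcs L. \<forall>\<alpha>2\<in>semi_arcs L.
        crossing L p q \<and> end_normal L \<beta> (fst (A \<beta>)) p u n \<and>
        end_normal L \<alpha>1 (fst (A \<alpha>1)) q (- w) n1 \<and> end_normal L \<alpha>2 (fst (A \<alpha>2)) q w n2 \<and>
        fst w \<bullet> n > 0
        \<longrightarrow> f (snd (A \<alpha>1)) (snd (A \<beta>)) = (if n1 = n2 then snd (A \<alpha>2) else \<rho> (snd (A \<alpha>2))))"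

definition basic_inversion ::
    "('a \<Rightarrow> 'a) \<Rightarrow> point3 set \<Rightarrow> 'a semi_arc_assignment \<Rightarrow> 'a semi_arc_assignment \<Rightarrow> bool" where
  "basic_inversion \<rho> L A B \<longleftrightarrow>
     (\<exists>\<alpha>\<in>semi_arcs L. B = A(\<alpha> := (restrict (\<lambda>p. - fst (A \<alpha>) p) \<alpha>, \<rho> (snd (A \<alpha>)))))"

definition sym_colorings ::
    "'a set \<Rightarrow> ('a \<Rightarrow> 'a \<Rightarrow> 'a) \<Rightarrow> ('a \<Rightarrow> 'a) \<Rightarrow> point3 set \<Rightarrow> 'a semi_arc_assignment set set" where
  "sym_colorings X f \<rho> L =
     {A. sym_assignment X f \<rho> L A} //
     {(A, B). sym_assignment X f \<rho> L A \<and> sym_assignment X f \<rho> L B \<and>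
        equivclp (\<lambda>A B. sym_assignment X f \<rho> L A \<and> sym_assignment X f \<rho> L B \<and>
          basic_inversion \<rho> L A B) A B}"

type_synonym ('a, 'y) sym_region_coloring =
  "'a semi_arc_assignment set \<times> (complex set \<Rightarrow> 'y)"

definition Col_sym ::
    "'a set \<Rightarrow> ('a \<Rightarrow> 'a \<Rightarrow> 'a) \<Rightarrow> ('a \<Rightarrow> 'a) \<Rightarrow> 'y set \<Rightarrow> ('y \<Rightarrow> 'a word set \<Rightarrow> 'y) \<Rightarrow> point3 set \<Rightarrow>
     ('a, 'y) sym_region_coloring set" where
  "Col_sym X f \<rho> Y act L =
     {(c, r). c \<in> sym_colorings X f \<rho> L \<and> r \<in> regions L \<rightarrow>\<^sub>E Y \<and>
        (\<forall>A\<in>c. \<forall>\<alpha>\<in>semi_arcs L. \<forall>p\<in>\<alpha>. \<forall>\<gamma>1\<in>regions L. \<forall>\<gamma>2\<in>regions L.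
           adjacent_at p (fst (A \<alpha>) p) \<gamma>1 \<gamma>2
           \<longrightarrow> act (r \<gamma>1) (sym_assoc_gen X f \<rho> (snd (A \<alpha>))) = r \<gamma>2)}"

section \<open>Colorings by the symmetric double\<close>

definition Col_double ::
    "'a set \<Rightarrow> ('a \<Rightarrow> 'a \<Rightarrow> 'a) \<Rightarrow> 'y set \<Rightarrow> ('y \<Rightarrow> 'a word set \<Rightarrow> 'y) \<Rightarrow> point3 set \<Rightarrow>
     ('a \<times> bool, 'y) sym_region_coloring set" where
  "Col_double X f Y act L =
     Col_sym (double_carrier X) (double_op X f) double_inv Y (double_act X f act) L"

definition canonical_form ::
    "point3 set \<Rightarrow> ('a \<times> bool, 'y) sym_region_coloring \<Rightarrow> ('a \<times> bool) semi_arc_assignment" where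
  "canonical_form L C = (THE A. A \<in> fst C \<and> (\<forall>\<alpha>\<in>semi_arcs L. snd (snd (A \<alpha>)) = True))"

definition induces_orientation ::
    "point3 set \<Rightarrow> ('a \<times> bool, 'y) sym_region_coloring \<Rightarrow> (point3 \<Rightarrow> complex) \<Rightarrow> bool" where
  "induces_orientation L C ori \<longleftrightarrow>
     diagram_orientation L ori \<and>
     (\<forall>\<alpha>\<in>semi_arcs L. \<forall>p\<in>\<alpha>. fst (canonical_form L C \<alpha>) p = \<i> * ori p)"

definition ori_equiv ::
    "'a set \<Rightarrow> ('a \<Rightarrow> 'a \<Rightarrow> 'a) \<Rightarrow> 'y set \<Rightarrow> ('y \<Rightarrow> 'a word set \<Rightarrow> 'y) \<Rightarrow> point3 set \<Rightarrow>
     (('a \<times> bool, 'y) sym_region_coloring \<times> ('a \<times> bool, 'y) sym_region_coloring) set" where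
  "ori_equiv X f Y act L =
     {(C, C'). C \<in> Col_double X f Y act L \<and> C' \<in> Col_double X f Y act L \<and>
        (\<exists>ori. induces_orientation L C ori \<and> induces_orientation L C' ori)}"

end

theory Submission
  imports Defs
begin

text \<open>
  An orientation of the diagram singles out, on every semi-arc, one of its two normal orientations,
  namely the tangent vector rotated by a right angle. Any assignment of normals and labels can be read
  against this choice: keep a label whose normal agrees with the orientation, and apply the good
  involution to the others. The resulting oriented labels do not change under basic inversions, and
  the conditions of a symmetric quandle coloring say precisely that they satisfy the crossing relations
  of the oriented diagram (\<open>sym_assignment_iff_oriented\<close>). As there are finitely many semi-arcs
  (\<open>finite_semi_arcs\<close>), assignments with equal oriented labels are joined by finitely many basic
  inversions. So a coloring by a symmetric quandle is the same as a labeling of the semi-arcs that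
  satisfies the oriented crossing relations (\<open>sym_colorings_eq\<close>).

  For the symmetric double, the canonical form of a coloring has the normal given by the orientation on
  the semi-arcs with an oriented label of sign \<open>+1\<close>, and the opposite normal on all others
  (\<open>canonical_form_double_class\<close>). It induces the given orientation if and only if all oriented labels
  lie in the copy \<open>X\<^sup>+\<^sup>1\<close>. Dropping the signs leaves a labeling of the semi-arcs by \<open>X\<close>; it takes equal
  values on both sides of each overpass, hence is constant on arcs
  (\<open>constant_over_imp_constant_on_arc\<close>), and is an \<open>X\<close>-coloring. Labels of regions are the same on both
  sides of the correspondence, because crossing an inverted semi-arc means crossing it backwards and
  acting by the inverse (\<open>double_class_in_Col_double_iff\<close>).

  The geometry enters through a description of a link near one of its points (\<open>link_strands\<close>). It yields
  that tangent spaces are lines, so that a semi-arc has only two normal orientations; that a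
  neighbourhood of a point meets few semi-arcs, whence their finiteness and the constancy of labels on
  arcs; and that the ends of arcs at a crossing are ends of semi-arcs.
\<close>

section \<open>Links near a point\<close>

text \<open>Shifting the parameter puts the point under consideration at time \<open>0\<close>. Periodicity together with
  injectivity on one period says that the parameter is determined up to an integer, which is the only
  form in which the global shape of the circle is used below.\<close>

lemma embedded_circle_param:
  assumes "embedded_circle K" "p \<in> K"
  obtains \<delta> :: "real \<Rightarrow> point3" and v where "\<delta> 0 = p" "range \<delta> = K" "continuous_on UNIV \<delta>"
    "(\<delta> has_vector_derivative v) (at 0)" "v \<noteq> 0" "\<And>s t. \<delta> s = \<delta> t \<longleftrightarrow> s - t \<in> \<int>"
proof -
  obtain \<gamma> \<gamma>' where K: "K = range \<gamma>" and per: "\<And>t::real. \<gamma> (t + 1) = \<gamma> t"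
    and inj: "inj_on \<gamma> {0..<1}"
    and der: "\<And>t. (\<gamma> has_vector_derivative \<gamma>' t) (at t)" "\<And>t. \<gamma>' t \<noteq> 0"
    using assms(1) unfolding embedded_circle_def by blast
  obtain a where a: "p = \<gamma> a" using assms(2) K by blast
  have nat: "\<gamma> (t + real n) = \<gamma> t" for t n
  proof (induction n)
    case (Suc n)
    then show ?case using per[of "t + real n"] by (simp add: ac_simps)
  qed simp
  have int: "\<gamma> (t + of_int n) = \<gamma> t" for t n
  proof (cases "n \<ge> 0")
    case True
    then show ?thesis using nat[of t "nat n"] by simp
  next
    case False
    then show ?thesis using nat[of "t + of_int n" "nat (- n)"] by simp
  qed
  have frac: "\<gamma> (frac t) = \<gamma> t" for t
    using int[of t "- \<lfloor>t\<rfloor>"] by (simp add: frac_def)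
  have eq: "\<gamma> s = \<gamma> t \<longleftrightarrow> s - t \<in> \<int>" for s t
  proof
    assume "\<gamma> s = \<gamma> t"
    then have "\<gamma> (frac s) = \<gamma> (frac t)" by (simp add: frac)
    then have "frac s = frac t"
      by (rule inj_onD[OF inj]) (simp_all add: frac_lt_1)
    then have "s - t = of_int (\<lfloor>s\<rfloor> - \<lfloor>t\<rfloor>)" by (simp add: frac_def)
    then show "s - t \<in> \<int>" by simp
  next
    assume "s - t \<in> \<int>"
    then obtain n where "s - t = of_int n" by (auto elim: Ints_cases)
    then have "s = t + of_int n" by simp
    then show "\<gamma> s = \<gamma> t" using int by simp
  qed
  have cont: "continuous_on UNIV \<gamma>"
    using der(1) by (meson continuous_at_imp_continuous_on has_vector_derivative_continuous)
  show ?thesis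
  proof (rule that[of "\<lambda>t. \<gamma> (a + t)" "\<gamma>' a"])
    show "range (\<lambda>t. \<gamma> (a + t)) = K"
    proof -
      have "\<gamma> t \<in> range (\<lambda>t. \<gamma> (a + t))" for t by (rule image_eqI[of _ _ "t - a"]) simp_all
      then show ?thesis unfolding K by blast
    qed
    show "continuous_on UNIV (\<lambda>t. \<gamma> (a + t))"
      by (rule continuous_on_compose2[OF cont]) (auto intro!: continuous_intros)
    show "((\<lambda>t. \<gamma> (a + t)) has_vector_derivative \<gamma>' a) (at 0)"
    proof -
      have "((\<lambda>t. a + t) has_vector_derivative 1) (at (0::real))"
        by (auto intro!: derivative_eq_intros)
      then have "(\<gamma> \<circ> (\<lambda>t. a + t) has_vector_derivative 1 *\<^sub>R \<gamma>' a) (at 0)"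
        by (rule vector_diff_chain_at) (use der(1)[of a] in simp)
      then show ?thesis by (simp add: o_def)
    qed
  qed (use a der(2) eq in auto)
qed

lemma compact_embedded_circle:
  assumes "embedded_circle K" shows "compact K"
proof (cases "K = {}")
  case False
  then obtain p where "p \<in> K" by blast
  from embedded_circle_param[OF assms this] obtain \<delta> where
    d: "range \<delta> = K" "continuous_on UNIV \<delta>" "\<And>s t::real. \<delta> s = \<delta> t \<longleftrightarrow> s - t \<in> \<int>" by metis
  have "\<delta> t = \<delta> (frac t)" for t using d(3) by (simp add: frac_def)
  moreover have "frac t \<in> {0..1::real}" for t using frac_lt_1[of t] by (simp add: less_imp_le)
  ultimately have "\<delta> t \<in> \<delta> ` {0..1}" for t by (rule image_eqI)
  then have "K = \<delta> ` {0..1}" using d(1) by blast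
  moreover have "compact (\<delta> ` {0..1})"
    by (rule compact_continuous_image[OF continuous_on_subset[OF d(2)]]) auto
  ultimately show ?thesis by simp
qed simp

lemma vector_derivative_quotient:
  fixes g :: "real \<Rightarrow> 'b::real_normed_vector"
  assumes "(g has_vector_derivative w) (at 0)"
  shows "((\<lambda>t. (g t - g 0) /\<^sub>R t) \<longlongrightarrow> w) (at 0)"
proof -
  have "norm (g (0 + t) - g 0 - t *\<^sub>R w) / norm t = norm ((g t - g 0) /\<^sub>R t - w)"
    if "t \<noteq> 0" for t
  proof -
    have "g (0 + t) - g 0 - t *\<^sub>R w = t *\<^sub>R ((g t - g 0) /\<^sub>R t - w)"
      using that by (simp add: scaleR_diff_right)
    then have "norm (g (0 + t) - g 0 - t *\<^sub>R w) = \<bar>t\<bar> * norm ((g t - g 0) /\<^sub>R t - w)"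
      by (simp only: norm_scaleR)
    then show ?thesis using that by (simp only: real_norm_def) simp
  qed
  then have ev: "\<forall>\<^sub>F t in at 0.
      norm (g (0 + t) - g 0 - t *\<^sub>R w) / norm t = norm ((g t - g 0) /\<^sub>R t - w)"
    unfolding eventually_at_filter by (intro always_eventually) blast
  have "((\<lambda>t. norm (g (0 + t) - g 0 - t *\<^sub>R w) / norm t) \<longlongrightarrow> 0) (at 0)"
    using assms unfolding has_vector_derivative_def has_derivative_at by simp
  from Lim_transform_eventually[OF this ev] show ?thesis
    by (rule LIM_zero_cancel[OF tendsto_norm_zero_cancel])
qed

lemma inner_derivative_sign:
  fixes h :: "real \<Rightarrow> 'b::real_inner"
  assumes "(h has_vector_derivative w) (at 0)" "0 < w \<bullet> u"
  shows "\<forall>\<^sub>F t in at 0. 0 < ((h t - h 0) \<bullet> u) * t"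
proof -
  have "((\<lambda>t. ((h t - h 0) /\<^sub>R t) \<bullet> u) \<longlongrightarrow> w \<bullet> u) (at 0)"
    by (intro tendsto_intros vector_derivative_quotient assms(1))
  then have "\<forall>\<^sub>F t in at 0. 0 < ((h t - h 0) /\<^sub>R t) \<bullet> u"
    using assms(2) by (rule order_tendstoD)
  moreover have "\<forall>\<^sub>F t in at (0::real). t \<noteq> 0" by (simp add: eventually_at_filter)
  ultimately show ?thesis
  proof eventually_elim
    case (elim t)
    have "0 < (((h t - h 0) /\<^sub>R t) \<bullet> u) * t\<^sup>2" using elim by (intro mult_pos_pos) simp_all
    also have "\<dots> = ((h t - h 0) \<bullet> u) * t"
      using elim(2) by (simp add: power2_eq_square)
    finally show ?case .
  qed
qed

text \<open>A curve \<open>h\<close> that is differentiable at \<open>0\<close> only and stays on the trace of \<open>\<delta>\<close> may jump, so its velocity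
  cannot be found by lifting it to the parameter of \<open>\<delta>\<close> and differentiating. Instead let \<open>R\<close> be the
  projection along \<open>v\<close> to its orthogonal complement. Along \<open>\<delta>\<close> the vector \<open>R (\<delta> s - \<delta> 0)\<close> is small
  compared to \<open>\<delta> s - \<delta> 0\<close>, a statement that no longer mentions the parameter and therefore passes to
  \<open>h\<close>; dividing by \<open>t\<close> gives \<open>R w = 0\<close>.\<close>

lemma derivative_along_curve_parallel:
  fixes \<delta> h :: "real \<Rightarrow> 'b::real_inner"
  assumes \<delta>: "(\<delta> has_vector_derivative v) (at 0)" and v: "v \<noteq> 0"
    and h: "(h has_vector_derivative w) (at 0)" and h0: "h 0 = \<delta> 0"
    and along: "\<And>e. e > 0 \<Longrightarrow> \<forall>\<^sub>F t in at 0. \<exists>s. \<bar>s\<bar> < e \<and> h t = \<delta> s"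
  shows "w = (w \<bullet> v / (v \<bullet> v)) *\<^sub>R v"
proof -
  define R where "R x = x - (x \<bullet> v / (v \<bullet> v)) *\<^sub>R v" for x
  have Rs: "R (x /\<^sub>R t) = R x /\<^sub>R t" for x t
    by (simp add: R_def scaleR_diff_right divide_inverse)
  have Rlim: "((\<lambda>t. R (F t)) \<longlongrightarrow> R x) net" if "(F \<longlongrightarrow> x) net" for F x and net :: "real filter"
    unfolding R_def by (intro tendsto_intros that) (use v in simp)
  have small: "norm (R w) \<le> e * norm w" if e: "e > 0" for e
  proof -
    have "((\<lambda>s. e * norm ((\<delta> s - \<delta> 0) /\<^sub>R s) - norm (R ((\<delta> s - \<delta> 0) /\<^sub>R s))) \<longlongrightarrow>
        e * norm v - norm (R v)) (at 0)"
      by (intro tendsto_intros Rlim vector_derivative_quotient \<delta>)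
    moreover have "0 < e * norm v - norm (R v)" using e v by (simp add: R_def)
    ultimately have "\<forall>\<^sub>F s in at 0. 0 < e * norm ((\<delta> s - \<delta> 0) /\<^sub>R s) - norm (R ((\<delta> s - \<delta> 0) /\<^sub>R s))"
      by (rule order_tendstoD)
    then obtain d where d: "d > 0" and
      *: "\<And>s. s \<noteq> 0 \<Longrightarrow> \<bar>s\<bar> < d \<Longrightarrow> norm (R ((\<delta> s - \<delta> 0) /\<^sub>R s)) < e * norm ((\<delta> s - \<delta> 0) /\<^sub>R s)"
      unfolding eventually_at by (auto simp: dist_real_def)
    have ds: "norm (R (\<delta> s - \<delta> 0)) \<le> e * norm (\<delta> s - \<delta> 0)" if "s \<noteq> 0" "\<bar>s\<bar> < d" for s
    proof -
      have "norm (R (\<delta> s - \<delta> 0)) / \<bar>s\<bar> \<le> e * norm (\<delta> s - \<delta> 0) / \<bar>s\<bar>"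
        using *[OF that] by (simp add: Rs divide_inverse mult_ac)
      then show ?thesis using that(1) by (simp add: divide_le_cancel)
    qed
    have "\<forall>\<^sub>F t in at 0. norm (R ((h t - h 0) /\<^sub>R t)) \<le> e * norm ((h t - h 0) /\<^sub>R t)"
      using along[OF d]
    proof eventually_elim
      case (elim t)
      then obtain s where s: "\<bar>s\<bar> < d" "h t = \<delta> s" by blast
      have "norm (R (h t - h 0)) \<le> e * norm (h t - h 0)"
        using ds[of s] s h0 by (cases "s = 0") (auto simp: R_def)
      then have "inverse \<bar>t\<bar> * norm (R (h t - h 0)) \<le> inverse \<bar>t\<bar> * (e * norm (h t - h 0))"
        by (rule mult_left_mono) simp
      then show ?case by (simp add: Rs mult.left_commute)
    qed
    then show ?thesis
      by (rule tendsto_le[OF trivial_limit_at, rotated 2])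
        (intro tendsto_intros Rlim vector_derivative_quotient h)+
  qed
  have "norm (R w) \<le> 0"
  proof (rule field_le_epsilon)
    fix e :: real assume e: "e > 0"
    have "norm (R w) \<le> (e / (norm w + 1)) * norm w"
      by (rule small) (use e in \<open>simp add: add_nonneg_pos\<close>)
    also have "\<dots> \<le> e"
    proof -
      have "norm w / (norm w + 1) \<le> 1" 
        by (rule divide_le_eq_1_pos[THEN iffD2]) (use norm_ge_zero[of w] in linarith)+
      from mult_left_mono[OF this, of e] show ?thesis using e by simp
    qed
    finally show "norm (R w) \<le> 0 + e" by simp
  qed
  then show ?thesis by (simp add: R_def)
qed

text \<open>The local picture on which everything else rests. A point \<open>p\<close> has a neighbourhood in \<open>L\<close> that
  consists of \<open>p\<close> and two strands \<open>S\<^sub>1\<close>, \<open>S\<^sub>2\<close> that leave \<open>p\<close> in the opposite directions \<open>v\<close>, \<open>- v\<close> and that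
  can be chosen so short that they avoid a given finite set. The last clause controls all curves used
  in the definitions of tangent spaces and ends of semi-arcs: their velocities are multiples of \<open>v\<close>,
  and the sign of the multiple decides on which strand the curve starts, because near \<open>p\<close> the sign of
  \<open>(x - p) \<bullet> v\<close> tells the two strands apart.\<close>

lemma link_strands:
  assumes L: "is_link L" and F: "finite F" and p: "p \<in> L"
  obtains v S\<^sub>1 S\<^sub>2 N where "v \<noteq> 0" "connected S\<^sub>1" "connected S\<^sub>2"
    "S\<^sub>1 \<subseteq> L - F" "S\<^sub>2 \<subseteq> L - F" "openin (top_of_set L) N" "p \<in> N" "N = insert p (S\<^sub>1 \<union> S\<^sub>2)"
    "issues_from L S\<^sub>1 p v" "issues_from L S\<^sub>2 p (- v)"
    "\<And>h w. curve_through L h p w \<Longrightarrow> \<exists>k. w = k *\<^sub>R v \<and>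
       (k > 0 \<longrightarrow> (\<forall>\<^sub>F t in at_right 0. h t \<in> S\<^sub>1)) \<and>
       (k < 0 \<longrightarrow> (\<forall>\<^sub>F t in at_right 0. h t \<in> S\<^sub>2))"
proof -
  obtain \<K> where \<K>: "finite \<K>" "pairwise disjnt \<K>" "\<And>K. K \<in> \<K> \<Longrightarrow> embedded_circle K" "L = \<Union>\<K>"
    using L unfolding is_link_def by blast
  obtain K where K: "K \<in> \<K>" "p \<in> K" using p \<K>(4) by blast
  obtain \<delta> :: "real \<Rightarrow> point3" and v where \<delta>: "\<delta> 0 = p" "range \<delta> = K" "continuous_on UNIV \<delta>"
    "(\<delta> has_vector_derivative v) (at 0)" "v \<noteq> 0" and eq: "\<And>s t. \<delta> s = \<delta> t \<longleftrightarrow> s - t \<in> \<int>"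
    by (rule embedded_circle_param[OF \<K>(3)[OF K(1)] K(2)]) (rule that)
  have L\<delta>: "\<delta> t \<in> L" for t using \<delta>(2) K \<K>(4) by blast
  have inj: "s = t" if "\<delta> s = \<delta> t" "\<bar>s - t\<bar> < 1" for s t
    using that eq Ints_eq_abs_less1[of "s - t" 0] by simp
  \<comment> \<open>For short times the sign of the parameter can be read off from the position in space.\<close>
  have "\<forall>\<^sub>F t in at 0. 0 < ((\<delta> t - \<delta> 0) \<bullet> v) * t"
    by (rule inner_derivative_sign[OF \<delta>(4)]) (use \<delta>(5) in simp)
  then obtain e1 where e1: "e1 > 0" "\<And>t. t \<noteq> 0 \<Longrightarrow> \<bar>t\<bar> < e1 \<Longrightarrow> 0 < ((\<delta> t - p) \<bullet> v) * t"
    unfolding eventually_at by (auto simp: dist_real_def \<delta>(1))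
  \<comment> \<open>The finite set meets the trace of \<open>[-1/3, 1/3]\<close> at finitely many times; the length \<open>1/3\<close>
    keeps all parameters in question less than one period apart.\<close>
  define Z where "Z = {t \<in> {-1/3..1/3}. \<delta> t \<in> F} - {0}"
  have "finite Z"
  proof -
    have "inj_on \<delta> {-1/3..1/3}" by (rule inj_onI) (auto intro!: inj)
    then have "finite (\<delta> -` F \<inter> {-1/3..1/3})" using F by (simp add: finite_vimage_IntI)
    then show ?thesis by (rule rev_finite_subset) (auto simp: Z_def)
  qed
  then have "open (- Z)" by (simp add: finite_imp_closed open_closed)
  moreover have "0 \<in> - Z" by (simp add: Z_def)
  ultimately obtain e2 where e2: "e2 > 0" "ball 0 e2 \<subseteq> - Z" using open_contains_ball by blast
  define \<epsilon> where "\<epsilon> = min (1/3) (min e1 e2)"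
  have \<epsilon>: "\<epsilon> > 0" "\<epsilon> \<le> 1/3" "\<epsilon> \<le> e1" "\<epsilon> \<le> e2" using e1 e2 by (auto simp: \<epsilon>_def)
  have notF: "\<delta> t \<notin> F" if "t \<noteq> 0" "\<bar>t\<bar> < \<epsilon>" for t
  proof
    assume "\<delta> t \<in> F"
    then have "t \<in> Z" using that \<epsilon> by (auto simp: Z_def)
    moreover have "t \<in> ball 0 e2" using that \<epsilon> by simp
    ultimately show False using e2 by blast
  qed
  define S\<^sub>1 where "S\<^sub>1 = \<delta> ` {0<..<\<epsilon>}"
  define S\<^sub>2 where "S\<^sub>2 = \<delta> ` {-\<epsilon><..<0}"
  have conn: "connected (\<delta> ` {a<..<b})" for a b
    by (rule connected_continuous_image[OF continuous_on_subset[OF \<delta>(3)]]) auto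
  have op: "openin (top_of_set L) (\<delta> ` {-e<..<e})" if e: "0 < e" "e \<le> 1/3" for e
  proof -
    \<comment> \<open>Closing the circle, the complement of the short strand is a compact strand together with the
      other components of the link.\<close>
    define M where "M = \<delta> ` {e..1-e} \<union> \<Union>(\<K> - {K})"
    have "compact (\<delta> ` {e..1-e})"
      by (rule compact_continuous_image[OF continuous_on_subset[OF \<delta>(3)]]) auto
    moreover have "compact (\<Union>(\<K> - {K}))"
      by (rule compact_Union) (use \<K> compact_embedded_circle in auto)
    ultimately have "closed M" unfolding M_def by (intro compact_imp_closed compact_Un)
    have "\<delta> ` {-e<..<e} \<inter> \<delta> ` {e..1-e} = {}"
    proof -
      have False if st: "s \<in> {-e<..<e}" "t \<in> {e..1-e}" "\<delta> s = \<delta> t" for s t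
        using inj[of s t] st e by (auto simp: abs_if split: if_splits)
      then show ?thesis by blast
    qed
    moreover have "K = \<delta> ` {-e<..<e} \<union> \<delta> ` {e..1-e}"
    proof -
      have "\<delta> t \<in> \<delta> ` {-e<..<e} \<union> \<delta> ` {e..1-e}" for t
      proof -
        \<comment> \<open>The representative of \<open>t\<close> modulo the period in the window \<open>[- e, 1 - e)\<close>.\<close>
        define u where "u = frac (t + e) - e"
        have "u - t = of_int (- \<lfloor>t + e\<rfloor>)" by (simp add: u_def frac_def)
        then have "\<delta> u = \<delta> t" unfolding eq by simp
        moreover have "u \<in> {-e<..<e} \<union> {e..1-e} \<or> u = - e"
          using frac_lt_1[of "t + e"] frac_ge_0[of "t + e"] by (auto simp: u_def)
        moreover have "\<delta> (- e) = \<delta> (1 - e)" unfolding eq by simp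
        moreover have "1 - e \<in> {e..1-e}" using e by simp
        ultimately show ?thesis by (elim disjE UnE) (metis UnI1 imageI, metis UnI2 imageI, metis UnI2 imageI)
      qed
      then show ?thesis using \<delta>(2) by blast
    qed
    moreover have "K \<inter> \<Union>(\<K> - {K}) = {}"
      using \<K>(2) K(1) unfolding pairwise_def disjnt_def by blast
    ultimately have "\<delta> ` {-e<..<e} = L \<inter> - M"
      unfolding \<K>(4) M_def using K(1) by blast
    then show ?thesis using \<open>closed M\<close> by (auto simp: openin_open)
  qed
  show ?thesis
  proof (rule that[of v S\<^sub>1 S\<^sub>2 "\<delta> ` {-\<epsilon><..<\<epsilon>}"])
    show "v \<noteq> 0" by fact
    show "connected S\<^sub>1" "connected S\<^sub>2" unfolding S\<^sub>1_def S\<^sub>2_def by (rule conn)+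
    show "S\<^sub>1 \<subseteq> L - F" "S\<^sub>2 \<subseteq> L - F" unfolding S\<^sub>1_def S\<^sub>2_def using L\<delta> notF by auto
    show "openin (top_of_set L) (\<delta> ` {-\<epsilon><..<\<epsilon>})" using \<epsilon> by (intro op)
    show "p \<in> \<delta> ` {-\<epsilon><..<\<epsilon>}" using \<delta>(1) \<epsilon> by (auto intro!: image_eqI[of _ _ 0])
    have "{-\<epsilon><..<\<epsilon>} = insert 0 ({0<..<\<epsilon>} \<union> {-\<epsilon><..<0})" using \<epsilon> by auto
    then show "\<delta> ` {-\<epsilon><..<\<epsilon>} = insert p (S\<^sub>1 \<union> S\<^sub>2)"
      unfolding S\<^sub>1_def S\<^sub>2_def using \<delta>(1) by (simp add: image_Un)
    have ev: "\<forall>\<^sub>F t in at_right 0. t \<in> {0<..<\<epsilon>}"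
      using \<epsilon>(1) by (auto simp: eventually_at_right_field)
    show "issues_from L S\<^sub>1 p v"
      unfolding issues_from_def curve_through_def
    proof (intro conjI exI[of _ \<delta>] allI L\<delta> \<delta>)
      show "\<forall>\<^sub>F t in at_right 0. \<delta> t \<in> S\<^sub>1"
        using ev by eventually_elim (auto simp: S\<^sub>1_def)
    qed
    have "((\<lambda>t. - t) has_vector_derivative - 1) (at (0::real))"
      by (auto intro!: derivative_eq_intros)
    then have "(\<delta> \<circ> (\<lambda>t. - t) has_vector_derivative (- 1) *\<^sub>R v) (at 0)"
      by (rule vector_diff_chain_at) (use \<delta>(4) in simp)
    then have der: "((\<lambda>t. \<delta> (- t)) has_vector_derivative - v) (at 0)" by (simp add: o_def)
    show "issues_from L S\<^sub>2 p (- v)"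
      unfolding issues_from_def curve_through_def
    proof (intro conjI exI[of _ "\<lambda>t. \<delta> (- t)"] allI L\<delta> der)
      show "\<forall>\<^sub>F t in at_right 0. \<delta> (- t) \<in> S\<^sub>2"
        using ev by eventually_elim (auto simp: S\<^sub>2_def)
    qed (use \<delta> in auto)
    fix h w assume "curve_through L h p w"
    then have h: "\<And>t. h t \<in> L" "h 0 = p" "(h has_vector_derivative w) (at 0)"
      unfolding curve_through_def by auto
    have cont: "(h \<longlongrightarrow> p) (at 0)"
      using has_vector_derivative_continuous[OF h(3)] h(2) by (simp add: isCont_def)
    have along: "\<forall>\<^sub>F t in at 0. \<exists>s. \<bar>s\<bar> < e \<and> h t = \<delta> s" if "e > 0" for e
    proof -
      define d where "d = min e (1/3)"
      have d: "0 < d" "d \<le> 1/3" "d \<le> e" using that by (auto simp: d_def)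
      obtain T where T: "open T" "\<delta> ` {-d<..<d} = L \<inter> T" using op[OF d(1,2)] by (auto simp: openin_open)
      have "p \<in> \<delta> ` {-d<..<d}" using d \<delta>(1) by (auto intro!: image_eqI[of _ _ 0])
      then have "p \<in> T" using T by blast
      from topological_tendstoD[OF cont T(1) this] show ?thesis
      proof eventually_elim
        case (elim t)
        then have "h t \<in> \<delta> ` {-d<..<d}" using T h(1) by blast
        then obtain s where "s \<in> {-d<..<d}" "h t = \<delta> s" by blast
        then show ?case using d by (intro exI[of _ s]) auto
      qed
    qed
    have w: "w = (w \<bullet> v / (v \<bullet> v)) *\<^sub>R v"
      by (rule derivative_along_curve_parallel[OF \<delta>(4,5) h(3) _ along]) (simp_all add: h \<delta>)
    define k where "k = w \<bullet> v / (v \<bullet> v)"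
    have kw: "w = k *\<^sub>R v" using w by (simp add: k_def)
    have vv: "v \<bullet> v > 0" using \<delta>(5) by simp
    have near: "\<forall>\<^sub>F t in at_right 0. \<exists>s. \<bar>s\<bar> < \<epsilon> \<and> h t = \<delta> s"
      using along[OF \<epsilon>(1)] by (simp add: eventually_at_split)
    have pos: "\<forall>\<^sub>F t in at_right (0::real). t > 0" by (simp add: eventually_at_right_less)
    show "\<exists>k. w = k *\<^sub>R v \<and>
       (k > 0 \<longrightarrow> (\<forall>\<^sub>F t in at_right 0. h t \<in> S\<^sub>1)) \<and>
       (k < 0 \<longrightarrow> (\<forall>\<^sub>F t in at_right 0. h t \<in> S\<^sub>2))"
    proof (intro exI[of _ k] conjI impI kw)
      assume "k > 0"
      then have "0 < w \<bullet> v" using vv by (simp add: kw)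
      then have "\<forall>\<^sub>F t in at 0. 0 < ((h t - h 0) \<bullet> v) * t" by (rule inner_derivative_sign[OF h(3)])
      then have "\<forall>\<^sub>F t in at_right 0. 0 < ((h t - h 0) \<bullet> v) * t" by (simp add: eventually_at_split)
      then show "\<forall>\<^sub>F t in at_right 0. h t \<in> S\<^sub>1" using near pos
      proof eventually_elim
        case (elim t)
        then obtain s where s: "\<bar>s\<bar> < \<epsilon>" "h t = \<delta> s" by blast
        have "0 < (\<delta> s - p) \<bullet> v" using elim s h(2) by (simp add: zero_less_mult_iff)
        moreover from this have "s \<noteq> 0" using \<delta>(1) by auto
        ultimately have "s > 0" using e1(2)[of s] s \<epsilon> by (simp add: zero_less_mult_iff)
        then show ?case using s by (auto simp: S\<^sub>1_def)
      qed
    next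
      assume "k < 0"
      then have "0 < w \<bullet> - v" using vv by (simp add: kw mult_neg_pos)
      then have "\<forall>\<^sub>F t in at 0. 0 < ((h t - h 0) \<bullet> - v) * t" by (rule inner_derivative_sign[OF h(3)])
      then have "\<forall>\<^sub>F t in at_right 0. 0 < ((h t - h 0) \<bullet> - v) * t" by (simp add: eventually_at_split)
      then show "\<forall>\<^sub>F t in at_right 0. h t \<in> S\<^sub>2" using near pos
      proof eventually_elim
        case (elim t)
        then obtain s where s: "\<bar>s\<bar> < \<epsilon>" "h t = \<delta> s" by blast
        have "(\<delta> s - p) \<bullet> v < 0" using elim s h(2) by (simp add: mult_less_0_iff)
        moreover from this have "s \<noteq> 0" using \<delta>(1) by auto
        ultimately have "s < 0" using e1(2)[of s] s \<epsilon> by (simp add: zero_less_mult_iff)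
        then show ?case using s by (auto simp: S\<^sub>2_def)
      qed
    qed
  qed
qed


section \<open>Arcs and semi-arcs\<close>

lemma link_diagram_is_link: "link_diagram L \<Longrightarrow> is_link L"
  by (simp add: link_diagram_def)

lemma finite_double_points:
  assumes "link_diagram L" shows "finite (upper_points L \<union> lower_points L)"
proof -
  let ?C = "{(p, q). crossing L p q}"
  have "finite ?C" using assms by (simp add: link_diagram_def)
  moreover have "upper_points L \<union> lower_points L \<subseteq> fst ` ?C \<union> snd ` ?C"
    unfolding upper_points_def lower_points_def by force
  ultimately show ?thesis by (meson finite_Un finite_imageI finite_subset)
qed

lemma upper_not_lower:
  assumes "link_diagram L" "p \<in> upper_points L" shows "p \<notin> lower_points L"
proof
  assume "p \<in> lower_points L"
  then obtain q r where "crossing L p q" "crossing L r p"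
    using assms(2) by (auto simp: upper_points_def lower_points_def)
  then have "p \<in> L" "q \<in> L" "r \<in> L" "fst p = fst q" "fst q = fst r" "p \<noteq> q" "q \<noteq> r" "p \<noteq> r"
    by (auto simp: crossing_def)
  then show False using assms(1) unfolding link_diagram_def by metis
qed

lemma compact_link:
  assumes "is_link L" shows "compact L"
proof -
  obtain \<K> where "finite \<K>" "\<forall>K\<in>\<K>. embedded_circle K" "L = \<Union>\<K>"
    using assms unfolding is_link_def by blast
  then show ?thesis using compact_embedded_circle by (simp add: compact_Union)
qed

lemma curve_through_tendsto:
  assumes "curve_through L g p w" shows "(g \<longlongrightarrow> p) (at_right 0)"
proof -
  have "isCont g 0" "g 0 = p"
    using assms has_vector_derivative_continuous unfolding curve_through_def by blast+
  then have "(g \<longlongrightarrow> p) (at 0)" by (simp add: isCont_def)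
  then show ?thesis by (rule tendsto_mono[rotated]) (simp add: at_le)
qed

lemma issues_from_mono: "issues_from L \<alpha> p w \<Longrightarrow> \<alpha> \<subseteq> \<beta> \<Longrightarrow> issues_from L \<beta> p w"
  unfolding issues_from_def by (blast intro: eventually_mono)

text \<open>The curve that witnesses the end shows that \<open>p\<close> lies in the closure of \<open>\<alpha>\<close>.\<close>

lemma connected_insert_end:
  assumes "issues_from L \<alpha> p w" "connected \<alpha>" shows "connected (insert p \<alpha>)"
proof -
  obtain g where g: "curve_through L g p w" "\<forall>\<^sub>F t in at_right 0. g t \<in> \<alpha>"
    using assms(1) by (auto simp: issues_from_def)
  have "\<forall>\<^sub>F t in at_right 0. g t \<in> closure \<alpha>"
    using g(2) by eventually_elim (rule closure_subset[THEN subsetD])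
  then have "p \<in> closure \<alpha>"
    by (rule Lim_in_closed_set[OF closed_closure _ trivial_limit_at_right_real curve_through_tendsto[OF g(1)]])
  then show ?thesis
    by (intro connected_intermediate_closure[OF assms(2)]) (use closure_subset in auto)
qed

text \<open>The two short strands at \<open>p\<close> are connected and free of double points, so each lies in one semi-arc;
  the semi-arcs \<open>\<beta>\<^sub>1\<close> and \<open>\<beta>\<^sub>2\<close> may coincide.\<close>

lemma semi_arcs_at:
  assumes L: "link_diagram L" and p: "p \<in> L"
  obtains v \<beta>\<^sub>1 \<beta>\<^sub>2 N where "v \<noteq> 0" "\<beta>\<^sub>1 \<in> semi_arcs L" "\<beta>\<^sub>2 \<in> semi_arcs L"
    "openin (top_of_set L) N" "p \<in> N" "N \<subseteq> insert p (\<beta>\<^sub>1 \<union> \<beta>\<^sub>2)"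
    "issues_from L \<beta>\<^sub>1 p v" "issues_from L \<beta>\<^sub>2 p (- v)"
    "\<And>h w. curve_through L h p w \<Longrightarrow> \<exists>k. w = k *\<^sub>R v \<and>
       (k > 0 \<longrightarrow> (\<forall>\<^sub>F t in at_right 0. h t \<in> \<beta>\<^sub>1)) \<and>
       (k < 0 \<longrightarrow> (\<forall>\<^sub>F t in at_right 0. h t \<in> \<beta>\<^sub>2))"
proof -
  let ?F = "upper_points L \<union> lower_points L"
  obtain v S\<^sub>1 S\<^sub>2 N where *: "v \<noteq> 0" "connected S\<^sub>1" "connected S\<^sub>2"
    "S\<^sub>1 \<subseteq> L - ?F" "S\<^sub>2 \<subseteq> L - ?F" "openin (top_of_set L) N" "p \<in> N" "N = insert p (S\<^sub>1 \<union> S\<^sub>2)"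
    "issues_from L S\<^sub>1 p v" "issues_from L S\<^sub>2 p (- v)" and
    curve: "\<And>h w. curve_through L h p w \<Longrightarrow> \<exists>k. w = k *\<^sub>R v \<and>
       (k > 0 \<longrightarrow> (\<forall>\<^sub>F t in at_right 0. h t \<in> S\<^sub>1)) \<and>
       (k < 0 \<longrightarrow> (\<forall>\<^sub>F t in at_right 0. h t \<in> S\<^sub>2))"
    by (rule link_strands[OF link_diagram_is_link[OF L] finite_double_points[OF L] p]) (rule that)
  have ne: "S \<noteq> {}" if "issues_from L S p u" for S u
    using that unfolding issues_from_def by (auto simp: eventually_False)
  have ex: "\<exists>\<beta>\<in>semi_arcs L. S \<subseteq> \<beta>" if "S \<subseteq> L - ?F" "S \<noteq> {}" "connected S" for S
    using exists_component_superset[of S "L - ?F"] that unfolding semi_arcs_def by blast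
  obtain \<beta>\<^sub>1 \<beta>\<^sub>2 where \<beta>: "\<beta>\<^sub>1 \<in> semi_arcs L" "S\<^sub>1 \<subseteq> \<beta>\<^sub>1" "\<beta>\<^sub>2 \<in> semi_arcs L" "S\<^sub>2 \<subseteq> \<beta>\<^sub>2"
    using ex[OF *(4) ne[OF *(9)] *(2)] ex[OF *(5) ne[OF *(10)] *(3)] by blast
  show ?thesis
  proof (rule that[of v \<beta>\<^sub>1 \<beta>\<^sub>2 N])
    show "issues_from L \<beta>\<^sub>1 p v" "issues_from L \<beta>\<^sub>2 p (- v)"
      using issues_from_mono *(9,10) \<beta> by blast+
    fix h w assume "curve_through L h p w"
    then obtain k where "w = k *\<^sub>R v" "k > 0 \<longrightarrow> (\<forall>\<^sub>F t in at_right 0. h t \<in> S\<^sub>1)"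
        "k < 0 \<longrightarrow> (\<forall>\<^sub>F t in at_right 0. h t \<in> S\<^sub>2)" using curve by blast
    moreover have "\<forall>\<^sub>F t in at_right 0. h t \<in> \<beta>" if "\<forall>\<^sub>F t in at_right 0. h t \<in> S" "S \<subseteq> \<beta>" for S \<beta>
      using that(1) by eventually_elim (use that(2) in blast)
    ultimately show "\<exists>k. w = k *\<^sub>R v \<and>
       (k > 0 \<longrightarrow> (\<forall>\<^sub>F t in at_right 0. h t \<in> \<beta>\<^sub>1)) \<and>
       (k < 0 \<longrightarrow> (\<forall>\<^sub>F t in at_right 0. h t \<in> \<beta>\<^sub>2))"
      using \<beta>(2,4) by (intro exI[of _ k]) blast
  qed (use * \<beta> in auto)
qed

text \<open>By compactness: near any point \<open>p\<close> of the link one sees only the semi-arcs of its two strands and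
  the semi-arc, if any, that contains \<open>p\<close> itself.\<close>

lemma finite_semi_arcs:
  assumes L: "link_diagram L" shows "finite (semi_arcs L)"
proof -
  have "\<exists>T B. open T \<and> p \<in> T \<and> finite B \<and> B \<subseteq> semi_arcs L \<and> L \<inter> T \<subseteq> insert p (\<Union>B)"
    if p: "p \<in> L" for p
  proof -
    obtain \<beta>\<^sub>1 \<beta>\<^sub>2 N where *: "\<beta>\<^sub>1 \<in> semi_arcs L" "\<beta>\<^sub>2 \<in> semi_arcs L"
      "openin (top_of_set L) N" "p \<in> N" "N \<subseteq> insert p (\<beta>\<^sub>1 \<union> \<beta>\<^sub>2)"
      by (rule semi_arcs_at[OF L p]) (rule that)
    obtain T where "open T" "N = L \<inter> T" using *(3) by (auto simp: openin_open)
    then show ?thesis using * by (intro exI[of _ T] exI[of _ "{\<beta>\<^sub>1, \<beta>\<^sub>2}"]) auto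
  qed
  then obtain T B where TB: "\<And>p. p \<in> L \<Longrightarrow> open (T p) \<and> p \<in> T p \<and> finite (B p) \<and>
      B p \<subseteq> semi_arcs L \<and> L \<inter> T p \<subseteq> insert p (\<Union>(B p))" by metis
  obtain P where P: "P \<subseteq> L" "finite P" "L \<subseteq> (\<Union>p\<in>P. T p)"
    by (rule compactE_image[OF compact_link[OF link_diagram_is_link[OF L]], of L T]) (use TB in auto)
  have "semi_arcs L \<subseteq> (\<Union>p\<in>P. B p) \<union> (\<Union>p\<in>P. {\<alpha> \<in> semi_arcs L. p \<in> \<alpha>})"
  proof
    fix \<alpha> assume \<alpha>: "\<alpha> \<in> semi_arcs L"
    then obtain x where x: "x \<in> \<alpha>" "x \<in> L"
      unfolding semi_arcs_def using in_components_nonempty in_components_subset by blast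
    then obtain p where p: "p \<in> P" "x \<in> T p" using P(3) by blast
    then consider "x = p" | \<beta> where "\<beta> \<in> B p" "x \<in> \<beta>" using TB[of p] x P(1) by blast
    then show "\<alpha> \<in> (\<Union>p\<in>P. B p) \<union> (\<Union>p\<in>P. {\<alpha> \<in> semi_arcs L. p \<in> \<alpha>})"
    proof cases
      case 1
      then show ?thesis using p x \<alpha> by blast
    next
      case 2
      then have "\<beta> = \<alpha>" using TB[of p] p P(1) \<alpha> x unfolding semi_arcs_def
        by (meson IntI components_nonoverlap disjoint_iff subsetD)
      then show ?thesis using 2 p by blast
    qed
  qed
  moreover have "finite {\<alpha> \<in> semi_arcs L. p \<in> \<alpha>}" for p
  proof (rule finite_subset)
    show "{\<alpha> \<in> semi_arcs L. p \<in> \<alpha>} \<subseteq> {THE \<alpha>. \<alpha> \<in> semi_arcs L \<and> p \<in> \<alpha>}"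
    proof
      fix \<alpha> assume a: "\<alpha> \<in> {\<alpha> \<in> semi_arcs L. p \<in> \<alpha>}"
      have "(THE \<alpha>. \<alpha> \<in> semi_arcs L \<and> p \<in> \<alpha>) = \<alpha>"
        by (rule the_equality) (use a in \<open>auto simp: semi_arcs_def dest: components_nonoverlap\<close>)
      then show "\<alpha> \<in> {THE \<alpha>. \<alpha> \<in> semi_arcs L \<and> p \<in> \<alpha>}" by simp
    qed
  qed simp
  moreover have "finite (\<Union>p\<in>P. B p)" using P TB by blast
  ultimately show ?thesis using P(2) by (simp add: finite_subset)
qed

lemma semi_arc_facts:
  assumes "\<alpha> \<in> semi_arcs L"
  shows "connected \<alpha>" "\<alpha> \<noteq> {}" "\<alpha> \<subseteq> L - (upper_points L \<union> lower_points L)"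
  using assms in_components_connected in_components_nonempty in_components_subset
  unfolding semi_arcs_def by blast+

lemma semi_arc_eqI:
  "\<alpha> \<in> semi_arcs L \<Longrightarrow> \<beta> \<in> semi_arcs L \<Longrightarrow> x \<in> \<alpha> \<Longrightarrow> x \<in> \<beta> \<Longrightarrow> \<alpha> = \<beta>"
  unfolding semi_arcs_def by (metis IntI components_nonoverlap empty_iff)

text \<open>Adjoining \<open>x\<close> keeps \<open>\<alpha>\<close> connected and free of double points, so \<open>x\<close> already belongs to \<open>\<alpha>\<close>.\<close>

lemma semi_arc_end_interior:
  assumes "\<alpha> \<in> semi_arcs L" "\<beta> \<in> semi_arcs L" "x \<in> \<beta>" "issues_from L \<alpha> x w"
  shows "\<alpha> = \<beta>"
proof -
  have "insert x \<alpha> \<subseteq> \<beta>"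
    using components_maximal[of \<beta> _ "insert x \<alpha>"] connected_insert_end[OF assms(4)]
      semi_arc_facts[OF assms(1)] semi_arc_facts[OF assms(2)] assms unfolding semi_arcs_def by blast
  then show ?thesis using semi_arc_facts(2)[OF assms(1)] semi_arc_eqI[OF assms(1,2)] by blast
qed

lemma ex_semi_arc:
  assumes "x \<in> L" "x \<notin> upper_points L" "x \<notin> lower_points L"
  shows "\<exists>\<alpha>\<in>semi_arcs L. x \<in> \<alpha>"
  using assms Union_components[of "L - (upper_points L \<union> lower_points L)"]
  unfolding semi_arcs_def by blast

definition arc_of :: "point3 set \<Rightarrow> point3 set \<Rightarrow> point3 set" where
  "arc_of L \<alpha> = (THE a. a \<in> arcs L \<and> \<alpha> \<subseteq> a)"

lemma arc_of:
  assumes "\<alpha> \<in> semi_arcs L"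
  shows arc_of_in_arcs: "arc_of L \<alpha> \<in> arcs L" and semi_arc_subset_arc_of: "\<alpha> \<subseteq> arc_of L \<alpha>"
proof -
  note \<alpha> = semi_arc_facts[OF assms]
  have "\<exists>a. a \<in> arcs L \<and> \<alpha> \<subseteq> a"
    unfolding arcs_def by (rule exists_component_superset) (use \<alpha> in auto)
  moreover have "a = b" if "a \<in> arcs L \<and> \<alpha> \<subseteq> a" "b \<in> arcs L \<and> \<alpha> \<subseteq> b" for a b
    using that \<alpha>(2) components_nonoverlap[of a _ b] unfolding arcs_def by blast
  ultimately have "\<exists>!a. a \<in> arcs L \<and> \<alpha> \<subseteq> a" by blast
  from theI'[OF this] show "arc_of L \<alpha> \<in> arcs L" "\<alpha> \<subseteq> arc_of L \<alpha>" by (simp_all add: arc_of_def)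
qed

lemma arc_of_eqI:
  assumes "\<alpha> \<in> semi_arcs L" "a \<in> arcs L" "x \<in> \<alpha>" "x \<in> a" shows "arc_of L \<alpha> = a"
  using arc_of[OF assms(1)] assms components_nonoverlap[of "arc_of L \<alpha>" _ a]
  unfolding arcs_def by blast

lemma arc_of_end:
  assumes "\<alpha> \<in> semi_arcs L" "issues_from L \<alpha> p w" "p \<in> L" "p \<notin> lower_points L" 
  shows "p \<in> arc_of L \<alpha>"
proof -
  have "insert p \<alpha> \<subseteq> arc_of L \<alpha>"
    using components_maximal[of "arc_of L \<alpha>" "L - lower_points L" "insert p \<alpha>"] arc_of[OF assms(1)]
      connected_insert_end[OF assms(2)] semi_arc_facts[OF assms(1)] assms
    unfolding arcs_def by blast
  then show ?thesis by blast
qed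

lemma semi_arc_at_point_of_arc:
  assumes L: "link_diagram L" and a: "a \<in> arcs L" "p \<in> a"
  obtains \<beta> v where "\<beta> \<in> semi_arcs L" "arc_of L \<beta> = a" "issues_from L \<beta> p v"
proof -
  have p: "p \<in> L" "p \<notin> lower_points L" using a in_components_subset unfolding arcs_def by blast+
  obtain v \<beta> where \<beta>: "\<beta> \<in> semi_arcs L" "issues_from L \<beta> p v"
    by (rule semi_arcs_at[OF L p(1)]) (rule that)
  have "arc_of L \<beta> = a"
    using arc_of_end[OF \<beta> p] arc_of[OF \<beta>(1)] a components_nonoverlap[of "arc_of L \<beta>" _ a]
    unfolding arcs_def by blast
  then show ?thesis using \<beta> that by blast
qed

lemma ex_semi_arc_in_arc:
  assumes L: "link_diagram L" and a: "a \<in> arcs L"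
  shows "\<exists>\<beta>\<in>semi_arcs L. arc_of L \<beta> = a"
proof -
  obtain p where "p \<in> a" using a in_components_nonempty unfolding arcs_def by blast
  from semi_arc_at_point_of_arc[OF L a this] show ?thesis by metis
qed

text \<open>A curve that starts into an arc starts into one of its semi-arcs, even though a semi-arc is only a
  piece of the arc: its velocity selects one of the two strands at \<open>p\<close>, and this strand lies in a single
  semi-arc.\<close>

lemma semi_arc_issues_from_arc:
  assumes L: "link_diagram L" and a: "a \<in> arcs L" and p: "p \<in> L" and i: "issues_from L a p w"
  obtains \<beta> where "\<beta> \<in> semi_arcs L" "arc_of L \<beta> = a" "issues_from L \<beta> p w"
proof -
  obtain g where g: "w \<noteq> 0" "curve_through L g p w" "\<forall>\<^sub>F t in at_right 0. g t \<in> a"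
    using i unfolding issues_from_def by blast
  obtain v \<beta>\<^sub>1 \<beta>\<^sub>2 where \<beta>: "\<beta>\<^sub>1 \<in> semi_arcs L" "\<beta>\<^sub>2 \<in> semi_arcs L" and
    c: "\<And>h w. curve_through L h p w \<Longrightarrow> \<exists>k. w = k *\<^sub>R v \<and>
       (k > 0 \<longrightarrow> (\<forall>\<^sub>F t in at_right 0. h t \<in> \<beta>\<^sub>1)) \<and>
       (k < 0 \<longrightarrow> (\<forall>\<^sub>F t in at_right 0. h t \<in> \<beta>\<^sub>2))"
    by (rule semi_arcs_at[OF L p]) (rule that)
  obtain k where k: "w = k *\<^sub>R v" "k > 0 \<longrightarrow> (\<forall>\<^sub>F t in at_right 0. g t \<in> \<beta>\<^sub>1)"
       "k < 0 \<longrightarrow> (\<forall>\<^sub>F t in at_right 0. g t \<in> \<beta>\<^sub>2)" using c[OF g(2)] by blast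
  have "k \<noteq> 0" using g(1) k(1) by auto
  then obtain \<beta> where b: "\<beta> \<in> semi_arcs L" "\<forall>\<^sub>F t in at_right 0. g t \<in> \<beta>"
    using k(2,3) \<beta> by (meson linorder_neqE_linordered_idom)
  have "\<forall>\<^sub>F t in at_right 0. g t \<in> a \<and> g t \<in> \<beta>" using g(3) b(2) by (rule eventually_conj)
  then obtain t where "g t \<in> a" "g t \<in> \<beta>"
    using eventually_happens trivial_limit_at_right_real by blast
  then have "arc_of L \<beta> = a" using arc_of_eqI b(1) a by blast
  moreover have "issues_from L \<beta> p w" unfolding issues_from_def using g b by blast
  ultimately show ?thesis using that b by blast
qed

text \<open>The condition at the over-strand of a crossing once labels are read against the orientation.\<close>

definition constant_over :: "point3 set \<Rightarrow> (point3 set \<Rightarrow> 'a) \<Rightarrow> bool" where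
  "constant_over L l \<longleftrightarrow>
     (\<forall>p w. \<forall>\<beta>1\<in>semi_arcs L. \<forall>\<beta>2\<in>semi_arcs L.
        p \<in> upper_points L \<and> issues_from L \<beta>1 p (- w) \<and> issues_from L \<beta>2 p w \<longrightarrow> l \<beta>1 = l \<beta>2)"

text \<open>An arc is connected, so it suffices that labels are locally constant on it. Around an interior point
  of a semi-arc there is only that semi-arc; around an upper point there are the two semi-arcs of its
  strands, and these carry equal labels. Since an upper point belongs to no semi-arc, the argument
  attaches to every point of the arc all semi-arcs that contain it or end at it.\<close>

lemma constant_over_imp_constant_on_arc:
  assumes L: "link_diagram L" and l: "constant_over L l"
    and \<alpha>: "\<alpha> \<in> semi_arcs L" "\<beta> \<in> semi_arcs L" "arc_of L \<alpha> = arc_of L \<beta>"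
  shows "l \<alpha> = l \<beta>"
proof -
  define a where "a = arc_of L \<alpha>"
  define touch where "touch x \<beta> \<longleftrightarrow> \<beta> \<in> semi_arcs L \<and> (x \<in> \<beta> \<or> (\<exists>w. issues_from L \<beta> x w))" for x \<beta>
  define R where "R x y \<longleftrightarrow> (\<forall>\<beta> \<beta>'. touch x \<beta> \<and> touch y \<beta>' \<longrightarrow> l \<beta> = l \<beta>')" for x y
  have a: "a \<in> arcs L" "connected a" "a \<subseteq> L - lower_points L"
    using arc_of[OF \<alpha>(1)] in_components_connected in_components_subset
    unfolding a_def arcs_def by blast+
  have interior: "\<beta>' = \<beta>" if "touch x \<beta>'" "\<beta> \<in> semi_arcs L" "x \<in> \<beta>" for x \<beta> \<beta>'
    using that semi_arc_end_interior semi_arc_eqI unfolding touch_def by blast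
  obtain x y where xy: "x \<in> \<alpha>" "y \<in> \<beta>" using semi_arc_facts(2) \<alpha> by blast
  have "R x y"
  proof (rule connected_equivalence_relation[OF a(2)])
    show "x \<in> a" "y \<in> a" using xy \<alpha> arc_of(2) unfolding a_def by blast+
    show "R z y" if "R y z" for y z using that unfolding R_def by metis
    show "R x z" if yz: "R x y" "R y z" "x \<in> a" "y \<in> a" for x y z
    proof -
      obtain v \<beta> where "\<beta> \<in> semi_arcs L" "issues_from L \<beta> y v"
        using semi_arc_at_point_of_arc[OF L a(1) yz(4)] by blast
      then have "touch y \<beta>" unfolding touch_def by blast
      then show ?thesis using yz unfolding R_def by metis
    qed
    fix x assume x: "x \<in> a"
    then have xL: "x \<in> L" "x \<notin> lower_points L" using a(3) by auto
    \<comment> \<open>All semi-arcs that contain or end at \<open>x\<close> carry one label, and near \<open>x\<close> no others occur.\<close>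
    obtain v \<beta>\<^sub>1 \<beta>\<^sub>2 N where \<beta>: "v \<noteq> 0" "\<beta>\<^sub>1 \<in> semi_arcs L" "\<beta>\<^sub>2 \<in> semi_arcs L"
      "openin (top_of_set L) N" "x \<in> N" "N \<subseteq> insert x (\<beta>\<^sub>1 \<union> \<beta>\<^sub>2)"
      "issues_from L \<beta>\<^sub>1 x v" "issues_from L \<beta>\<^sub>2 x (- v)" and
      c: "\<And>h w. curve_through L h x w \<Longrightarrow> \<exists>k. w = k *\<^sub>R v \<and>
       (k > 0 \<longrightarrow> (\<forall>\<^sub>F t in at_right 0. h t \<in> \<beta>\<^sub>1)) \<and>
       (k < 0 \<longrightarrow> (\<forall>\<^sub>F t in at_right 0. h t \<in> \<beta>\<^sub>2))"
      by (rule semi_arcs_at[OF L xL(1)]) (rule that)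
    have "l \<beta>\<^sub>1 = l \<beta>\<^sub>2 \<and> (\<forall>\<beta>'. touch x \<beta>' \<longrightarrow> \<beta>' = \<beta>\<^sub>1 \<or> \<beta>' = \<beta>\<^sub>2)"
    proof (cases "x \<in> upper_points L")
      case True
      have "l \<beta>\<^sub>2 = l \<beta>\<^sub>1" using l \<beta> True unfolding constant_over_def by blast
      moreover have "\<beta>' = \<beta>\<^sub>1 \<or> \<beta>' = \<beta>\<^sub>2" if t: "touch x \<beta>'" for \<beta>'
      proof -
        have \<beta>': "\<beta>' \<in> semi_arcs L" using t by (simp add: touch_def)
        have "x \<notin> \<beta>'" using semi_arc_facts(3)[OF \<beta>'] True by blast
        then obtain w where "issues_from L \<beta>' x w" using t unfolding touch_def by blast
        then obtain g where g: "w \<noteq> 0" "curve_through L g x w" "\<forall>\<^sub>F t in at_right 0. g t \<in> \<beta>'"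
          unfolding issues_from_def by blast
        obtain k where k: "w = k *\<^sub>R v" "k > 0 \<longrightarrow> (\<forall>\<^sub>F t in at_right 0. g t \<in> \<beta>\<^sub>1)"
          "k < 0 \<longrightarrow> (\<forall>\<^sub>F t in at_right 0. g t \<in> \<beta>\<^sub>2)" using c[OF g(2)] by blast
        have eq: "\<beta>' = \<beta>''" if b: "\<beta>'' \<in> semi_arcs L" "\<forall>\<^sub>F t in at_right 0. g t \<in> \<beta>''" for \<beta>''
        proof -
          obtain t where "g t \<in> \<beta>' \<and> g t \<in> \<beta>''"
            using eventually_happens[OF eventually_conj[OF g(3) b(2)]] trivial_limit_at_right_real
            by blast
          then show ?thesis using semi_arc_eqI \<beta>' b by blast
        qed
        have "k > 0 \<or> k < 0" using g(1) k(1) by auto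
        then show ?thesis using eq k \<beta>(2,3) by blast
      qed
      ultimately show ?thesis by auto
    next
      case False
      then obtain \<beta>' where "\<beta>' \<in> semi_arcs L" "x \<in> \<beta>'" using ex_semi_arc xL by blast
      moreover have "touch x \<beta>\<^sub>1" "touch x \<beta>\<^sub>2" using \<beta> unfolding touch_def by blast+
      ultimately show ?thesis using interior by blast
    qed
    note at = this
    have "R x y" if y: "y \<in> N" for y
    proof (cases "y = x")
      case True
      then show ?thesis using at unfolding R_def by metis
    next
      case False
      then have "y \<in> \<beta>\<^sub>1 \<or> y \<in> \<beta>\<^sub>2" using y \<beta>(6) by blast
      then show ?thesis using at interior \<beta>(2,3) unfolding R_def by metis
    qed
    moreover have "openin (top_of_set a) (a \<inter> N)"
      using \<beta>(4) a(3) by (auto simp: openin_open)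
    ultimately show "\<exists>T. openin (top_of_set a) T \<and> x \<in> T \<and> (\<forall>y\<in>T. R x y)"
      using x \<beta>(5) by (intro exI[of _ "a \<inter> N"]) auto
  qed
  moreover have "touch x \<alpha>" "touch y \<beta>" using xy \<alpha> unfolding touch_def by blast+
  ultimately show ?thesis unfolding R_def by blast
qed


section \<open>Normal orientations read against an orientation of the diagram\<close>

text \<open>All tangent vectors at \<open>p\<close> are multiples of one vector, by the local picture.\<close>

lemma unit_tangents_opposite:
  assumes L: "link_diagram L" "p \<in> L"
    and w: "w\<^sub>1 \<in> fst ` tangent_space L p" "w\<^sub>2 \<in> fst ` tangent_space L p" "norm w\<^sub>1 = 1" "norm w\<^sub>2 = 1"
  shows "w\<^sub>1 = w\<^sub>2 \<or> w\<^sub>1 = - w\<^sub>2"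
proof -
  obtain v :: point3 where v: "\<And>h w. curve_through L h p w \<Longrightarrow> \<exists>k. w = k *\<^sub>R v"
    by (rule semi_arcs_at[OF L]) blast
  have "\<exists>k. u = k *\<^sub>R fst v" if "u \<in> fst ` tangent_space L p" for u
    using that v unfolding tangent_space_def by fastforce
  then obtain k\<^sub>1 k\<^sub>2 where k: "w\<^sub>1 = k\<^sub>1 *\<^sub>R fst v" "w\<^sub>2 = k\<^sub>2 *\<^sub>R fst v" using w by meson
  then have "\<bar>k\<^sub>1\<bar> * norm (fst v) = 1" "\<bar>k\<^sub>2\<bar> * norm (fst v) = 1" using w by simp_all
  then have "\<bar>k\<^sub>1\<bar> = \<bar>k\<^sub>2\<bar>" by (metis mult_cancel_right mult_zero_right zero_neq_one)
  then have "k\<^sub>1 = k\<^sub>2 \<or> k\<^sub>1 = - k\<^sub>2" by (simp add: abs_eq_iff)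
  then show ?thesis using k by auto
qed

definition agrees :: "(point3 \<Rightarrow> complex) \<Rightarrow> (point3 \<Rightarrow> complex) \<Rightarrow> point3 set \<Rightarrow> bool" where
  "agrees ori \<nu> \<alpha> \<longleftrightarrow> (\<forall>p\<in>\<alpha>. \<nu> p = \<i> * ori p)"

text \<open>At each point a unit normal is one of \<open>\<plusminus> \<i> * ori p\<close>. The points with one sign and those with the
  other form two disjoint relatively closed sets covering the connected semi-arc, so one of them is
  empty.\<close>

lemma normal_orientation_cases:
  assumes L: "link_diagram L" and ori: "diagram_orientation L ori" and \<alpha>: "\<alpha> \<in> semi_arcs L"
    and \<nu>: "\<nu> \<in> normal_orientations L \<alpha>" and na: "\<not> agrees ori \<nu> \<alpha>" and p: "p \<in> \<alpha>"
  shows "\<nu> p = - (\<i> * ori p)"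
proof -
  note \<alpha>s = semi_arc_facts[OF \<alpha>]
  have pm: "\<nu> q = \<i> * ori q \<or> \<nu> q = - (\<i> * ori q)" if q: "q \<in> \<alpha>" for q
  proof -
    have "q \<in> L" using \<alpha>s q by blast
    then have "- \<i> * \<nu> q = ori q \<or> - \<i> * \<nu> q = - ori q"
      using \<nu> ori q by (intro unit_tangents_opposite[OF L])
        (auto simp: normal_orientations_def diagram_orientation_def norm_mult)
    moreover have "\<nu> q = \<i> * (- \<i> * \<nu> q)" by simp
    ultimately show ?thesis by (metis mult_minus_right)
  qed
  have cont: "continuous_on \<alpha> \<nu>" "continuous_on \<alpha> ori"
    using \<nu> ori \<alpha>s(3) by (auto simp: normal_orientations_def diagram_orientation_def
      intro: continuous_on_subset)
  define E where "E s = {q \<in> \<alpha>. \<nu> q - s * (\<i> * ori q) = 0}" for s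
  have closed: "closedin (top_of_set \<alpha>) (E s)" for s
    unfolding E_def
    by (intro continuous_closedin_preimage_constant continuous_intros cont)
  have "E 1 \<inter> E (- 1) = {}"
  proof -
    have "ori q \<noteq> 0" if "q \<in> \<alpha>" for q
      using ori \<alpha>s(3) that unfolding diagram_orientation_def by fastforce
    then show ?thesis by (auto simp: E_def)
  qed
  moreover have "\<alpha> \<subseteq> E 1 \<union> E (- 1)"
  proof
    fix q assume "q \<in> \<alpha>"
    with pm[OF this] show "q \<in> E 1 \<union> E (- 1)" unfolding E_def by fastforce
  qed
  moreover have "E 1 = {} \<or> E (- 1) = {}"
    using \<alpha>s(1) calculation closed unfolding connected_closedin by blast
  moreover have "E 1 \<noteq> \<alpha>" using na unfolding E_def agrees_def by fastforce
  moreover have "E 1 \<subseteq> \<alpha>" by (auto simp: E_def)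
  ultimately have "p \<in> E (- 1)" using p by blast
  then show ?thesis by (simp add: E_def eq_neg_iff_add_eq_0)
qed

lemma orientation_nonzero: "diagram_orientation L ori \<Longrightarrow> p \<in> L \<Longrightarrow> ori p \<noteq> 0"
  unfolding diagram_orientation_def by fastforce

text \<open>On a semi-arc the normal is \<open>\<plusminus> \<i> * ori\<close> with a constant sign, and \<open>ori\<close> is continuous on all of \<open>L\<close>, also at
  double points. So the limit of the normal at an end is known in advance, which removes limits from all
  conditions on colorings.\<close>

lemma end_normal_iff:
  assumes L: "link_diagram L" and ori: "diagram_orientation L ori" and \<alpha>: "\<alpha> \<in> semi_arcs L"
    and \<nu>: "\<nu> \<in> normal_orientations L \<alpha>" and p: "p \<in> L"
  shows "end_normal L \<alpha> \<nu> p w n \<longleftrightarrow>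
    issues_from L \<alpha> p w \<and> n = (if agrees ori \<nu> \<alpha> then \<i> * ori p else - (\<i> * ori p))"
proof -
  let ?n = "if agrees ori \<nu> \<alpha> then \<i> * ori p else - (\<i> * ori p)"
  have lim: "((\<lambda>t. \<nu> (g t)) \<longlongrightarrow> ?n) (at_right 0)"
    if g: "curve_through L g p w" "\<forall>\<^sub>F t in at_right 0. g t \<in> \<alpha>" for g
  proof -
    have gL: "\<forall>\<^sub>F t in at_right 0. g t \<in> L"
      using g(1) by (intro always_eventually) (simp add: curve_through_def)
    have o: "((\<lambda>t. ori (g t)) \<longlongrightarrow> ori p) (at_right 0)"
      using ori by (intro continuous_on_tendsto_compose[OF _ curve_through_tendsto[OF g(1)] p gL])
        (simp add: diagram_orientation_def)
    have "((\<lambda>t. if agrees ori \<nu> \<alpha> then \<i> * ori (g t) else - (\<i> * ori (g t))) \<longlongrightarrow> ?n) (at_right 0)"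
      using o by (auto intro!: tendsto_intros)
    moreover have "\<forall>\<^sub>F t in at_right 0.
        (if agrees ori \<nu> \<alpha> then \<i> * ori (g t) else - (\<i> * ori (g t))) = \<nu> (g t)"
      using g(2)
    proof eventually_elim
      case (elim t)
      then show ?case using normal_orientation_cases[OF L ori \<alpha> \<nu> _ elim] by (auto simp: agrees_def)
    qed
    ultimately show ?thesis by (rule Lim_transform_eventually)
  qed
  show ?thesis
  proof
    assume "end_normal L \<alpha> \<nu> p w n"
    then obtain g where g: "w \<noteq> 0" "curve_through L g p w" "\<forall>\<^sub>F t in at_right 0. g t \<in> \<alpha>"
      "((\<lambda>t. \<nu> (g t)) \<longlongrightarrow> n) (at_right 0)"
      unfolding end_normal_def by blast
    have "n = ?n" using tendsto_unique[OF trivial_limit_at_right_real g(4) lim[OF g(2,3)]] .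
    then show "issues_from L \<alpha> p w \<and> n = ?n" using g unfolding issues_from_def by blast
  next
    assume *: "issues_from L \<alpha> p w \<and> n = ?n"
    then obtain g where g: "w \<noteq> 0" "curve_through L g p w" "\<forall>\<^sub>F t in at_right 0. g t \<in> \<alpha>"
      unfolding issues_from_def by blast
    then show "end_normal L \<alpha> \<nu> p w n" unfolding end_normal_def using lim[OF g(2,3)] * by blast
  qed
qed

text \<open>The crossing conditions of an \<open>X\<close>-coloring of the oriented diagram, for labels on semi-arcs instead
  of arcs.\<close>

definition oriented_semi_coloring ::
    "'a set \<Rightarrow> ('a \<Rightarrow> 'a \<Rightarrow> 'a) \<Rightarrow> point3 set \<Rightarrow> (point3 \<Rightarrow> complex) \<Rightarrow> (point3 set \<Rightarrow> 'a) \<Rightarrow> bool" where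
  "oriented_semi_coloring X f L ori l \<longleftrightarrow>
     l \<in> semi_arcs L \<rightarrow> X \<and> constant_over L l \<and>
     (\<forall>p q u w. \<forall>\<beta>\<in>semi_arcs L. \<forall>\<alpha>1\<in>semi_arcs L. \<forall>\<alpha>2\<in>semi_arcs L.
        crossing L p q \<and> issues_from L \<beta> p u \<and>
        issues_from L \<alpha>1 q (- w) \<and> issues_from L \<alpha>2 q w \<and> fst w \<bullet> (\<i> * ori p) > 0
        \<longrightarrow> f (l \<alpha>1) (l \<beta>) = l \<alpha>2)"

lemma oriented_semi_coloring_cong:
  assumes "\<And>\<alpha>. \<alpha> \<in> semi_arcs L \<Longrightarrow> l \<alpha> = l' \<alpha>"
  shows "oriented_semi_coloring X f L ori l \<longleftrightarrow> oriented_semi_coloring X f L ori l'"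
proof -
  have "oriented_semi_coloring X f L ori l'" if "oriented_semi_coloring X f L ori l"
    "\<And>\<alpha>. \<alpha> \<in> semi_arcs L \<Longrightarrow> l \<alpha> = l' \<alpha>" for l l'
    unfolding oriented_semi_coloring_def constant_over_def
  proof (intro conjI allI ballI impI)
    show "l' \<in> semi_arcs L \<rightarrow> X"
      using that by (auto simp: oriented_semi_coloring_def Pi_def)
    show "l' \<beta>1 = l' \<beta>2" if "\<beta>1 \<in> semi_arcs L" "\<beta>2 \<in> semi_arcs L"
      "p \<in> upper_points L \<and> issues_from L \<beta>1 p (- w) \<and> issues_from L \<beta>2 p w" for p w \<beta>1 \<beta>2
      using that \<open>oriented_semi_coloring X f L ori l\<close> \<open>\<And>\<alpha>. \<alpha> \<in> semi_arcs L \<Longrightarrow> l \<alpha> = l' \<alpha>\<close>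
      unfolding oriented_semi_coloring_def constant_over_def by metis
    show "f (l' \<alpha>1) (l' \<beta>) = l' \<alpha>2"
      if "\<beta> \<in> semi_arcs L" "\<alpha>1 \<in> semi_arcs L" "\<alpha>2 \<in> semi_arcs L"
       "crossing L p q \<and> issues_from L \<beta> p u \<and>
        issues_from L \<alpha>1 q (- w) \<and> issues_from L \<alpha>2 q w \<and> fst w \<bullet> (\<i> * ori p) > 0" for p q u w \<beta> \<alpha>1 \<alpha>2
    proof -
      have "f (l \<alpha>1) (l \<beta>) = l \<alpha>2"
        using that \<open>oriented_semi_coloring X f L ori l\<close> unfolding oriented_semi_coloring_def by blast
      then show ?thesis using that \<open>\<And>\<alpha>. \<alpha> \<in> semi_arcs L \<Longrightarrow> l \<alpha> = l' \<alpha>\<close> by simp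
    qed
  qed
  then show ?thesis using assms by metis
qed

text \<open>The label that a semi-arc has after it has been inverted, if necessary, so that its normal is the one
  given by the orientation.\<close>

definition oriented_label ::
    "('a \<Rightarrow> 'a) \<Rightarrow> (point3 \<Rightarrow> complex) \<Rightarrow> 'a semi_arc_assignment \<Rightarrow> point3 set \<Rightarrow> 'a" where
  "oriented_label \<rho> ori A \<alpha> = (if agrees ori (fst (A \<alpha>)) \<alpha> then snd (A \<alpha>) else \<rho> (snd (A \<alpha>)))"

text \<open>The relation at the under-strand of a crossing, with labels \<open>a\<close>, \<open>c\<close> of the under-semi-arcs and \<open>b\<close> of
  the over-semi-arc; the signs \<open>s\<^sub>1\<close>, \<open>s\<^sub>2\<close> say whether the normals of the under-semi-arcs agree with the
  orientation. The first equivalence passes to oriented labels of the under-semi-arcs. The second one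
  also inverts the over-semi-arc: its normal is then reversed, so that the under-semi-arcs change roles,
  and this is consistent because the right operation by \<open>\<rho> b\<close> is inverse to that by \<open>b\<close>.\<close>

lemma symmetric_quandle_sign_change:
  assumes Q: "symmetric_quandle X f \<rho>" and X: "a \<in> X" "b \<in> X" "c \<in> X"
  shows "f a b = (if s\<^sub>1 = s\<^sub>2 then c else \<rho> c) \<longleftrightarrow>
      f (if s\<^sub>1 then a else \<rho> a) b = (if s\<^sub>2 then c else \<rho> c)"
    and "f a b = (if s\<^sub>1 = s\<^sub>2 then c else \<rho> c) \<longleftrightarrow>
      f (if s\<^sub>2 then c else \<rho> c) (\<rho> b) = (if s\<^sub>1 then a else \<rho> a)"
proof -
  have q: "quandle X f" using Q by (simp add: symmetric_quandle_def)
  have cl: "f x y \<in> X" if "x \<in> X" "y \<in> X" for x y using q that by (simp add: quandle_def)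
  have \<rho>: "\<rho> x \<in> X" "\<rho> (\<rho> x) = x" if "x \<in> X" for x
    using Q that by (auto simp: symmetric_quandle_def good_involution_def)
  have \<rho>f: "f (\<rho> x) y = \<rho> (f x y)" "f x (\<rho> y) = quandle_pow X f x y False" if "x \<in> X" "y \<in> X" for x y
    using Q that by (auto simp: symmetric_quandle_def good_involution_def)
  show 1: "f a b = (if s\<^sub>1 = s\<^sub>2 then c else \<rho> c) \<longleftrightarrow>
      f (if s\<^sub>1 then a else \<rho> a) b = (if s\<^sub>2 then c else \<rho> c)" for s\<^sub>1 s\<^sub>2
    using X \<rho> \<rho>f(1) cl by (cases s\<^sub>1; cases s\<^sub>2) (simp_all, metis+)
  have flip: "f x y = z \<longleftrightarrow> f z (\<rho> y) = x" if "x \<in> X" "y \<in> X" "z \<in> X" for x y z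
    using quandle_pow_False[OF q] quandle_pow_eqI[OF q] \<rho>f(2) that by metis
  show "f a b = (if s\<^sub>1 = s\<^sub>2 then c else \<rho> c) \<longleftrightarrow>
      f (if s\<^sub>2 then c else \<rho> c) (\<rho> b) = (if s\<^sub>1 then a else \<rho> a)"
    unfolding 1 by (rule flip) (use X \<rho> in auto)
qed

text \<open>In the presence of an orientation, the conditions on normals and labels together are conditions on the
  oriented labels alone: at an over-crossing equality, at an under-crossing the oriented crossing
  relation. When the over-semi-arc has the normal opposite to the orientation, the symmetric condition
  for the tangent vector \<open>- w\<close> corresponds to the oriented one for \<open>w\<close>.\<close>

lemma sym_assignment_iff_oriented:
  assumes Q: "symmetric_quandle X f \<rho>" and L: "link_diagram L" and ori: "diagram_orientation L ori"
  shows "sym_assignment X f \<rho> L A \<longleftrightarrow>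
    A \<in> (\<Pi>\<^sub>E \<alpha>\<in>semi_arcs L. normal_orientations L \<alpha> \<times> X) \<and>
    oriented_semi_coloring X f L ori (oriented_label \<rho> ori A)"
proof (cases "A \<in> (\<Pi>\<^sub>E \<alpha>\<in>semi_arcs L. normal_orientations L \<alpha> \<times> X)")
  case False
  then show ?thesis by (simp add: sym_assignment_def)
next
  case A: True
  define x s l where "x = (\<lambda>\<alpha>. snd (A \<alpha>))" and "s = (\<lambda>\<alpha>. agrees ori (fst (A \<alpha>)) \<alpha>)"
    and "l = oriented_label \<rho> ori A"
  have l: "l \<alpha> = (if s \<alpha> then x \<alpha> else \<rho> (x \<alpha>))" for \<alpha>
    by (simp add: l_def s_def x_def oriented_label_def)
  have \<rho>: "\<rho> y \<in> X" "\<rho> (\<rho> y) = y" if "y \<in> X" for y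
    using Q that by (auto simp: symmetric_quandle_def good_involution_def)
  have \<nu>: "fst (A \<alpha>) \<in> normal_orientations L \<alpha>" and xX: "x \<alpha> \<in> X" if "\<alpha> \<in> semi_arcs L" for \<alpha>
    using A that by (auto simp: x_def PiE_def Pi_def mem_Times_iff)
  have lX: "l \<in> semi_arcs L \<rightarrow> X" using xX \<rho> by (auto simp: l)
  define N where "N \<alpha> p = (if s \<alpha> then \<i> * ori p else - (\<i> * ori p))" for \<alpha> p
  have en: "end_normal L \<alpha> (fst (A \<alpha>)) p w n \<longleftrightarrow> issues_from L \<alpha> p w \<and> n = N \<alpha> p"
    if "\<alpha> \<in> semi_arcs L" "p \<in> L" for \<alpha> p w n
    unfolding N_def s_def using end_normal_iff[OF L ori that(1) \<nu>[OF that(1)] that(2)] .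
  have N: "N \<alpha> p = N \<beta> p \<longleftrightarrow> s \<alpha> = s \<beta>" if "p \<in> L" for \<alpha> \<beta> p
    using orientation_nonzero[OF ori that] by (auto simp: N_def)
  have up: "p \<in> L" if "p \<in> upper_points L" for p
    using that by (auto simp: upper_points_def crossing_def)
  have cr: "p \<in> L" "q \<in> L" if "crossing L p q" for p q using that by (auto simp: crossing_def)
  have over: "(\<forall>p w n1 n2. \<forall>\<beta>1\<in>semi_arcs L. \<forall>\<beta>2\<in>semi_arcs L.
        p \<in> upper_points L \<and>
        end_normal L \<beta>1 (fst (A \<beta>1)) p (- w) n1 \<and> end_normal L \<beta>2 (fst (A \<beta>2)) p w n2
        \<longrightarrow> snd (A \<beta>1) = (if n1 = n2 then snd (A \<beta>2) else \<rho> (snd (A \<beta>2)))) \<longleftrightarrow> constant_over L l"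
    (is "?O \<longleftrightarrow> _")
  proof -
    have sgn: "x \<beta>1 = (if s \<beta>1 = s \<beta>2 then x \<beta>2 else \<rho> (x \<beta>2)) \<longleftrightarrow> l \<beta>1 = l \<beta>2"
      if "\<beta>1 \<in> semi_arcs L" "\<beta>2 \<in> semi_arcs L" for \<beta>1 \<beta>2
      using xX[OF that(1)] xX[OF that(2)] \<rho> by (auto simp: l) metis+
    show ?thesis
    proof
      assume O: ?O
      show "constant_over L l"
        unfolding constant_over_def
      proof (intro allI ballI impI)
        fix p w \<beta>1 \<beta>2
        assume b: "\<beta>1 \<in> semi_arcs L" "\<beta>2 \<in> semi_arcs L"
          "p \<in> upper_points L \<and> issues_from L \<beta>1 p (- w) \<and> issues_from L \<beta>2 p w"
        have p: "p \<in> L" using up b(3) by blast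
        have "x \<beta>1 = (if N \<beta>1 p = N \<beta>2 p then x \<beta>2 else \<rho> (x \<beta>2))"
          unfolding x_def
          by (rule O[rule_format, OF b(1,2), of p w]) (use b en[OF b(1) p] en[OF b(2) p] in simp)
        then show "l \<beta>1 = l \<beta>2" using sgn[OF b(1,2)] N[OF p] by simp
      qed
    next
      assume l: "constant_over L l"
      show ?O
      proof (intro allI ballI impI)
        fix p w n1 n2 \<beta>1 \<beta>2
        assume b: "\<beta>1 \<in> semi_arcs L" "\<beta>2 \<in> semi_arcs L" "p \<in> upper_points L \<and>
          end_normal L \<beta>1 (fst (A \<beta>1)) p (- w) n1 \<and> end_normal L \<beta>2 (fst (A \<beta>2)) p w n2"
        have p: "p \<in> L" using up b(3) by blast
        have i: "issues_from L \<beta>1 p (- w)" "issues_from L \<beta>2 p w" "n1 = N \<beta>1 p" "n2 = N \<beta>2 p"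
          using b en[OF b(1) p] en[OF b(2) p] by simp_all
        have "l \<beta>1 = l \<beta>2"
          using l[unfolded constant_over_def, rule_format, OF b(1,2), of p w] i b(3) by simp
        then show "snd (A \<beta>1) = (if n1 = n2 then snd (A \<beta>2) else \<rho> (snd (A \<beta>2)))"
          using sgn[OF b(1,2)] N[OF p] i by (simp add: x_def)
      qed
    qed
  qed
  have "(\<forall>p q u w n n1 n2. \<forall>\<beta>\<in>semi_arcs L. \<forall>\<alpha>1\<in>semi_arcs L. \<forall>\<alpha>2\<in>semi_arcs L.
        crossing L p q \<and> end_normal L \<beta> (fst (A \<beta>)) p u n \<and>
        end_normal L \<alpha>1 (fst (A \<alpha>1)) q (- w) n1 \<and> end_normal L \<alpha>2 (fst (A \<alpha>2)) q w n2 \<and>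
        fst w \<bullet> n > 0
        \<longrightarrow> f (snd (A \<alpha>1)) (snd (A \<beta>)) = (if n1 = n2 then snd (A \<alpha>2) else \<rho> (snd (A \<alpha>2)))) \<longleftrightarrow>
      (\<forall>p q u w. \<forall>\<beta>\<in>semi_arcs L. \<forall>\<alpha>1\<in>semi_arcs L. \<forall>\<alpha>2\<in>semi_arcs L.
        crossing L p q \<and> issues_from L \<beta> p u \<and>
        issues_from L \<alpha>1 q (- w) \<and> issues_from L \<alpha>2 q w \<and> fst w \<bullet> (\<i> * ori p) > 0
        \<longrightarrow> f (l \<alpha>1) (l \<beta>) = l \<alpha>2)" (is "?U \<longleftrightarrow> ?V")
  proof -
    let ?W = "\<forall>p q u w. \<forall>\<beta>\<in>semi_arcs L. \<forall>\<alpha>1\<in>semi_arcs L. \<forall>\<alpha>2\<in>semi_arcs L.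
        crossing L p q \<and> issues_from L \<beta> p u \<and>
        issues_from L \<alpha>1 q (- w) \<and> issues_from L \<alpha>2 q w \<and> fst w \<bullet> N \<beta> p > 0
        \<longrightarrow> f (x \<alpha>1) (x \<beta>) = (if s \<alpha>1 = s \<alpha>2 then x \<alpha>2 else \<rho> (x \<alpha>2))"
    have "?U \<longleftrightarrow> ?W"
    proof
      assume U: ?U
      show ?W
      proof (intro allI ballI impI)
        fix p q u w \<beta> \<alpha>1 \<alpha>2
        assume a: "\<beta> \<in> semi_arcs L" "\<alpha>1 \<in> semi_arcs L" "\<alpha>2 \<in> semi_arcs L"
          "crossing L p q \<and> issues_from L \<beta> p u \<and>
           issues_from L \<alpha>1 q (- w) \<and> issues_from L \<alpha>2 q w \<and> fst w \<bullet> N \<beta> p > 0"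
        have pq: "p \<in> L" "q \<in> L" using a(4) cr by blast+
        have "f (x \<alpha>1) (x \<beta>) = (if N \<alpha>1 q = N \<alpha>2 q then x \<alpha>2 else \<rho> (x \<alpha>2))"
          unfolding x_def
          by (rule U[rule_format, OF a(1-3), of p q u "N \<beta> p" w])
            (use a en[OF a(1) pq(1)] en[OF a(2) pq(2)] en[OF a(3) pq(2)] in simp)
        then show "f (x \<alpha>1) (x \<beta>) = (if s \<alpha>1 = s \<alpha>2 then x \<alpha>2 else \<rho> (x \<alpha>2))"
          by (simp add: N[OF pq(2)])
      qed
    next
      assume W: ?W
      show ?U
      proof (intro allI ballI impI)
        fix p q u w n n1 n2 \<beta> \<alpha>1 \<alpha>2
        assume a: "\<beta> \<in> semi_arcs L" "\<alpha>1 \<in> semi_arcs L" "\<alpha>2 \<in> semi_arcs L"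
          "crossing L p q \<and> end_normal L \<beta> (fst (A \<beta>)) p u n \<and>
           end_normal L \<alpha>1 (fst (A \<alpha>1)) q (- w) n1 \<and> end_normal L \<alpha>2 (fst (A \<alpha>2)) q w n2 \<and>
           fst w \<bullet> n > 0"
        have pq: "p \<in> L" "q \<in> L" using a(4) cr by blast+
        have i: "issues_from L \<beta> p u" "n = N \<beta> p" "issues_from L \<alpha>1 q (- w)" "n1 = N \<alpha>1 q"
            "issues_from L \<alpha>2 q w" "n2 = N \<alpha>2 q"
          using a(4) en[OF a(1) pq(1)] en[OF a(2) pq(2)] en[OF a(3) pq(2)] by simp_all
        have "f (x \<alpha>1) (x \<beta>) = (if s \<alpha>1 = s \<alpha>2 then x \<alpha>2 else \<rho> (x \<alpha>2))"
          by (rule W[rule_format, OF a(1-3), of p q u w]) (use a(4) i in simp)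
        then show "f (snd (A \<alpha>1)) (snd (A \<beta>)) = (if n1 = n2 then snd (A \<alpha>2) else \<rho> (snd (A \<alpha>2)))"
          by (simp add: x_def i N[OF pq(2)])
      qed
    qed
    also have "\<dots> \<longleftrightarrow> ?V"
    proof
      assume W: ?W
      show ?V
      proof (intro allI ballI impI)
        fix p q u w \<beta> \<alpha>1 \<alpha>2
        assume a: "\<beta> \<in> semi_arcs L" "\<alpha>1 \<in> semi_arcs L" "\<alpha>2 \<in> semi_arcs L"
          "crossing L p q \<and> issues_from L \<beta> p u \<and>
           issues_from L \<alpha>1 q (- w) \<and> issues_from L \<alpha>2 q w \<and> fst w \<bullet> (\<i> * ori p) > 0"
        note xs = xX[OF a(1)] xX[OF a(2)] xX[OF a(3)]
        show "f (l \<alpha>1) (l \<beta>) = l \<alpha>2"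
        proof (cases "s \<beta>")
          case True
          then have "f (x \<alpha>1) (x \<beta>) = (if s \<alpha>1 = s \<alpha>2 then x \<alpha>2 else \<rho> (x \<alpha>2))"
            using W[rule_format, OF a(1-3), of p q u w] a(4) by (simp add: N_def)
          then show ?thesis
            using symmetric_quandle_sign_change(1)[OF Q xs(2,1,3), of "s \<alpha>1" "s \<alpha>2"] True
            by (simp add: l)
        next
          case False
          \<comment> \<open>The normal of the over-semi-arc points against the orientation, so the symmetric
            condition applies to the same crossing with \<open>- w\<close> and the under-semi-arcs exchanged.\<close>
          then have "f (x \<alpha>2) (x \<beta>) = (if s \<alpha>2 = s \<alpha>1 then x \<alpha>1 else \<rho> (x \<alpha>1))"
            using W[rule_format, OF a(1,3,2), of p q u "- w"] a(4) by (simp add: N_def)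
          then show ?thesis
            using symmetric_quandle_sign_change(2)[OF Q xs(3,1,2), of "s \<alpha>2" "s \<alpha>1"] False
            by (simp add: l)
        qed
      qed
    next
      assume V: ?V
      show ?W
      proof (intro allI ballI impI)
        fix p q u w \<beta> \<alpha>1 \<alpha>2
        assume a: "\<beta> \<in> semi_arcs L" "\<alpha>1 \<in> semi_arcs L" "\<alpha>2 \<in> semi_arcs L"
          "crossing L p q \<and> issues_from L \<beta> p u \<and>
           issues_from L \<alpha>1 q (- w) \<and> issues_from L \<alpha>2 q w \<and> fst w \<bullet> N \<beta> p > 0"
        note xs = xX[OF a(1)] xX[OF a(2)] xX[OF a(3)]
        show "f (x \<alpha>1) (x \<beta>) = (if s \<alpha>1 = s \<alpha>2 then x \<alpha>2 else \<rho> (x \<alpha>2))"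
        proof (cases "s \<beta>")
          case True
          then have "f (l \<alpha>1) (l \<beta>) = l \<alpha>2"
            using V[rule_format, OF a(1-3), of p q u w] a(4) by (simp add: N_def)
          then show ?thesis
            using symmetric_quandle_sign_change(1)[OF Q xs(2,1,3), of "s \<alpha>1" "s \<alpha>2"] True
            by (simp add: l)
        next
          case False
          then have "f (l \<alpha>2) (l \<beta>) = l \<alpha>1"
            using V[rule_format, OF a(1,3,2), of p q u "- w"] a(4) by (simp add: N_def)
          then show ?thesis
            using symmetric_quandle_sign_change(2)[OF Q xs(2,1,3), of "s \<alpha>1" "s \<alpha>2"] False
            by (simp add: l)
        qed
      qed
    qed
    finally show ?thesis .
  qed
  then show ?thesis
    unfolding sym_assignment_def oriented_semi_coloring_def over l_def[symmetric]
    using A lX by blast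
qed


section \<open>Colorings by a symmetric quandle as labelings of semi-arcs\<close>

text \<open>A basic inversion flips the agreement with the orientation and applies \<open>\<rho>\<close> to the label; the two
  changes cancel because \<open>\<rho>\<close> is an involution.\<close>

lemma basic_inversion_oriented_label:
  assumes L: "link_diagram L" and ori: "diagram_orientation L ori"
    and \<rho>: "\<And>x. x \<in> X \<Longrightarrow> \<rho> (\<rho> x) = x"
    and A: "A \<in> (\<Pi>\<^sub>E \<alpha>\<in>semi_arcs L. normal_orientations L \<alpha> \<times> X)"
    and inv: "basic_inversion \<rho> L A B" and \<beta>: "\<beta> \<in> semi_arcs L"
  shows "oriented_label \<rho> ori B \<beta> = oriented_label \<rho> ori A \<beta>"
proof -
  obtain \<alpha> where \<alpha>: "\<alpha> \<in> semi_arcs L"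
    and B: "B = A(\<alpha> := (restrict (\<lambda>p. - fst (A \<alpha>) p) \<alpha>, \<rho> (snd (A \<alpha>))))"
    using inv unfolding basic_inversion_def by blast
  have \<nu>: "fst (A \<alpha>) \<in> normal_orientations L \<alpha>" and x: "snd (A \<alpha>) \<in> X"
    using A \<alpha> by (auto simp: PiE_def Pi_def mem_Times_iff)
  obtain p where p: "p \<in> \<alpha>" using semi_arc_facts(2)[OF \<alpha>] by blast
  have pL: "q \<in> L" if "q \<in> \<alpha>" for q using that semi_arc_facts(3)[OF \<alpha>] by blast
  have "agrees ori (restrict (\<lambda>p. - fst (A \<alpha>) p) \<alpha>) \<alpha> \<longleftrightarrow> \<not> agrees ori (fst (A \<alpha>)) \<alpha>"
    (is "?l \<longleftrightarrow> ?r")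
  proof
    assume ?l
    then have "- fst (A \<alpha>) p = \<i> * ori p" using p by (simp add: agrees_def)
    moreover have "\<i> * ori p \<noteq> 0" using orientation_nonzero[OF ori pL[OF p]] by simp
    ultimately have "fst (A \<alpha>) p \<noteq> \<i> * ori p" by (auto simp: complex_eq_iff)
    then show ?r using p by (auto simp: agrees_def)
  next
    assume ?r
    show ?l
      unfolding agrees_def
    proof
      fix q assume q: "q \<in> \<alpha>"
      with normal_orientation_cases[OF L ori \<alpha> \<nu> \<open>?r\<close> q]
      show "restrict (\<lambda>p. - fst (A \<alpha>) p) \<alpha> q = \<i> * ori q" by simp
    qed
  qed
  then show ?thesis using \<rho>[OF x] by (auto simp: oriented_label_def B)
qed

text \<open>A semi-arc has exactly two normal orientations, so a given oriented label is realized by exactly two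
  pairs of a normal and a label, which differ by a basic inversion.\<close>

lemma assignment_eq_if_labels_eq:
  assumes L: "link_diagram L" and ori: "diagram_orientation L ori"
    and \<rho>: "\<And>x. x \<in> X \<Longrightarrow> \<rho> (\<rho> x) = x"
    and A: "A \<in> (\<Pi>\<^sub>E \<alpha>\<in>semi_arcs L. normal_orientations L \<alpha> \<times> X)"
    and B: "B \<in> (\<Pi>\<^sub>E \<alpha>\<in>semi_arcs L. normal_orientations L \<alpha> \<times> X)"
    and \<alpha>: "\<alpha> \<in> semi_arcs L" and eq: "oriented_label \<rho> ori A \<alpha> = oriented_label \<rho> ori B \<alpha>"
  shows "agrees ori (fst (A \<alpha>)) \<alpha> = agrees ori (fst (B \<alpha>)) \<alpha> \<Longrightarrow> A \<alpha> = B \<alpha>"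
    and "agrees ori (fst (A \<alpha>)) \<alpha> \<noteq> agrees ori (fst (B \<alpha>)) \<alpha> \<Longrightarrow>
      B \<alpha> = (restrict (\<lambda>p. - fst (A \<alpha>) p) \<alpha>, \<rho> (snd (A \<alpha>)))"
proof -
  have \<nu>: "fst (A \<alpha>) \<in> normal_orientations L \<alpha>" "fst (B \<alpha>) \<in> normal_orientations L \<alpha>"
    and x: "snd (A \<alpha>) \<in> X" "snd (B \<alpha>) \<in> X"
    using A B \<alpha> by (auto simp: PiE_def Pi_def mem_Times_iff)
  have val: "\<nu> p = (if agrees ori \<nu> \<alpha> then \<i> * ori p else - (\<i> * ori p))"
    if "\<nu> \<in> normal_orientations L \<alpha>" "p \<in> \<alpha>" for \<nu> p
    using normal_orientation_cases[OF L ori \<alpha> that(1) _ that(2)] that(2) by (auto simp: agrees_def)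
  have ext: "fst (A \<alpha>) \<in> extensional \<alpha>" "fst (B \<alpha>) \<in> extensional \<alpha>"
    using \<nu> by (auto simp: normal_orientations_def)
  {
    assume s: "agrees ori (fst (A \<alpha>)) \<alpha> = agrees ori (fst (B \<alpha>)) \<alpha>"
    have "fst (A \<alpha>) = fst (B \<alpha>)"
    proof (rule extensionalityI[OF ext])
      fix p assume "p \<in> \<alpha>"
      with val[OF \<nu>(1) this] val[OF \<nu>(2) this] s
      show "fst (A \<alpha>) p = fst (B \<alpha>) p" by (simp only:)
    qed
    moreover have "snd (A \<alpha>) = snd (B \<alpha>)"
      using eq s \<rho>[OF x(1)] \<rho>[OF x(2)] unfolding oriented_label_def by metis
    ultimately show "A \<alpha> = B \<alpha>" by (rule prod_eqI)
  next
    assume s: "agrees ori (fst (A \<alpha>)) \<alpha> \<noteq> agrees ori (fst (B \<alpha>)) \<alpha>"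
    have "fst (B \<alpha>) = restrict (\<lambda>p. - fst (A \<alpha>) p) \<alpha>"
    proof (rule extensionalityI[OF ext(2)])
      fix p assume "p \<in> \<alpha>"
      with val[OF \<nu>(1) this] val[OF \<nu>(2) this] s
      show "fst (B \<alpha>) p = restrict (\<lambda>p. - fst (A \<alpha>) p) \<alpha> p" by (auto split: if_splits)
    qed simp
    moreover have "snd (B \<alpha>) = \<rho> (snd (A \<alpha>))"
      using eq s \<rho>[OF x(1)] \<rho>[OF x(2)] unfolding oriented_label_def by metis
    ultimately show "B \<alpha> = (restrict (\<lambda>p. - fst (A \<alpha>) p) \<alpha>, \<rho> (snd (A \<alpha>)))"
      by (metis prod.collapse)
  }
qed

text \<open>A curve run backwards has the opposite velocity, so tangent spaces are symmetric.\<close>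

lemma neg_normal_orientation:
  assumes "\<nu> \<in> normal_orientations L \<alpha>"
  shows "restrict (\<lambda>p. - \<nu> p) \<alpha> \<in> normal_orientations L \<alpha>"
proof -
  have neg: "- w \<in> fst ` tangent_space L p" if "w \<in> fst ` tangent_space L p" for w p
  proof -
    obtain u g where u: "w = fst u" "curve_through L g p u"
      using \<open>w \<in> fst ` tangent_space L p\<close> unfolding tangent_space_def by blast
    have "((\<lambda>t. - t) has_vector_derivative - 1) (at (0::real))"
      by (auto intro!: derivative_eq_intros)
    then have "(g \<circ> (\<lambda>t. - t) has_vector_derivative (- 1) *\<^sub>R u) (at 0)"
      by (rule vector_diff_chain_at) (use u in \<open>simp add: curve_through_def\<close>)
    then have "curve_through L (\<lambda>t. g (- t)) p (- u)"
      using u by (simp add: curve_through_def o_def)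
    then have "- u \<in> tangent_space L p" unfolding tangent_space_def by blast
    then show ?thesis using u(1) by force
  qed
  have "continuous_on \<alpha> (restrict (\<lambda>p. - \<nu> p) \<alpha>) \<longleftrightarrow> continuous_on \<alpha> (\<lambda>p. - \<nu> p)"
    by (rule continuous_on_cong) simp_all
  moreover have "continuous_on \<alpha> (\<lambda>p. - \<nu> p)"
    using assms by (intro continuous_on_minus) (simp add: normal_orientations_def)
  moreover have "- \<i> * - \<nu> p \<in> fst ` tangent_space L p" if "p \<in> \<alpha>" for p
    using neg[of "- \<i> * \<nu> p" p] assms that by (simp add: normal_orientations_def)
  moreover have "norm (\<nu> p) = 1" if "p \<in> \<alpha>" for p
    using assms that by (simp add: normal_orientations_def)
  ultimately show ?thesis unfolding normal_orientations_def by simp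
qed

definition inversion_step ::
    "'a set \<Rightarrow> ('a \<Rightarrow> 'a \<Rightarrow> 'a) \<Rightarrow> ('a \<Rightarrow> 'a) \<Rightarrow> point3 set \<Rightarrow>
     'a semi_arc_assignment \<Rightarrow> 'a semi_arc_assignment \<Rightarrow> bool" where
  "inversion_step X f \<rho> L A B \<longleftrightarrow>
     sym_assignment X f \<rho> L A \<and> sym_assignment X f \<rho> L B \<and> basic_inversion \<rho> L A B"

text \<open>The oriented labels are a complete invariant of the equivalence generated by basic inversions. For
  completeness one inverts, one after the other, the finitely many semi-arcs on which two assignments
  with the same oriented labels differ; each intermediate assignment again satisfies the crossing
  conditions, since these depend on the oriented labels only.\<close>

lemma equivclp_inversion_iff:
  assumes Q: "symmetric_quandle X f \<rho>" and L: "link_diagram L" and ori: "diagram_orientation L ori"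
    and AB: "sym_assignment X f \<rho> L A" "sym_assignment X f \<rho> L B"
  shows "equivclp (inversion_step X f \<rho> L) A B \<longleftrightarrow>
    (\<forall>\<alpha>\<in>semi_arcs L. oriented_label \<rho> ori B \<alpha> = oriented_label \<rho> ori A \<alpha>)"
proof
  have \<rho>: "\<rho> (\<rho> x) = x" "\<rho> x \<in> X" if "x \<in> X" for x
    using Q that by (auto simp: symmetric_quandle_def good_involution_def)
  note iff = sym_assignment_iff_oriented[OF Q L ori]
  show "\<forall>\<alpha>\<in>semi_arcs L. oriented_label \<rho> ori B \<alpha> = oriented_label \<rho> ori A \<alpha>"
    if "equivclp (inversion_step X f \<rho> L) A B"
    using that
  proof (induction rule: equivclp_induct)
    case (step B C)
    have "oriented_label \<rho> ori C \<alpha> = oriented_label \<rho> ori B \<alpha>" if "\<alpha> \<in> semi_arcs L" for \<alpha>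
    proof -
      have *: "oriented_label \<rho> ori C \<alpha> = oriented_label \<rho> ori B \<alpha>" if "inversion_step X f \<rho> L B C" for B C
        using basic_inversion_oriented_label[OF L ori \<rho>(1) _ _ \<open>\<alpha> \<in> semi_arcs L\<close>, of X B C] that
        unfolding inversion_step_def iff by blast
      show ?thesis using step.hyps(2) *[of B C] *[of C B] by argo
    qed
    then show ?case using step.IH by simp
  qed simp
  show "equivclp (inversion_step X f \<rho> L) A B"
    if "\<forall>\<alpha>\<in>semi_arcs L. oriented_label \<rho> ori B \<alpha> = oriented_label \<rho> ori A \<alpha>"
    using AB(1) that
  proof (induction "card {\<alpha>\<in>semi_arcs L. A \<alpha> \<noteq> B \<alpha>}" arbitrary: A rule: less_induct)
    case (less A)
    have PA: "A \<in> (\<Pi>\<^sub>E \<alpha>\<in>semi_arcs L. normal_orientations L \<alpha> \<times> X)"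
      and PB: "B \<in> (\<Pi>\<^sub>E \<alpha>\<in>semi_arcs L. normal_orientations L \<alpha> \<times> X)"
      using less.prems(1) AB(2) iff[THEN iffD1] by blast+
    show ?case
    proof (cases "\<exists>\<alpha>\<in>semi_arcs L. A \<alpha> \<noteq> B \<alpha>")
      case False
      then have "A = B" using PiE_ext[OF PA PB] by blast
      then show ?thesis by simp
    next
      case True
      then obtain \<alpha> where \<alpha>: "\<alpha> \<in> semi_arcs L" "A \<alpha> \<noteq> B \<alpha>" by blast
      \<comment> \<open>Two values of an assignment with the same oriented label are equal or inverse to each other, so
        inverting \<open>A\<close> where it differs from \<open>B\<close> makes it agree with \<open>B\<close> there.\<close>
      define A' where "A' = A(\<alpha> := (restrict (\<lambda>p. - fst (A \<alpha>) p) \<alpha>, \<rho> (snd (A \<alpha>))))"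
      have eq: "oriented_label \<rho> ori A \<alpha> = oriented_label \<rho> ori B \<alpha>" using less.prems(2) \<alpha>(1) by simp
      have "B \<alpha> = A' \<alpha>"
        using assignment_eq_if_labels_eq[OF L ori \<rho>(1) PA PB \<alpha>(1) eq] \<alpha>(2) by (auto simp: A'_def)
      have inv: "basic_inversion \<rho> L A A'" using \<alpha>(1) unfolding basic_inversion_def A'_def by blast
      have lab: "oriented_label \<rho> ori A' \<beta> = oriented_label \<rho> ori A \<beta>" if "\<beta> \<in> semi_arcs L" for \<beta>
        using basic_inversion_oriented_label[OF L ori \<rho>(1) PA inv that] .
      have "A' \<in> (\<Pi>\<^sub>E \<alpha>\<in>semi_arcs L. normal_orientations L \<alpha> \<times> X)"
      proof (rule PiE_I)
        fix \<beta> assume \<beta>: "\<beta> \<in> semi_arcs L"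
        then have "fst (A \<beta>) \<in> normal_orientations L \<beta>" "snd (A \<beta>) \<in> X"
          using PiE_mem[OF PA \<beta>] by (simp_all add: mem_Times_iff)
        then show "A' \<beta> \<in> normal_orientations L \<beta> \<times> X"
          using neg_normal_orientation[of "fst (A \<beta>)" L \<beta>] \<rho>(2)[of "snd (A \<beta>)"] PiE_mem[OF PA \<beta>]
          by (auto simp: A'_def)
      next
        fix \<beta> assume "\<beta> \<notin> semi_arcs L"
        then have "\<beta> \<noteq> \<alpha>" "A \<beta> = undefined" using \<alpha>(1) PiE_arb[OF PA] by blast+
        then show "A' \<beta> = undefined" by (simp add: A'_def)
      qed
      then have A': "sym_assignment X f \<rho> L A'"
        using iff[THEN iffD1, OF less.prems(1)]
          oriented_semi_coloring_cong[of L "oriented_label \<rho> ori A'" "oriented_label \<rho> ori A", OF lab]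
        by (intro iff[THEN iffD2] conjI) blast+
      have "{\<beta>\<in>semi_arcs L. A' \<beta> \<noteq> B \<beta>} \<subset> {\<beta>\<in>semi_arcs L. A \<beta> \<noteq> B \<beta>}"
      proof -
        have "A' \<beta> = A \<beta>" if "\<beta> \<noteq> \<alpha>" for \<beta> using that by (simp add: A'_def)
        note A'_other = this
        have sub1: "\<beta> \<noteq> \<alpha>" if d: "A' \<beta> \<noteq> B \<beta>" for \<beta>
        proof
          assume "\<beta> = \<alpha>"
          with d \<open>B \<alpha> = A' \<alpha>\<close> show False by (simp only: not_True_eq_False HOL.simp_thms)
        qed
        have sub2: "A \<beta> \<noteq> B \<beta>" if d: "A' \<beta> \<noteq> B \<beta>" for \<beta>
          using A'_other[OF sub1[OF d]] d by simp
        show ?thesis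
        proof (rule psubsetI)
          show "{\<beta>\<in>semi_arcs L. A' \<beta> \<noteq> B \<beta>} \<subseteq> {\<beta>\<in>semi_arcs L. A \<beta> \<noteq> B \<beta>}"
            using sub2 by blast
          have "\<alpha> \<in> {\<beta>\<in>semi_arcs L. A \<beta> \<noteq> B \<beta>}" "\<alpha> \<notin> {\<beta>\<in>semi_arcs L. A' \<beta> \<noteq> B \<beta>}"
            using \<alpha> sub1 by blast+
          then show "{\<beta>\<in>semi_arcs L. A' \<beta> \<noteq> B \<beta>} \<noteq> {\<beta>\<in>semi_arcs L. A \<beta> \<noteq> B \<beta>}"
            by blast
        qed
      qed
      then have "card {\<beta>\<in>semi_arcs L. A' \<beta> \<noteq> B \<beta>} < card {\<beta>\<in>semi_arcs L. A \<beta> \<noteq> B \<beta>}"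
        by (rule psubset_card_mono[rotated]) (simp add: finite_semi_arcs[OF L])
      then have "equivclp (inversion_step X f \<rho> L) A' B"
      proof (rule less.hyps)
        show "\<forall>\<alpha>\<in>semi_arcs L. oriented_label \<rho> ori B \<alpha> = oriented_label \<rho> ori A' \<alpha>"
          by (simp add: lab less.prems(2)[THEN bspec])
      qed (rule A')
      moreover have "equivclp (inversion_step X f \<rho> L) A A'"
        using less.prems(1) A' inv by (intro r_into_equivclp) (simp only: inversion_step_def)
      ultimately show ?thesis by (rule equivclp_trans[rotated])
    qed
  qed
qed

definition label_class ::
    "'a set \<Rightarrow> ('a \<Rightarrow> 'a \<Rightarrow> 'a) \<Rightarrow> ('a \<Rightarrow> 'a) \<Rightarrow> point3 set \<Rightarrow> (point3 \<Rightarrow> complex) \<Rightarrow>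
     (point3 set \<Rightarrow> 'a) \<Rightarrow> 'a semi_arc_assignment set" where
  "label_class X f \<rho> L ori l =
     {A. sym_assignment X f \<rho> L A \<and> (\<forall>\<alpha>\<in>semi_arcs L. oriented_label \<rho> ori A \<alpha> = l \<alpha>)}"

text \<open>Colorings by a symmetric quandle are thereby identified with labelings of the semi-arcs.\<close>

lemma sym_colorings_eq:
  assumes Q: "symmetric_quandle X f \<rho>" and L: "link_diagram L" and ori: "diagram_orientation L ori"
  shows "sym_colorings X f \<rho> L =
    {label_class X f \<rho> L ori (oriented_label \<rho> ori A) | A. sym_assignment X f \<rho> L A}"
proof -
  let ?S = "{A. sym_assignment X f \<rho> L A}"
  let ?E = "{(A, B). sym_assignment X f \<rho> L A \<and> sym_assignment X f \<rho> L B \<and>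
    equivclp (inversion_step X f \<rho> L) A B}"
  have "sym_colorings X f \<rho> L = ?S // ?E"
    unfolding sym_colorings_def inversion_step_def[abs_def] ..
  also have "\<dots> = (\<lambda>A. ?E `` {A}) ` ?S" unfolding quotient_def by blast
  also have "\<dots> = (\<lambda>A. label_class X f \<rho> L ori (oriented_label \<rho> ori A)) ` ?S"
  proof (rule image_cong[OF HOL.refl])
    fix A assume A: "A \<in> ?S"
    show "?E `` {A} = label_class X f \<rho> L ori (oriented_label \<rho> ori A)"
    proof -
      have "B \<in> ?E `` {A} \<longleftrightarrow> B \<in> label_class X f \<rho> L ori (oriented_label \<rho> ori A)" for B
        using equivclp_inversion_iff[OF Q L ori, of A B] A unfolding label_class_def by blast
      then show ?thesis by blast
    qed
  qed
  also have "\<dots> = {label_class X f \<rho> L ori (oriented_label \<rho> ori A) | A. sym_assignment X f \<rho> L A}"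
    by blast
  finally show ?thesis .
qed


section \<open>Colorings of arcs and labelings of semi-arcs\<close>

lemma X_coloring_imp_oriented_semi_coloring:
  assumes L: "link_diagram L" and c: "X_coloring X f L ori c"
  shows "oriented_semi_coloring X f L ori (\<lambda>\<alpha>. c (arc_of L \<alpha>))"
proof -
  have cX: "c \<in> arcs L \<rightarrow>\<^sub>E X" using c by (simp add: X_coloring_def)
  have end_arc: "p \<in> arc_of L \<beta>" if "\<beta> \<in> semi_arcs L" "issues_from L \<beta> p w" "p \<in> upper_points L" for \<beta> p w
  proof -
    have "p \<in> L" using that(3) by (auto simp: upper_points_def crossing_def)
    then show ?thesis by (rule arc_of_end[OF that(1,2) _ upper_not_lower[OF L that(3)]])
  qed
  show ?thesis
    unfolding oriented_semi_coloring_def constant_over_def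
  proof (intro conjI allI ballI impI)
    show "(\<lambda>\<alpha>. c (arc_of L \<alpha>)) \<in> semi_arcs L \<rightarrow> X"
      using PiE_mem[OF cX arc_of_in_arcs] by blast
  next
    fix p w \<beta>1 \<beta>2
    assume b: "\<beta>1 \<in> semi_arcs L" "\<beta>2 \<in> semi_arcs L"
      "p \<in> upper_points L \<and> issues_from L \<beta>1 p (- w) \<and> issues_from L \<beta>2 p w"
    then have "p \<in> arc_of L \<beta>1" "p \<in> arc_of L \<beta>2" using end_arc by blast+
    then have "arc_of L \<beta>1 = arc_of L \<beta>2"
      using arc_of_in_arcs[OF b(1)] arc_of_in_arcs[OF b(2)] components_nonoverlap
      unfolding arcs_def by blast
    then show "c (arc_of L \<beta>1) = c (arc_of L \<beta>2)" by simp
  next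
    fix p q u w \<beta> \<alpha>1 \<alpha>2
    assume a: "\<beta> \<in> semi_arcs L" "\<alpha>1 \<in> semi_arcs L" "\<alpha>2 \<in> semi_arcs L"
      "crossing L p q \<and> issues_from L \<beta> p u \<and>
       issues_from L \<alpha>1 q (- w) \<and> issues_from L \<alpha>2 q w \<and> fst w \<bullet> (\<i> * ori p) > 0"
    have "p \<in> upper_points L" using a(4) unfolding upper_points_def by blast
    then have "p \<in> arc_of L \<beta>" using end_arc a(1,4) by blast
    moreover have "issues_from L (arc_of L \<alpha>1) q (- w)" "issues_from L (arc_of L \<alpha>2) q w"
      using a issues_from_mono semi_arc_subset_arc_of by blast+
    ultimately show "f (c (arc_of L \<alpha>1)) (c (arc_of L \<beta>)) = c (arc_of L \<alpha>2)"
      using c a(4) arc_of_in_arcs a(1-3) unfolding X_coloring_def by blast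
  qed
qed

text \<open>The labels are constant on arcs, so an arc can be given the label of any of its semi-arcs. Every
  crossing condition for arcs is the condition for suitable semi-arcs of these arcs, because each
  curve in the condition for arcs starts into some semi-arc.\<close>

lemma oriented_semi_coloring_imp_X_coloring:
  assumes L: "link_diagram L" and l: "oriented_semi_coloring X f L ori l"
  shows "\<exists>c. X_coloring X f L ori c \<and> (\<forall>\<alpha>\<in>semi_arcs L. c (arc_of L \<alpha>) = l \<alpha>)"
proof -
  have lX: "l \<in> semi_arcs L \<rightarrow> X" and over: "constant_over L l"
    using l by (auto simp: oriented_semi_coloring_def)
  define pick where "pick a = (SOME \<alpha>. \<alpha> \<in> semi_arcs L \<and> arc_of L \<alpha> = a)" for a
  have pick: "pick a \<in> semi_arcs L" "arc_of L (pick a) = a" if "a \<in> arcs L" for a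
  proof -
    have "\<exists>\<alpha>. \<alpha> \<in> semi_arcs L \<and> arc_of L \<alpha> = a" using ex_semi_arc_in_arc[OF L that] by blast
    from someI_ex[OF this] show "pick a \<in> semi_arcs L" "arc_of L (pick a) = a"
      unfolding pick_def by blast+
  qed
  define c where "c = (\<lambda>a\<in>arcs L. l (pick a))"
  have c: "c (arc_of L \<alpha>) = l \<alpha>" if "\<alpha> \<in> semi_arcs L" for \<alpha>
  proof -
    note a = arc_of_in_arcs[OF that]
    have "l (pick (arc_of L \<alpha>)) = l \<alpha>"
      by (rule constant_over_imp_constant_on_arc[OF L over pick(1)[OF a] that pick(2)[OF a]])
    then show ?thesis using a by (simp add: c_def)
  qed
  have "X_coloring X f L ori c"
    unfolding X_coloring_def
  proof (intro conjI allI ballI impI)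
    have "l (pick a) \<in> X" if "a \<in> arcs L" for a using lX pick(1)[OF that] by blast
    then show "c \<in> arcs L \<rightarrow>\<^sub>E X" unfolding c_def by simp
  next
    fix p q w a1 a2 b
    assume a: "a1 \<in> arcs L" "a2 \<in> arcs L" "b \<in> arcs L"
      "crossing L p q \<and> p \<in> b \<and> issues_from L a1 q (- w) \<and> issues_from L a2 q w \<and>
        fst w \<bullet> (\<i> * ori p) > 0"
    have q: "q \<in> L" using a(4) by (auto simp: crossing_def)
    obtain \<beta> u where \<beta>: "\<beta> \<in> semi_arcs L" "arc_of L \<beta> = b" "issues_from L \<beta> p u"
      using semi_arc_at_point_of_arc[OF L a(3), of p] a(4) by blast
    obtain \<alpha>1 where \<alpha>1: "\<alpha>1 \<in> semi_arcs L" "arc_of L \<alpha>1 = a1" "issues_from L \<alpha>1 q (- w)"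
      using semi_arc_issues_from_arc[OF L a(1) q] a(4) by blast
    obtain \<alpha>2 where \<alpha>2: "\<alpha>2 \<in> semi_arcs L" "arc_of L \<alpha>2 = a2" "issues_from L \<alpha>2 q w"
      using semi_arc_issues_from_arc[OF L a(2) q] a(4) by blast
    have "f (l \<alpha>1) (l \<beta>) = l \<alpha>2"
      using l a(4) \<beta>(1,3) \<alpha>1(1,3) \<alpha>2(1,3) unfolding oriented_semi_coloring_def by blast
    then show "f (c a1) (c b) = c a2"
      using c[OF \<beta>(1)] c[OF \<alpha>1(1)] c[OF \<alpha>2(1)] \<beta>(2) \<alpha>1(2) \<alpha>2(2) by simp
  qed
  then show ?thesis using c by blast
qed

text \<open>The copy \<open>X\<^sup>+\<^sup>1\<close> is a subquandle of the symmetric double isomorphic to \<open>X\<close>.\<close>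

lemma oriented_semi_coloring_double:
  "oriented_semi_coloring (double_carrier X) (double_op X f) L ori (\<lambda>\<alpha>. (l \<alpha>, True)) \<longleftrightarrow>
    oriented_semi_coloring X f L ori l"
  by (simp add: oriented_semi_coloring_def constant_over_def double_carrier_def double_op_def
    quandle_pow_def Pi_iff)

section \<open>Canonical forms over the symmetric double\<close>

lemma double_inv_double_inv: "double_inv (double_inv x) = x"
  by (simp add: double_inv_def split_beta)

text \<open>The assignment with oriented labels \<open>l\<close> and all labels in \<open>X\<^sup>+\<^sup>1\<close>: exactly the semi-arcs whose oriented
  label has sign \<open>-1\<close> are inverted, that is, carry the normal opposite to the orientation.\<close>

definition canonical_assignment ::
    "(point3 \<Rightarrow> complex) \<Rightarrow> point3 set \<Rightarrow> (point3 set \<Rightarrow> 'a \<times> bool) \<Rightarrow> ('a \<times> bool) semi_arc_assignment" where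
  "canonical_assignment ori L l =
     (\<lambda>\<alpha>\<in>semi_arcs L. if snd (l \<alpha>) then (\<lambda>p\<in>\<alpha>. \<i> * ori p, l \<alpha>)
        else (\<lambda>p\<in>\<alpha>. - (\<i> * ori p), double_inv (l \<alpha>)))"

lemma orientation_normal:
  assumes ori: "diagram_orientation L ori" and \<alpha>: "\<alpha> \<in> semi_arcs L"
  shows "(\<lambda>p\<in>\<alpha>. \<i> * ori p) \<in> normal_orientations L \<alpha>"
proof -
  have sub: "\<alpha> \<subseteq> L" using semi_arc_facts(3)[OF \<alpha>] by blast
  have o: "norm (ori p) = 1 \<and> ori p \<in> fst ` tangent_space L p" if "p \<in> \<alpha>" for p
    using ori sub that unfolding diagram_orientation_def by blast
  have "continuous_on \<alpha> ori"
    using ori sub unfolding diagram_orientation_def by (blast intro: continuous_on_subset)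
  then have "continuous_on \<alpha> (\<lambda>p. \<i> * ori p)" by (intro continuous_intros)
  moreover have "continuous_on \<alpha> (\<lambda>p\<in>\<alpha>. \<i> * ori p) \<longleftrightarrow> continuous_on \<alpha> (\<lambda>p. \<i> * ori p)"
    by (rule continuous_on_cong) simp_all
  ultimately show ?thesis using o by (simp add: normal_orientations_def norm_mult)
qed

lemma canonical_assignment:
  assumes ori: "diagram_orientation L ori" and l: "l \<in> semi_arcs L \<rightarrow> double_carrier X"
  shows "canonical_assignment ori L l
      \<in> (\<Pi>\<^sub>E \<alpha>\<in>semi_arcs L. normal_orientations L \<alpha> \<times> double_carrier X)" (is ?m)
    and "\<And>\<alpha>. \<alpha> \<in> semi_arcs L \<Longrightarrow> oriented_label double_inv ori (canonical_assignment ori L l) \<alpha> = l \<alpha>"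
    and "\<And>\<alpha>. \<alpha> \<in> semi_arcs L \<Longrightarrow> snd (snd (canonical_assignment ori L l \<alpha>)) = True"
proof -
  show ?m
  proof (rule PiE_I)
    fix \<alpha> assume \<alpha>: "\<alpha> \<in> semi_arcs L"
    have "(\<lambda>p\<in>\<alpha>. - (\<lambda>p\<in>\<alpha>. \<i> * ori p) p) = (\<lambda>p\<in>\<alpha>. - (\<i> * ori p))" by (rule restrict_ext) simp
    then have n: "(\<lambda>p\<in>\<alpha>. - (\<i> * ori p)) \<in> normal_orientations L \<alpha>"
      using neg_normal_orientation[OF orientation_normal[OF ori \<alpha>]] by simp
    have "l \<alpha> \<in> double_carrier X" using l \<alpha> by blast
    then have "double_inv (l \<alpha>) \<in> double_carrier X"
      by (simp add: double_inv_def double_carrier_def split_beta mem_Times_iff)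
    then show "canonical_assignment ori L l \<alpha> \<in> normal_orientations L \<alpha> \<times> double_carrier X"
      using n orientation_normal[OF ori \<alpha>] \<alpha> \<open>l \<alpha> \<in> double_carrier X\<close>
      by (simp add: canonical_assignment_def)
  next
    fix \<alpha> assume "\<alpha> \<notin> semi_arcs L"
    then show "canonical_assignment ori L l \<alpha> = undefined" by (simp add: canonical_assignment_def)
  qed
  fix \<alpha> assume \<alpha>: "\<alpha> \<in> semi_arcs L"
  obtain p where p: "p \<in> \<alpha>" "p \<in> L" using semi_arc_facts[OF \<alpha>] by blast
  have "- (\<i> * ori p) \<noteq> \<i> * ori p" using orientation_nonzero[OF ori p(2)] by (auto simp: complex_eq_iff)
  then have neg: "\<not> agrees ori (\<lambda>p\<in>\<alpha>. - (\<i> * ori p)) \<alpha>"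
    unfolding agrees_def using p(1) by (intro notI) (drule bspec[OF _ p(1)], simp)
  show "oriented_label double_inv ori (canonical_assignment ori L l) \<alpha> = l \<alpha>"
  proof (cases "snd (l \<alpha>)")
    case True
    then show ?thesis using \<alpha> by (simp add: oriented_label_def canonical_assignment_def agrees_def)
  next
    case False
    then show ?thesis using \<alpha> neg
      by (simp add: oriented_label_def canonical_assignment_def double_inv_double_inv)
  qed
  show "snd (snd (canonical_assignment ori L l \<alpha>)) = True"
    using \<alpha> by (simp add: canonical_assignment_def double_inv_def split_beta)
qed

abbreviation double_class where
  "double_class X f L ori l \<equiv> label_class (double_carrier X) (double_op X f) double_inv L ori l"

text \<open>Two members of a class differ on a semi-arc by at most an inversion, which changes the sign of the
  label. Hence the class has only one member with all signs \<open>+1\<close>.\<close>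

lemma canonical_form_double_class:
  assumes q: "quandle X f" and L: "link_diagram L" and ori: "diagram_orientation L ori"
    and l: "oriented_semi_coloring (double_carrier X) (double_op X f) L ori l"
  shows "canonical_assignment ori L l \<in> double_class X f L ori l"
    and "canonical_form L (double_class X f L ori l, r) = canonical_assignment ori L l"
proof -
  let ?D = "double_carrier X" and ?A = "canonical_assignment ori L l"
  note Q = symmetric_quandle_double[OF q]
  note iff = sym_assignment_iff_oriented[OF Q L ori]
  have lD: "l \<in> semi_arcs L \<rightarrow> ?D" using l by (simp add: oriented_semi_coloring_def)
  note ca = canonical_assignment[OF ori lD]
  have sA: "sym_assignment ?D (double_op X f) double_inv L ?A"
    unfolding iff using ca(1) l oriented_semi_coloring_cong[of L _ l, OF ca(2)] by blast
  show mem: "?A \<in> double_class X f L ori l" unfolding label_class_def using sA ca(2) by blast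
  have "B = ?A" if B: "B \<in> double_class X f L ori l" "\<forall>\<alpha>\<in>semi_arcs L. snd (snd (B \<alpha>)) = True" for B
  proof -
    have lab: "oriented_label double_inv ori B \<alpha> = l \<alpha>" if "\<alpha> \<in> semi_arcs L" for \<alpha>
      using B(1) that unfolding label_class_def by blast
    have sB: "sym_assignment ?D (double_op X f) double_inv L B"
      using B(1) unfolding label_class_def by blast
    have PB: "B \<in> (\<Pi>\<^sub>E \<alpha>\<in>semi_arcs L. normal_orientations L \<alpha> \<times> ?D)" using sB unfolding iff by blast
    show "B = ?A"
    proof (rule PiE_ext[OF PB ca(1)])
      fix \<alpha> assume \<alpha>: "\<alpha> \<in> semi_arcs L"
      have eq: "oriented_label double_inv ori B \<alpha> = oriented_label double_inv ori ?A \<alpha>"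
        using lab[OF \<alpha>] ca(2)[OF \<alpha>] by simp
      note cases = assignment_eq_if_labels_eq[OF L ori double_inv_double_inv PB ca(1) \<alpha> eq]
      show "B \<alpha> = ?A \<alpha>"
      proof (rule ccontr)
        assume "B \<alpha> \<noteq> ?A \<alpha>"
        then have "snd (?A \<alpha>) = double_inv (snd (B \<alpha>))" using cases by (metis snd_conv)
        then show False using ca(3)[OF \<alpha>] B(2)[rule_format, OF \<alpha>]
          by (simp add: double_inv_def split_beta)
      qed
    qed
  qed
  then show "canonical_form L (double_class X f L ori l, r) = ?A"
    unfolding canonical_form_def fst_conv using mem ca(3) by (intro the_equality) blast+
qed


section \<open>Region colorings and the bijection\<close>

lemma label_class_cong:
  assumes "\<And>\<alpha>. \<alpha> \<in> semi_arcs L \<Longrightarrow> l \<alpha> = l' \<alpha>"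
  shows "label_class X f \<rho> L ori l = label_class X f \<rho> L ori l'"
  using assms by (simp add: label_class_def)

lemma double_class_in_sym_colorings:
  assumes q: "quandle X f" and L: "link_diagram L" and ori: "diagram_orientation L ori"
    and l: "oriented_semi_coloring (double_carrier X) (double_op X f) L ori l"
  shows "double_class X f L ori l \<in> sym_colorings (double_carrier X) (double_op X f) double_inv L"
proof -
  let ?A = "canonical_assignment ori L l"
  have A: "?A \<in> double_class X f L ori l" by (rule canonical_form_double_class(1)[OF q L ori l])
  then have "double_class X f L ori l = double_class X f L ori (oriented_label double_inv ori ?A)"
    by (intro label_class_cong) (simp add: label_class_def)
  moreover have "sym_assignment (double_carrier X) (double_op X f) double_inv L ?A"
    using A by (simp add: label_class_def)
  ultimately show ?thesis unfolding sym_colorings_eq[OF symmetric_quandle_double[OF q] L ori] by blast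
qed

lemma double_act_gen:
  assumes "quandle X f" "x \<in> X"
  shows "double_act X f act r (sym_assoc_gen (double_carrier X) (double_op X f) double_inv (x, e)) =
    act r (if e then assoc_gen X f x else inv\<^bsub>assoc_group X f\<^esub> assoc_gen X f x)"
  using double_hom_gen[OF assms(1,2)] by (simp add: double_act_def)

lemma right_action_inv:
  assumes "group G" "right_action G Y act" "r \<in> Y" "g \<in> carrier G"
  shows "act (act r g) (inv\<^bsub>G\<^esub> g) = r"
proof -
  interpret group G by fact
  have "act (act r g) (inv\<^bsub>G\<^esub> g) = act r (g \<otimes>\<^bsub>G\<^esub> inv\<^bsub>G\<^esub> g)"
    using assms(2-4) inv_closed[OF assms(4)] unfolding right_action_def by metis
  also have "\<dots> = r" using assms(2,3) r_inv[OF assms(4)] unfolding right_action_def by metis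
  finally show ?thesis .
qed

lemma adjacent_at_flip: "adjacent_at p (- n) \<gamma>1 \<gamma>2 \<longleftrightarrow> adjacent_at p n \<gamma>2 \<gamma>1"
  by (simp add: adjacent_at_def conj_commute)

definition oriented_regions ::
    "'a set \<Rightarrow> ('a \<Rightarrow> 'a \<Rightarrow> 'a) \<Rightarrow> ('y \<Rightarrow> 'a word set \<Rightarrow> 'y) \<Rightarrow> point3 set \<Rightarrow>
     (point3 \<Rightarrow> complex) \<Rightarrow> (point3 set \<Rightarrow> 'a) \<Rightarrow> (complex set \<Rightarrow> 'y) \<Rightarrow> bool" where
  "oriented_regions X f act L ori l r \<longleftrightarrow>
     (\<forall>\<alpha>\<in>semi_arcs L. \<forall>p\<in>\<alpha>. \<forall>\<gamma>1\<in>regions L. \<forall>\<gamma>2\<in>regions L.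
        adjacent_at p (\<i> * ori p) \<gamma>1 \<gamma>2 \<longrightarrow> act (r \<gamma>1) (assoc_gen X f (l \<alpha>)) = r \<gamma>2)"

text \<open>The condition on regions is tested on every member of a class. A semi-arc with the normal of the
  orientation has a label \<open>x\<^sup>+\<^sup>1\<close> and gives the oriented condition; an inverted one has the label \<open>x\<^sup>-\<^sup>1\<close>, is
  crossed in the other direction and acts by the inverse group element, so that it gives the same
  condition.\<close>

lemma double_class_in_Col_double_iff:
  assumes q: "quandle X f" and act: "right_action (assoc_group X f) Y act"
    and L: "link_diagram L" and ori: "diagram_orientation L ori"
    and l: "oriented_semi_coloring X f L ori l"
  shows "(double_class X f L ori (\<lambda>\<alpha>. (l \<alpha>, True)), r) \<in> Col_double X f Y act L \<longleftrightarrow>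
    r \<in> regions L \<rightarrow>\<^sub>E Y \<and> oriented_regions X f act L ori l r"
proof -
  let ?D = "double_carrier X" and ?l = "\<lambda>\<alpha>. (l \<alpha>, True)"
  let ?K = "double_class X f L ori ?l" and ?A = "canonical_assignment ori L ?l"
  let ?gen = "sym_assoc_gen ?D (double_op X f) double_inv"
  let ?inv = "\<lambda>x. inv\<^bsub>assoc_group X f\<^esub> x"
  have l2: "oriented_semi_coloring ?D (double_op X f) L ori ?l"
    using l by (simp add: oriented_semi_coloring_double)
  have lX: "l \<alpha> \<in> X" if "\<alpha> \<in> semi_arcs L" for \<alpha>
    using l that unfolding oriented_semi_coloring_def by blast
  have A: "?A \<in> ?K" by (rule canonical_form_double_class(1)[OF q L ori l2])
  note iff = sym_assignment_iff_oriented[OF symmetric_quandle_double[OF q] L ori]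
  have "(\<forall>A\<in>?K. \<forall>\<alpha>\<in>semi_arcs L. \<forall>p\<in>\<alpha>. \<forall>\<gamma>1\<in>regions L. \<forall>\<gamma>2\<in>regions L.
           adjacent_at p (fst (A \<alpha>) p) \<gamma>1 \<gamma>2
           \<longrightarrow> double_act X f act (r \<gamma>1) (?gen (snd (A \<alpha>))) = r \<gamma>2) \<longleftrightarrow>
        oriented_regions X f act L ori l r" (is "?lhs \<longleftrightarrow> _") if r: "r \<in> regions L \<rightarrow>\<^sub>E Y"
  proof
    assume lhs: ?lhs
    show "oriented_regions X f act L ori l r"
      unfolding oriented_regions_def
    proof (intro ballI impI)
      fix \<alpha> p \<gamma>1 \<gamma>2
      assume a: "\<alpha> \<in> semi_arcs L" "p \<in> \<alpha>" "\<gamma>1 \<in> regions L" "\<gamma>2 \<in> regions L"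
        "adjacent_at p (\<i> * ori p) \<gamma>1 \<gamma>2"
      have "?A \<alpha> = (\<lambda>p\<in>\<alpha>. \<i> * ori p, (l \<alpha>, True))"
        using a(1) by (simp add: canonical_assignment_def)
      then show "act (r \<gamma>1) (assoc_gen X f (l \<alpha>)) = r \<gamma>2"
        using lhs[rule_format, OF A a(1-4)] a(2,5)
          double_act_gen[OF q lX[OF a(1)], where act = act and r = "r \<gamma>1" and e = True]
        by simp
    qed
  next
    assume o: "oriented_regions X f act L ori l r"
    show ?lhs
    proof (intro ballI impI)
      fix B \<alpha> p \<gamma>1 \<gamma>2
      assume B: "B \<in> ?K" and a: "\<alpha> \<in> semi_arcs L" "p \<in> \<alpha>" "\<gamma>1 \<in> regions L" "\<gamma>2 \<in> regions L"
        and adj: "adjacent_at p (fst (B \<alpha>) p) \<gamma>1 \<gamma>2"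
      have "sym_assignment ?D (double_op X f) double_inv L B"
        and lab: "oriented_label double_inv ori B \<alpha> = (l \<alpha>, True)"
        using B a(1) unfolding label_class_def by blast+
      then have \<nu>: "fst (B \<alpha>) \<in> normal_orientations L \<alpha>"
        using a(1) unfolding iff by (auto simp: PiE_def Pi_def mem_Times_iff)
      show "double_act X f act (r \<gamma>1) (?gen (snd (B \<alpha>))) = r \<gamma>2"
      proof (cases "agrees ori (fst (B \<alpha>)) \<alpha>")
        case True
        then have "snd (B \<alpha>) = (l \<alpha>, True)" "fst (B \<alpha>) p = \<i> * ori p"
          using lab a(2) by (simp_all add: oriented_label_def agrees_def)
        then show ?thesis
          using o[unfolded oriented_regions_def, rule_format, OF a] adj
            double_act_gen[OF q lX[OF a(1)], where act = act and r = "r \<gamma>1" and e = True] by simp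
      next
        case False
        have "double_inv (snd (B \<alpha>)) = (l \<alpha>, True)" using lab False by (simp add: oriented_label_def)
        then have snd: "snd (B \<alpha>) = (l \<alpha>, False)" by (cases "snd (B \<alpha>)") (simp add: double_inv_def)
        have "fst (B \<alpha>) p = - (\<i> * ori p)"
          by (rule normal_orientation_cases[OF L ori a(1) \<nu> False a(2)])
        then have "adjacent_at p (\<i> * ori p) \<gamma>2 \<gamma>1" using adj by (simp add: adjacent_at_flip)
        then have "act (r \<gamma>2) (assoc_gen X f (l \<alpha>)) = r \<gamma>1"
          using o a unfolding oriented_regions_def by blast
        then have "act (r \<gamma>1) (?inv (assoc_gen X f (l \<alpha>))) = r \<gamma>2"
          using right_action_inv[OF group_assoc_group act, of "r \<gamma>2"] PiE_mem[OF r a(4)]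
            assoc_gen_closed[OF lX[OF a(1)]] by metis
        then show ?thesis 
          using double_act_gen[OF q lX[OF a(1)], where act = act and r = "r \<gamma>1" and e = False] snd by simp
      qed
    qed
  qed
  then show ?thesis
    unfolding Col_double_def Col_sym_def using double_class_in_sym_colorings[OF q L ori l2] by blast
qed

text \<open>An arc without its upper points is the union of its semi-arcs.\<close>

lemma oriented_regions_arcs:
  "oriented_regions X f act L ori (\<lambda>\<alpha>. c (arc_of L \<alpha>)) r \<longleftrightarrow>
    (\<forall>a\<in>arcs L. \<forall>p\<in>a - upper_points L. \<forall>\<gamma>1\<in>regions L. \<forall>\<gamma>2\<in>regions L.
       adjacent_at p (\<i> * ori p) \<gamma>1 \<gamma>2 \<longrightarrow> act (r \<gamma>1) (assoc_gen X f (c a)) = r \<gamma>2)"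
  (is "?l \<longleftrightarrow> ?r")
proof
  assume l: ?l
  show ?r
  proof (intro ballI impI)
    fix a p \<gamma>1 \<gamma>2
    assume a: "a \<in> arcs L" "p \<in> a - upper_points L" "\<gamma>1 \<in> regions L" "\<gamma>2 \<in> regions L"
      "adjacent_at p (\<i> * ori p) \<gamma>1 \<gamma>2"
    have "p \<in> L - lower_points L" using a(1,2) in_components_subset unfolding arcs_def by blast
    then obtain \<alpha> where \<alpha>: "\<alpha> \<in> semi_arcs L" "p \<in> \<alpha>" using ex_semi_arc[of p L] a(2) by blast
    then have "arc_of L \<alpha> = a" using arc_of_eqI[OF \<alpha>(1) a(1) \<alpha>(2)] a(2) by blast
    then show "act (r \<gamma>1) (assoc_gen X f (c a)) = r \<gamma>2"
      using l[unfolded oriented_regions_def, rule_format, OF \<alpha> a(3-5)] by simp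
  qed
next
  assume r: ?r
  show ?l
    unfolding oriented_regions_def
  proof (intro ballI impI)
    fix \<alpha> p \<gamma>1 \<gamma>2
    assume a: "\<alpha> \<in> semi_arcs L" "p \<in> \<alpha>" "\<gamma>1 \<in> regions L" "\<gamma>2 \<in> regions L"
      "adjacent_at p (\<i> * ori p) \<gamma>1 \<gamma>2"
    have "p \<in> arc_of L \<alpha> - upper_points L"
      using semi_arc_subset_arc_of[OF a(1)] semi_arc_facts(3)[OF a(1)] a(2) by blast
    then show "act (r \<gamma>1) (assoc_gen X f (c (arc_of L \<alpha>))) = r \<gamma>2"
      using r arc_of_in_arcs[OF a(1)] a(3-5) by blast
  qed
qed

text \<open>The coloring with the labels of the semi-arcs inherited from the arcs, in the copy \<open>X\<^sup>+\<^sup>1\<close>, with respect to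
  the normals given by the orientation.\<close>

definition double_coloring ::
    "'a set \<Rightarrow> ('a \<Rightarrow> 'a \<Rightarrow> 'a) \<Rightarrow> point3 set \<Rightarrow> (point3 \<Rightarrow> complex) \<Rightarrow>
     (point3 set \<Rightarrow> 'a) \<times> (complex set \<Rightarrow> 'y) \<Rightarrow> ('a \<times> bool, 'y) sym_region_coloring" where
  "double_coloring X f L ori = (\<lambda>(c, r). (double_class X f L ori (\<lambda>\<alpha>. (c (arc_of L \<alpha>), True)), r))"

lemma Col_XY_iff:
  assumes q: "quandle X f" and act: "right_action (assoc_group X f) Y act"
    and L: "link_diagram L" and ori: "diagram_orientation L ori"
  shows "(c, r) \<in> Col_XY X f Y act L ori \<longleftrightarrow>
    X_coloring X f L ori c \<and> double_coloring X f L ori (c, r) \<in> Col_double X f Y act L"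
proof (cases "X_coloring X f L ori c")
  case True
  note l = X_coloring_imp_oriented_semi_coloring[OF L True]
  show ?thesis
    unfolding double_coloring_def prod.case double_class_in_Col_double_iff[OF q act L ori l]
    using True by (simp add: Col_XY_def oriented_regions_arcs)
qed (simp add: Col_XY_def)

lemma induces_orientation_double_coloring:
  assumes q: "quandle X f" and L: "link_diagram L" and ori: "diagram_orientation L ori"
    and c: "X_coloring X f L ori c"
  shows "induces_orientation L (double_coloring X f L ori (c, r)) ori"
proof -
  have l: "oriented_semi_coloring (double_carrier X) (double_op X f) L ori (\<lambda>\<alpha>. (c (arc_of L \<alpha>), True))"
    using X_coloring_imp_oriented_semi_coloring[OF L c] by (simp add: oriented_semi_coloring_double)
  show ?thesis
    unfolding induces_orientation_def double_coloring_def prod.case canonical_form_double_class(2)[OF q L ori l]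
    using ori by (simp add: canonical_assignment_def)
qed

text \<open>The class determines the oriented labels of its members, and every arc contains a semi-arc.\<close>

lemma double_coloring_inj:
  assumes q: "quandle X f" and L: "link_diagram L" and ori: "diagram_orientation L ori"
    and c: "X_coloring X f L ori c" "X_coloring X f L ori c'"
    and eq: "double_coloring X f L ori (c, r) = double_coloring X f L ori (c', r')"
  shows "(c, r) = (c', r')"
proof -
  let ?l = "\<lambda>\<alpha>. (c (arc_of L \<alpha>), True)" and ?l' = "\<lambda>\<alpha>. (c' (arc_of L \<alpha>), True)"
  have l: "oriented_semi_coloring (double_carrier X) (double_op X f) L ori ?l"
    using X_coloring_imp_oriented_semi_coloring[OF L c(1)] by (simp add: oriented_semi_coloring_double)
  have "double_class X f L ori ?l = double_class X f L ori ?l'" and r: "r = r'"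
    using eq by (simp_all add: double_coloring_def)
  moreover have "canonical_assignment ori L ?l \<in> double_class X f L ori ?l"
    by (rule canonical_form_double_class(1)[OF q L ori l])
  ultimately have *: "canonical_assignment ori L ?l \<in> double_class X f L ori ?l"
    "canonical_assignment ori L ?l \<in> double_class X f L ori ?l'" by simp_all
  have semi: "c (arc_of L \<alpha>) = c' (arc_of L \<alpha>)" if "\<alpha> \<in> semi_arcs L" for \<alpha>
  proof -
    have "oriented_label double_inv ori (canonical_assignment ori L ?l) \<alpha> = ?l \<alpha>"
      "oriented_label double_inv ori (canonical_assignment ori L ?l) \<alpha> = ?l' \<alpha>"
      using * that unfolding label_class_def by blast+
    then show ?thesis by simp
  qed
  have "c \<in> arcs L \<rightarrow>\<^sub>E X" "c' \<in> arcs L \<rightarrow>\<^sub>E X" using c by (simp_all add: X_coloring_def)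
  then have "c = c'"
  proof (rule PiE_ext)
    fix a assume "a \<in> arcs L"
    then obtain \<alpha> where "\<alpha> \<in> semi_arcs L" "arc_of L \<alpha> = a" using ex_semi_arc_in_arc[OF L] by blast
    then show "c a = c' a" using semi by blast
  qed
  then show ?thesis using r by simp
qed

text \<open>If the canonical form has the normals given by \<open>ori\<close>, no semi-arc was inverted to reach it, so all
  oriented labels lie in \<open>X\<^sup>+\<^sup>1\<close> and come from an \<open>X\<close>-coloring.\<close>

lemma double_coloring_surj:
  assumes q: "quandle X f" and L: "link_diagram L" and ori: "diagram_orientation L ori"
    and C': "C' \<in> Col_double X f Y act L"
    and normal: "\<And>\<alpha> p. \<alpha> \<in> semi_arcs L \<Longrightarrow> p \<in> \<alpha> \<Longrightarrow> fst (canonical_form L C' \<alpha>) p = \<i> * ori p"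
  shows "\<exists>c r. X_coloring X f L ori c \<and> C' = double_coloring X f L ori (c, r)"
proof -
  obtain K r where C'_eq: "C' = (K, r)" and
    K: "K \<in> sym_colorings (double_carrier X) (double_op X f) double_inv L"
    using C' unfolding Col_double_def Col_sym_def by blast
  note Q = symmetric_quandle_double[OF q]
  obtain A where A: "sym_assignment (double_carrier X) (double_op X f) double_inv L A"
    and K_eq: "K = double_class X f L ori (oriented_label double_inv ori A)"
    using K unfolding sym_colorings_eq[OF Q L ori] by blast
  define l where "l = oriented_label double_inv ori A"
  have l: "oriented_semi_coloring (double_carrier X) (double_op X f) L ori l"
    using A unfolding l_def sym_assignment_iff_oriented[OF Q L ori] by blast
  have canon: "canonical_form L C' = canonical_assignment ori L l"
    unfolding C'_eq K_eq l_def[symmetric] by (rule canonical_form_double_class(2)[OF q L ori l])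
  have True: "l \<alpha> = (fst (l \<alpha>), True)" if \<alpha>: "\<alpha> \<in> semi_arcs L" for \<alpha>
  proof (rule ccontr)
    assume "l \<alpha> \<noteq> (fst (l \<alpha>), True)"
    then have "\<not> snd (l \<alpha>)" by (cases "l \<alpha>") simp
    obtain p where p: "p \<in> \<alpha>" "p \<in> L" using semi_arc_facts[OF \<alpha>] by blast
    have "- (\<i> * ori p) = \<i> * ori p"
      using normal[OF \<alpha> p(1)] \<open>\<not> snd (l \<alpha>)\<close> \<alpha> p(1) by (simp add: canon canonical_assignment_def)
    then show False using orientation_nonzero[OF ori p(2)] by (auto simp: complex_eq_iff)
  qed
  have "oriented_semi_coloring (double_carrier X) (double_op X f) L ori (\<lambda>\<alpha>. (fst (l \<alpha>), True))"
    using l oriented_semi_coloring_cong[of L l "\<lambda>\<alpha>. (fst (l \<alpha>), True)", OF True] by blast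
  then have "oriented_semi_coloring X f L ori (\<lambda>\<alpha>. fst (l \<alpha>))"
    by (simp only: oriented_semi_coloring_double)
  then obtain c where c: "X_coloring X f L ori c" "\<And>\<alpha>. \<alpha> \<in> semi_arcs L \<Longrightarrow> c (arc_of L \<alpha>) = fst (l \<alpha>)"
    using oriented_semi_coloring_imp_X_coloring[OF L] by blast
  have "K = double_class X f L ori (\<lambda>\<alpha>. (c (arc_of L \<alpha>), True))"
    unfolding K_eq l_def[symmetric] by (rule label_class_cong) (use True c(2) in simp)
  then show ?thesis using c(1) C'_eq by (auto simp: double_coloring_def)
qed

theorem theorem5p7:
  fixes X :: "'a set" and f :: "'a \<Rightarrow> 'a \<Rightarrow> 'a"
    and Y :: "'y set" and act :: "'y \<Rightarrow> 'a word set \<Rightarrow> 'y"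
    and L :: "point3 set" and ori :: "point3 \<Rightarrow> complex"
    and C :: "('a \<times> bool, 'y) sym_region_coloring"
  assumes "quandle X f"
    and "right_action (assoc_group X f) Y act"
    and "link_diagram L"
    and "diagram_orientation L ori"
    and "C \<in> Col_double X f Y act L"
    and "induces_orientation L C ori"
  shows "(\<exists>\<phi>. bij_betw \<phi> (Col_XY X f Y act L ori) (ori_equiv X f Y act L `` {C})) \<and>
    (card_of (Col_XY X f Y act L ori), card_of (ori_equiv X f Y act L `` {C})) \<in> ordIso \<and>
    card (Col_XY X f Y act L ori) = card (ori_equiv X f Y act L `` {C})"
proof -
  note q = assms(1) and act = assms(2) and L = assms(3) and ori = assms(4)
  let ?\<phi> = "double_coloring X f L ori :: _ \<Rightarrow> ('a \<times> bool, 'y) sym_region_coloring"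
  note iff = Col_XY_iff[OF q act L ori]
  have bij: "bij_betw ?\<phi> (Col_XY X f Y act L ori) (ori_equiv X f Y act L `` {C})"
    unfolding bij_betw_def
  proof (intro conjI subset_antisym subsetI)
    show "inj_on ?\<phi> (Col_XY X f Y act L ori)"
    proof (rule inj_onI)
      fix x y assume xy: "x \<in> Col_XY X f Y act L ori" "y \<in> Col_XY X f Y act L ori" "?\<phi> x = ?\<phi> y"
      obtain c r c' r' where [simp]: "x = (c, r)" "y = (c', r')" by (cases x, cases y) blast
      show "x = y" using double_coloring_inj[OF q L ori, of c c' r r'] xy by (simp add: iff)
    qed
  next
    fix C' assume "C' \<in> ?\<phi> ` Col_XY X f Y act L ori"
    then obtain c r where "(c, r) \<in> Col_XY X f Y act L ori" "C' = ?\<phi> (c, r)" by auto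
    then show "C' \<in> ori_equiv X f Y act L `` {C}"
      using induces_orientation_double_coloring[OF q L ori] assms(5,6)
      unfolding iff ori_equiv_def by blast
  next
    fix C' assume "C' \<in> ori_equiv X f Y act L `` {C}"
    then obtain ori' where C': "C' \<in> Col_double X f Y act L" "induces_orientation L C ori'"
      "induces_orientation L C' ori'"
      unfolding ori_equiv_def by blast
    \<comment> \<open>Both \<open>ori\<close> and \<open>ori'\<close> describe the normals of the canonical form of \<open>C\<close>, so they agree on semi-arcs.\<close>
    have "fst (canonical_form L C' \<alpha>) p = \<i> * ori p" if "\<alpha> \<in> semi_arcs L" "p \<in> \<alpha>" for \<alpha> p
      using assms(6) C'(2,3) that unfolding induces_orientation_def by metis
    from double_coloring_surj[OF q L ori C'(1) this]
    obtain c r where "X_coloring X f L ori c" "C' = ?\<phi> (c, r)" by blast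
    then show "C' \<in> ?\<phi> ` Col_XY X f Y act L ori" using C'(1) iff by blast
  qed
  then show ?thesis
    using card_of_ordIsoI[OF bij] bij_betw_same_card[OF bij] by (intro conjI exI)
qed

end
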